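(* Let $k$ be a non-Archimedean local field of characteristic different from $2$ which is not an extension of $\mathbb{Q}_2$, let $n\geq 1$ be an integer, and let $\theta\in\mathcal{O}_k^\times$. The quantization map $\mathbf{\Omega}_\theta:\mathcal{D}'(X_n)\to\mathcal{L}(\mathcal{D}(U_n),\mathcal{D}'(U_n))$ restricts to a continuous linear mapping from the symbol space $\mathcal{B}(X_n)$ to the space of bounded operators $\mathcal{B}(L^2(U_n))$. More precisely, for each real $s<-2$ and each $F\in\mathcal{B}(X_n)$, we have the operator norm estimate $$\|\mathbf{\Omega}_\theta(F)\|\leq\big(q^n+\|\mu_0^{s+1}\|_1\big)\,\|J^{-s}F\|_\infty,$$ where $\|\mu_0^{s+1}\|_1$ is the norm in $L^1(k)$.
   Context: Field: $|\cdot|_k$ is the normalized absolute value (module function) of $k$, $\mathcal{O}_k$ the ring of integers, $\mathcal{O}_k^\times$ its units, $\varpi$ a uniformizer, $q$ the cardinality of the residue field, so $|\varpi|_k=q^{-1}$. $\Psi$ is a fixed unitary character of $(k,+)$ trivial on $\mathcal{O}_k$ but not on $\varpi^{-1}\mathcal{O}_k$, and $\Psi_\theta(t)=\Psi(\theta t)$. Groups: $U_n=1+\varpi^n\mathcal{O}_k$ (multiplicative group), $\Gamma_n=k/\varpi^{-n}\mathcal{O}_k$ (discrete, classes $[t]$), and $X_n=U_n\ltimes\Gamma_n$ with law $(u,[t])(u',[t'])=(uu',[u'^{-1}t+t'])$. Measures: $dt$ is the Haar measure of $k$ with $\mathrm{Vol}(\mathcal{O}_k)=1$; $U_n$ carries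 its restriction; $\Gamma_n$ the counting measure; $X_n$ the product measure $d[g]$. Inner products are antilinear in the first variable. Test functions: for $Y=k,U_n,X_n$, $\mathcal{D}(Y)$ is the space of locally constant compactly supported complex functions on $Y$ and $\mathcal{D}'(Y)$ its dual with the weak dual topology, pairing $\langle T|\varphi\rangle$ (bilinear). Locally integrable functions are viewed as distributions. $\mathcal{L}(\mathcal{D}(U_n),\mathcal{D}'(U_n))$ is the space of continuous linear maps. $\mathcal{F}_kf(s)=\int_kf(t)\Psi(st)\,dt$, extended to $\mathcal{D}'(k)$ by $\langle\mathcal{F}_kT|\varphi\rangle=\langle T|\mathcal{F}_k\varphi\rangle$. Quantization: $\phi:U_n\to\varpi^n\mathcal{O}_k$, $\phi(u)=u-u^{-1}$. For $[g]=(u,[t])\in X_n$ let $\Omega_\theta([g])$ be the operator on $L^2(U_n)$ given by $\Omega_\theta([g])\varphi(u_0)=\Psi_\theta(\phi(uu_0^{-1})t)\,\varphi(u^2u_0^{-1})$. For $\varphi_1,\varphi_2\in L^2(U_n)$ put $W^\theta_{\varphi_1,\varphi_2}([g])=\langle\varphi_1,\Omega_\theta([g])\varphi_2\rangle$; for $\varphi_1,\varphi_2\in\mathcal{D}(U_n)$ it belongs to $\mathcal{D}(X_n)$. For $F\in\mathcal{D}'(X_n)$, $\mathbf{\Omega}_\theta(F):\mathcal{D}(U_n)\to\mathcal{D}'(U_n)$ is defined by $\langle\mathbf{\Omega}_\theta(F)\varphi_2|\varphi_1\rangle=|\theta|_k\,q^n\,\langle F|W^\theta_{\overline{\varphi_1},\varphi_2}\rangle$.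 Saying that $\mathbf{\Omega}_\theta(F)$ is a bounded operator on $L^2(U_n)$ means that it extends from the dense subspace $\mathcal{D}(U_n)$ to an element of $\mathcal{B}(L^2(U_n))$ (with $L^2(U_n)\subset\mathcal{D}'(U_n)$). Symbol space: $\mu_0(t)=\max(1,|\varpi^nt|_k)$ on $k$. For $s\in\mathbb{R}$ the distribution $\mathcal{F}_k(\overline{\Psi}\mu_0^s)$ is supported in $U_n$, is viewed as an element of $\mathcal{D}'(U_n)$, and $J^s$ is the operator $J^s=\int_{U_n}\mathcal{F}_k(\overline{\Psi}\mu_0^s)(u)\,\rho_{(u,[0])}\,du$ on $\mathcal{D}(X_n)$, where $\rho_{[g]}f([h])=f([h][g])$; i.e. $(J^s\varphi)(u_0,[t_0])=\langle\mathcal{F}_k(\overline{\Psi}\mu_0^s)\,|\,u\mapsto\varphi(u_0u,[u^{-1}t_0])\rangle$. It is extended to $\mathcal{D}'(X_n)$ by $\langle J^sF|\varphi\rangle=\langle F|J^s\varphi\rangle$. Then $\mathcal{B}(X_n)=\{F\in\mathcal{D}'(X_n):J^jF\in L^\infty(X_n)\ \forall j\in\mathbb{N}\}$, where $0\in\mathbb{N}$, topologized by the seminorms $F\mapsto\|J^jF\|_\infty$, $j\in\mathbb{N}$. *)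

theory Defs
  imports "HOL-Analysis.Analysis" "HOL-Library.Function_Algebras"
    "HOL-Computational_Algebra.Computational_Algebra"
begin

section \<open>Non-Archimedean local fields\<close>

text \<open>
  The library's \<open>norm\<close> is not used for the absolute value because its type is constrained to real
  normed vector spaces. Positivity and definiteness of \<open>absk\<close> follow from \<open>absk_dist\<close>.
\<close>

class complete_ultrametric_field = field + complete_space +
  fixes absk :: "'a \<Rightarrow> real"
  assumes absk_dist: "dist x y = absk (x - y)"
    and absk_mult: "absk (x * y) = absk x * absk y"
    and absk_ultrametric: "absk (x + y) \<le> max (absk x) (absk y)"
begin

definition integers :: "'a set" where
  "integers = {x. absk x \<le> 1}"

definition residue_field :: "'a set set" where
  "residue_field = integers // {(x, y). x \<in> integers \<and> y \<in> integers \<and> absk (x - y) < 1}"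

definition is_uniformizer :: "'a \<Rightarrow> bool" where
  "is_uniformizer p \<longleftrightarrow> p \<noteq> 0 \<and> {x. absk x < 1} = {p * y | y. y \<in> integers}"

end

text \<open>
  A non-Archimedean local field is a complete discretely valued field with finite residue field, of
  cardinality \<open>q\<close> say. The absolute value is the normalized one, equal to \<open>1/q\<close> at uniformizers.
\<close>

class nonarch_local_field = complete_ultrametric_field +
  assumes finite_residue_field: "finite residue_field"
    and absk_normalized: "\<exists>p. is_uniformizer p \<and> absk p = 1 / real (card residue_field)"

definition padic_abs :: "nat \<Rightarrow> rat \<Rightarrow> real" where
  "padic_abs p r = (if r = 0 then 0 else
     real p powi (int (multiplicity (int p) (snd (quotient_of r)))
                - int (multiplicity (int p) (fst (quotient_of r)))))"

text \<open>
  \<open>K\<close> is a subfield of the ambient field which is a copy of \<open>\<rat>\<^sub>p\<close>: a completion of the rationals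
  with respect to the \<open>p\<close>-adic absolute value. The absolute value \<open>w\<close> on \<open>K\<close> is not required to be
  related to any given topology of the ambient field.
\<close>

definition is_copy_of_Qp :: "nat \<Rightarrow> 'a::field set \<Rightarrow> bool" where
  "is_copy_of_Qp p K \<longleftrightarrow>
     1 \<in> K \<and> (\<forall>x\<in>K. \<forall>y\<in>K. x - y \<in> K \<and> x * y \<in> K) \<and> (\<forall>x\<in>K. inverse x \<in> K) \<and>
     (\<exists>(w :: 'a \<Rightarrow> real) (\<iota> :: rat \<Rightarrow> 'a).
        (\<forall>x\<in>K. 0 \<le> w x \<and> (w x = 0 \<longleftrightarrow> x = 0)) \<and>
        (\<forall>x\<in>K. \<forall>y\<in>K. w (x * y) = w x * w y \<and> w (x + y) \<le> w x + w y) \<and>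
        (\<forall>X :: nat \<Rightarrow> 'a. range X \<subseteq> K \<and> (\<forall>e>0. \<exists>N. \<forall>i\<ge>N. \<forall>j\<ge>N. w (X i - X j) < e) \<longrightarrow>
           (\<exists>x\<in>K. (\<lambda>i. w (X i - x)) \<longlonglongrightarrow> 0)) \<and>
        range \<iota> \<subseteq> K \<and> \<iota> 1 = 1 \<and>
        (\<forall>r s. \<iota> (r + s) = \<iota> r + \<iota> s \<and> \<iota> (r * s) = \<iota> r * \<iota> s) \<and>
        (\<forall>r. w (\<iota> r) = padic_abs p r) \<and>
        (\<forall>x\<in>K. \<forall>e>0. \<exists>r. w (x - \<iota> r) < e))"

definition extends_Qp :: "nat \<Rightarrow> 'a::field itself \<Rightarrow> bool" where
  "extends_Qp p _ \<longleftrightarrow> (\<exists>K :: 'a set. is_copy_of_Qp p K)"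


section \<open>Spaces of complex functions, distributions and operators\<close>

text \<open>
  Test functions, distributions and maps into distributions are all curried functions into
  \<^typ>\<open>complex\<close>, with pointwise operations.
\<close>

class cscale =
  fixes cscale :: "complex \<Rightarrow> 'a \<Rightarrow> 'a"  (infixr "*\<^sub>c" 75)

instantiation complex :: cscale
begin
definition cscale_complex :: "complex \<Rightarrow> complex \<Rightarrow> complex" where
  "cscale_complex c z = c * z"
instance ..
end

instantiation "fun" :: (type, cscale) cscale
begin
definition cscale_fun :: "complex \<Rightarrow> ('a \<Rightarrow> 'b) \<Rightarrow> 'a \<Rightarrow> 'b" where
  "cscale_fun c f = (\<lambda>x. c *\<^sub>c f x)"
instance ..
end

definition clinear_on :: "'v::{plus,cscale} set \<Rightarrow> ('v \<Rightarrow> 'w::{plus,cscale}) \<Rightarrow> bool" where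
  "clinear_on V T \<longleftrightarrow>
     (\<forall>x\<in>V. \<forall>y\<in>V. T (x + y) = T x + T y) \<and> (\<forall>c. \<forall>x\<in>V. T (c *\<^sub>c x) = c *\<^sub>c T x)"

definition seminorm_on :: "'v::{plus,cscale} set \<Rightarrow> ('v \<Rightarrow> real) \<Rightarrow> bool" where
  "seminorm_on V p \<longleftrightarrow>
     (\<forall>x\<in>V. 0 \<le> p x) \<and> (\<forall>x\<in>V. \<forall>y\<in>V. p (x + y) \<le> p x + p y) \<and>
     (\<forall>c. \<forall>x\<in>V. p (c *\<^sub>c x) = cmod c * p x)"

definition seminorm_topology :: "'v::minus set \<Rightarrow> ('v \<Rightarrow> real) set \<Rightarrow> 'v topology" where
  "seminorm_topology V P =
     topology_generated_by (insert V {{y \<in> V. p (y - x) < e} | p x e. p \<in> P \<and> x \<in> V \<and> 0 < e})"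

text \<open>Functions on \<open>topspace Y\<close> are extended by zero to the whole type.\<close>

definition test_functions :: "'y topology \<Rightarrow> ('y \<Rightarrow> complex) set" where
  "test_functions Y = {f.
     (\<forall>x\<in>topspace Y. \<exists>V. openin Y V \<and> x \<in> V \<and> (\<forall>y\<in>V. f y = f x)) \<and>
     compactin Y (Y closure_of {x \<in> topspace Y. f x \<noteq> 0}) \<and>
     (\<forall>x. x \<notin> topspace Y \<longrightarrow> f x = 0)}"

text \<open>
  The usual (Bruhat) topology on test functions of a totally disconnected space is the locally
  convex inductive limit of finite-dimensional subspaces, i.e. the finest locally convex topology:
  the one given by all seminorms.
\<close>

definition test_topology :: "'y topology \<Rightarrow> ('y \<Rightarrow> complex) topology" where
  "test_topology Y =
     seminorm_topology (test_functions Y) {p. seminorm_on (test_functions Y) p}"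

text \<open>Distributions are given the value zero outside the test functions.\<close>

definition distributions :: "'y topology \<Rightarrow> (('y \<Rightarrow> complex) \<Rightarrow> complex) set" where
  "distributions Y = {T. clinear_on (test_functions Y) T \<and>
     continuous_map (test_topology Y) euclidean T \<and> (\<forall>f. f \<notin> test_functions Y \<longrightarrow> T f = 0)}"

definition weak_dual_topology :: "'y topology \<Rightarrow> (('y \<Rightarrow> complex) \<Rightarrow> complex) topology" where
  "weak_dual_topology Y =
     seminorm_topology (distributions Y) {\<lambda>T. cmod (T f) | f. f \<in> test_functions Y}"

text \<open>The space \<open>\<L>(\<D>(Y), \<D>'(Y))\<close>.\<close>

definition distribution_operators ::
  "'y topology \<Rightarrow> (('y \<Rightarrow> complex) \<Rightarrow> ('y \<Rightarrow> complex) \<Rightarrow> complex) set" where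
  "distribution_operators Y = {A. clinear_on (test_functions Y) A \<and>
     continuous_map (test_topology Y) (weak_dual_topology Y) A \<and>
     (\<forall>f. f \<notin> test_functions Y \<longrightarrow> A f = 0)}"

definition distribution_of_function ::
  "'y topology \<Rightarrow> 'y measure \<Rightarrow> ('y \<Rightarrow> complex) \<Rightarrow> ('y \<Rightarrow> complex) \<Rightarrow> complex" where
  "distribution_of_function Y M f =
     (\<lambda>\<phi>. if \<phi> \<in> test_functions Y then \<integral>x. f x * \<phi> x \<partial>M else 0)"

definition in_Linf :: "'y topology \<Rightarrow> 'y measure \<Rightarrow> (('y \<Rightarrow> complex) \<Rightarrow> complex) \<Rightarrow> bool" where
  "in_Linf Y M T \<longleftrightarrow> (\<exists>f C. f \<in> borel_measurable M \<and> (AE x in M. cmod (f x) \<le> C) \<and>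
     T = distribution_of_function Y M f)"

text \<open>Only meaningful for \<open>T\<close> with \<^term>\<open>in_Linf Y M T\<close>: the essential supremum of the function
  (unique almost everywhere) that \<open>T\<close> is given by.\<close>

definition Linf_norm :: "'y topology \<Rightarrow> 'y measure \<Rightarrow> (('y \<Rightarrow> complex) \<Rightarrow> complex) \<Rightarrow> real" where
  "Linf_norm Y M T = Inf {C. 0 \<le> C \<and> (\<exists>f. f \<in> borel_measurable M \<and>
     (AE x in M. cmod (f x) \<le> C) \<and> T = distribution_of_function Y M f)}"

definition L1_norm :: "'y measure \<Rightarrow> ('y \<Rightarrow> real) \<Rightarrow> real" where
  "L1_norm M f = (\<integral>x. \<bar>f x\<bar> \<partial>M)"

text \<open>Elements of \<open>L\<^sup>2\<close> are represented by square-integrable functions; bounded operators act on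
  representatives, and linearity holds up to almost everywhere equality. (The norm bound implies
  that they respect almost everywhere equality.)\<close>

definition L2_functions :: "'y measure \<Rightarrow> ('y \<Rightarrow> complex) set" where
  "L2_functions M = {f \<in> borel_measurable M. integrable M (\<lambda>x. (cmod (f x))\<^sup>2)}"

definition L2_inner :: "'y measure \<Rightarrow> ('y \<Rightarrow> complex) \<Rightarrow> ('y \<Rightarrow> complex) \<Rightarrow> complex" where
  "L2_inner M f g = (\<integral>x. cnj (f x) * g x \<partial>M)"

definition L2_norm :: "'y measure \<Rightarrow> ('y \<Rightarrow> complex) \<Rightarrow> real" where
  "L2_norm M f = sqrt (\<integral>x. (cmod (f x))\<^sup>2 \<partial>M)"

definition bounded_L2_operator :: "'y measure \<Rightarrow> (('y \<Rightarrow> complex) \<Rightarrow> 'y \<Rightarrow> complex) \<Rightarrow> bool" where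
  "bounded_L2_operator M A \<longleftrightarrow>
     (\<forall>f\<in>L2_functions M. A f \<in> L2_functions M) \<and>
     (\<forall>f\<in>L2_functions M. \<forall>g\<in>L2_functions M. AE x in M. A (f + g) x = A f x + A g x) \<and>
     (\<forall>c. \<forall>f\<in>L2_functions M. AE x in M. A (c *\<^sub>c f) x = c * A f x) \<and>
     (\<exists>C. \<forall>f\<in>L2_functions M. L2_norm M (A f) \<le> C * L2_norm M f)"

definition L2_opnorm :: "'y measure \<Rightarrow> (('y \<Rightarrow> complex) \<Rightarrow> 'y \<Rightarrow> complex) \<Rightarrow> real" where
  "L2_opnorm M A = (SUP f\<in>{f \<in> L2_functions M. L2_norm M f \<le> 1}. L2_norm M (A f))"

definition is_L2_extension :: "'y topology \<Rightarrow> 'y measure \<Rightarrow>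
    (('y \<Rightarrow> complex) \<Rightarrow> ('y \<Rightarrow> complex) \<Rightarrow> complex) \<Rightarrow> (('y \<Rightarrow> complex) \<Rightarrow> 'y \<Rightarrow> complex) \<Rightarrow> bool" where
  "is_L2_extension Y M T A \<longleftrightarrow> bounded_L2_operator M A \<and>
     (\<forall>\<phi>\<in>test_functions Y. T \<phi> = distribution_of_function Y M (A \<phi>))"

text \<open>The space of bounded operators, as the subspace of \<open>\<L>(\<D>(Y), \<D>'(Y))\<close> of those operators that
  extend boundedly to \<open>L\<^sup>2\<close>, with the operator norm of the extension (unique up to almost everywhere
  equality when the test functions are dense).\<close>

definition bounded_operators ::
  "'y topology \<Rightarrow> 'y measure \<Rightarrow> (('y \<Rightarrow> complex) \<Rightarrow> ('y \<Rightarrow> complex) \<Rightarrow> complex) set" where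
  "bounded_operators Y M = {T \<in> distribution_operators Y. \<exists>A. is_L2_extension Y M T A}"

definition operator_norm :: "'y topology \<Rightarrow> 'y measure \<Rightarrow>
    (('y \<Rightarrow> complex) \<Rightarrow> ('y \<Rightarrow> complex) \<Rightarrow> complex) \<Rightarrow> real" where
  "operator_norm Y M T = L2_opnorm M (SOME A. is_L2_extension Y M T A)"

definition bounded_operator_topology :: "'y topology \<Rightarrow> 'y measure \<Rightarrow>
    (('y \<Rightarrow> complex) \<Rightarrow> ('y \<Rightarrow> complex) \<Rightarrow> complex) topology" where
  "bounded_operator_topology Y M = seminorm_topology (bounded_operators Y M) {operator_norm Y M}"


section \<open>The quantization\<close>

text \<open>
  \<open>dt\<close> is the Haar measure normalized on the ring of integers and \<open>\<Psi>\<close> the fixed character;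
  \<open>n\<close> and \<open>\<theta>\<close> are constrained in the theorem only.
\<close>

locale local_field_quantization =
  fixes \<pi> :: "'k::nonarch_local_field"
    and dt :: "'k measure"
    and \<Psi> :: "'k \<Rightarrow> complex"
    and n :: nat
    and \<theta> :: 'k
  assumes uniformizer: "is_uniformizer \<pi>"
    and haar_sets: "sets dt = sets borel"
    and haar_invariant: "\<And>a. distr dt dt (\<lambda>t. a + t) = dt"
    and haar_normalized: "emeasure dt integers = 1"
    and char_add: "\<And>s t. \<Psi> (s + t) = \<Psi> s * \<Psi> t"
    and char_unitary: "\<And>t. cmod (\<Psi> t) = 1"
    and char_continuous: "continuous_on UNIV \<Psi>"
    and char_trivial: "\<And>t. t \<in> integers \<Longrightarrow> \<Psi> t = 1"
    and char_nontrivial: "\<exists>t. t \<in> integers \<and> \<Psi> (inverse \<pi> * t) \<noteq> 1"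
begin

definition q :: real where
  "q = real (card (residue_field :: 'k set set))"

definition U :: "'k set" where
  "U = {1 + \<pi> ^ n * x | x. x \<in> integers}"

definition cls :: "'k \<Rightarrow> 'k set" where
  "cls t = {t + inverse (\<pi> ^ n) * x | x. x \<in> integers}"

definition \<Gamma> :: "'k set set" where
  "\<Gamma> = range cls"

definition rep :: "'k set \<Rightarrow> 'k" where
  "rep c = (SOME t. t \<in> c)"

definition X :: "('k \<times> 'k set) set" where
  "X = U \<times> \<Gamma>"

definition X_mult :: "'k \<times> 'k set \<Rightarrow> 'k \<times> 'k set \<Rightarrow> 'k \<times> 'k set" where
  "X_mult g h = (fst g * fst h, cls (inverse (fst h) * rep (snd g) + rep (snd h)))"

definition U_top :: "'k topology" where
  "U_top = subtopology euclidean U"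

definition X_top :: "('k \<times> 'k set) topology" where
  "X_top = prod_topology U_top (discrete_topology \<Gamma>)"

definition U_measure :: "'k measure" where
  "U_measure = restrict_space dt U"

definition X_measure :: "('k \<times> 'k set) measure" where
  "X_measure = U_measure \<Otimes>\<^sub>M count_space \<Gamma>"

definition \<phi> :: "'k \<Rightarrow> 'k" where
  "\<phi> u = u - inverse u"

definition \<Omega> :: "'k \<times> 'k set \<Rightarrow> ('k \<Rightarrow> complex) \<Rightarrow> 'k \<Rightarrow> complex" where
  "\<Omega> g f u0 = \<Psi> (\<theta> * (\<phi> (fst g * inverse u0) * rep (snd g))) * f ((fst g)\<^sup>2 * inverse u0)"

definition W :: "('k \<Rightarrow> complex) \<Rightarrow> ('k \<Rightarrow> complex) \<Rightarrow> 'k \<times> 'k set \<Rightarrow> complex" where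
  "W f1 f2 g = (if g \<in> X then L2_inner U_measure f1 (\<Omega> g f2) else 0)"

definition quantization ::
  "(('k \<times> 'k set \<Rightarrow> complex) \<Rightarrow> complex) \<Rightarrow> ('k \<Rightarrow> complex) \<Rightarrow> ('k \<Rightarrow> complex) \<Rightarrow> complex" where
  "quantization F f2 f1 =
     (if f1 \<in> test_functions U_top \<and> f2 \<in> test_functions U_top
      then of_real (absk \<theta> * q ^ n) * F (W (\<lambda>u. cnj (f1 u)) f2) else 0)"

definition \<mu>0 :: "'k \<Rightarrow> real" where
  "\<mu>0 t = max 1 (absk (\<pi> ^ n * t))"

definition fourier :: "('k \<Rightarrow> complex) \<Rightarrow> 'k \<Rightarrow> complex" where
  "fourier f s = (\<integral>t. f t * \<Psi> (s * t) \<partial>dt)"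

definition fourier_distribution :: "(('k \<Rightarrow> complex) \<Rightarrow> complex) \<Rightarrow> ('k \<Rightarrow> complex) \<Rightarrow> complex" where
  "fourier_distribution T f = (if f \<in> test_functions euclidean then T (fourier f) else 0)"

definition J_kernel :: "real \<Rightarrow> ('k \<Rightarrow> complex) \<Rightarrow> complex" where
  "J_kernel s = fourier_distribution
     (distribution_of_function euclidean dt (\<lambda>t. cnj (\<Psi> t) * of_real (\<mu>0 t powr s)))"

text \<open>The kernel is supported in the compact open set \<open>U\<close>; as a distribution on \<open>U\<close> it is evaluated
  at test functions of \<open>U\<close> extended by zero.\<close>

definition J_test :: "real \<Rightarrow> ('k \<times> 'k set \<Rightarrow> complex) \<Rightarrow> 'k \<times> 'k set \<Rightarrow> complex" where
  "J_test s f g =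
     (if g \<in> X then J_kernel s (\<lambda>u. if u \<in> U then f (X_mult g (u, cls 0)) else 0) else 0)"

definition J :: "real \<Rightarrow> (('k \<times> 'k set \<Rightarrow> complex) \<Rightarrow> complex) \<Rightarrow>
    ('k \<times> 'k set \<Rightarrow> complex) \<Rightarrow> complex" where
  "J s F f = (if f \<in> test_functions X_top then F (J_test s f) else 0)"

definition symbol_space :: "(('k \<times> 'k set \<Rightarrow> complex) \<Rightarrow> complex) set" where
  "symbol_space = {F \<in> distributions X_top. \<forall>j::nat. in_Linf X_top X_measure (J (real j) F)}"

definition symbol_topology :: "(('k \<times> 'k set \<Rightarrow> complex) \<Rightarrow> complex) topology" where
  "symbol_topology = seminorm_topology symbol_space
     {\<lambda>F. Linf_norm X_top X_measure (J (real j) F) | j :: nat. True}"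

end

end

theory Submission
  imports Defs
begin

text \<open>
  On the orbits of the right translations by \<open>U\<close> the operator \<open>J\<^sup>s\<close> is the Fourier multiplier
  \<open>\<mu>\<^sub>0\<^sup>s\<close>. Since \<open>\<mu>\<^sub>0\<close> is constant on shells, \<open>J\<^sup>s = (\<Sum>k. q\<^sup>k\<^sup>s (E\<^sub>k - E\<^sub>k\<^sub>-\<^sub>1))\<close> with \<open>E\<^sub>k\<close> the average over
  balls of radius \<open>q\<^sup>-\<^sup>n\<^sup>-\<^sup>k\<close> and \<open>E\<^sub>-\<^sub>1 = 0\<close>. The \<open>E\<^sub>k\<close> are commuting projections, so \<open>J\<^sup>s J\<^sup>t = J\<^sup>s\<^sup>+\<^sup>t\<close>; for
  \<open>s \<le> 0\<close>, summation by parts makes \<open>J\<^sup>s\<close> a convex combination of the \<open>E\<^sub>k\<close>, hence a contraction of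
  \<open>L\<^sup>1\<close>. Therefore the pairing of \<open>F\<close> with a Wigner function \<open>W\<close> is that of \<open>J\<^sup>-\<^sup>s F\<close> with \<open>J\<^sup>s W\<close>, and
  it remains to bound \<open>E\<^sub>k W\<close> in \<open>L\<^sup>1\<close>. As \<open>2\<close> is a unit, \<open>u \<mapsto> u\<^sup>2\<close> and \<open>\<phi>\<close> are isometries on \<open>U\<close>; after
  substituting \<open>y = u\<^sup>2 / x\<close> the phase of \<open>W\<close> splits into a factor in \<open>x\<close> and one in \<open>y\<close>, so \<open>E\<^sub>k W\<close> is a
  sum of products of two Fourier coefficients over the \<open>q\<^sup>k\<close> cosets of the ball of radius \<open>q\<^sup>-\<^sup>n\<^sup>-\<^sup>k\<close>.
  Cauchy-Schwarz and Bessel's inequality bound its \<open>L\<^sup>1\<close> norm by \<open>q\<^sup>k\<^sup>-\<^sup>n\<close> times the product of the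
  \<open>L\<^sup>2\<close> norms, and summing over \<open>k\<close> against \<open>q\<^sup>k\<^sup>s\<close> gives the estimate.
\<close>

section \<open>Square-integrable functions\<close>

text \<open>The estimates are carried out on functions that are constant on balls of one radius. For
  them an integral is a finite sum over representatives, Fubini is an exchange of finite sums, and
  an isometry of a ball can be substituted without a Jacobian, since it carries one system of
  representatives to another. Hence the care taken to let a single level K control a function, its
  support and its twist at once. The hypotheses on the field enter through |2| = 1: if 0 < |2| < 1,
  the closure of the prime field would be a copy of Q_2. The symbol space provides natural exponents
  j only, while the estimate concerns all real s < -2. Duality closes the gap: a distribution
  bounded by C times the L1 norm is a function bounded by C, so the L1 contraction lets exponents
  decrease. Origin of the constant: an average over a ball is normalized by q^(n+k), Bessel's
  inequality and the volume of \<open>U\<close> contribute q^-n each, and with the q^n in the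
  definition of the quantization this leaves q^k. The sum of q^(ks) (q^k + q^(k-1)) is compared
  shell by shell with the integral of \<open>\<mu>0\<close> to the power s + 1, which converges
  because s < -2.\<close>

lemma le_sqrt_multI:
  fixes a b x :: real
  assumes le: "\<And>r. r > 0 \<Longrightarrow> x \<le> (r * a + b / r) / 2" and "0 \<le> a" "0 \<le> b"
  shows "x \<le> sqrt a * sqrt b"
proof (rule ccontr)
  assume "\<not> ?thesis"
  hence x: "sqrt a * sqrt b < x" by simp
  hence xpos: "0 < x" using assms(2,3) by (meson le_less_trans mult_nonneg_nonneg real_sqrt_ge_zero)
  consider "a = 0" "b = 0" | "a = 0" "0 < b" | "0 < a" "b = 0" | "0 < a" "0 < b"
    using assms(2,3) by linarith
  thus False
  proof cases
    case 1 thus ?thesis using le[of 1] xpos by simp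
  next
    \<comment> \<open>When exactly one of a, b vanishes there is no optimal weight; the weights b /
      x and x / a reduce the hypothesis to x <= x / 2. In the last case the weight sqrt b / sqrt a
      equalizes the two summands.\<close>
    case 2 thus ?thesis using le[of "b / x"] xpos by (simp add: field_simps)
  next
    case 3 thus ?thesis using le[of "x / a"] xpos by (simp add: field_simps)
  next
    case 4
    have "sqrt b / sqrt a * a = sqrt a * sqrt b"
      using 4 by (simp add: field_simps)
    moreover have "b / (sqrt b / sqrt a) = sqrt a * sqrt b"
      using 4 by (simp add: field_simps)
    ultimately show ?thesis using le[of "sqrt b / sqrt a"] 4 x by simp
  qed
qed

lemma L2_borel: "f \<in> L2_functions M \<Longrightarrow> f \<in> borel_measurable M"
  and L2_integrable: "f \<in> L2_functions M \<Longrightarrow> integrable M (\<lambda>x. (cmod (f x))\<^sup>2)"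
  by (simp_all add: L2_functions_def)

lemma L2_norm_nonneg [simp]: "0 \<le> L2_norm M f"
  by (simp add: L2_norm_def)

lemma L2_norm_sq: "(L2_norm M f)\<^sup>2 = (\<integral>x. (cmod (f x))\<^sup>2 \<partial>M)"
  by (simp add: L2_norm_def)

lemma L2_norm_zero: "L2_norm M 0 = 0" "L2_norm M (\<lambda>x. 0) = 0"
  by (simp_all add: L2_norm_def)

lemma zero_in_L2: "0 \<in> L2_functions M"
  by (simp add: L2_functions_def zero_fun_def)

lemma L2_cnj: "f \<in> L2_functions M \<Longrightarrow> (\<lambda>x. cnj (f x)) \<in> L2_functions M"
  by (auto simp: L2_functions_def intro!: borel_measurable_continuous_on[of cnj] continuous_intros)

lemma L2_norm_cnj: "L2_norm M (\<lambda>x. cnj (f x)) = L2_norm M f"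
  by (simp add: L2_norm_def)

lemma L2_scale: "f \<in> L2_functions M \<Longrightarrow> c *\<^sub>c f \<in> L2_functions M"
  by (auto simp: L2_functions_def cscale_fun_def cscale_complex_def norm_mult power_mult_distrib
      intro!: borel_measurable_times)

lemma L2_norm_scale: "L2_norm M (c *\<^sub>c f) = cmod c * L2_norm M f"
  by (simp add: L2_norm_def cscale_fun_def cscale_complex_def norm_mult power_mult_distrib real_sqrt_mult)

lemma mult_le_half_squares: "0 < r \<Longrightarrow> (a::real) * b \<le> (r * a\<^sup>2 + b\<^sup>2 / r) / 2"
proof -
  assume r: "0 < r"
  have "0 \<le> (r * a - b)\<^sup>2 / r" using r by simp
  also have "(r * a - b)\<^sup>2 / r = r * a\<^sup>2 + b\<^sup>2 / r - 2 * (a * b)"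
    using r by (simp add: power2_eq_square field_simps)
  finally show ?thesis by simp
qed

lemma L2_mult_integrable:
  assumes f: "f \<in> L2_functions M" and g: "g \<in> L2_functions M"
  shows "integrable M (\<lambda>x. f x * g x)"
proof (rule Bochner_Integration.integrable_bound)
  show "integrable M (\<lambda>x. (cmod (f x))\<^sup>2 + (cmod (g x))\<^sup>2)"
    using L2_integrable[OF f] L2_integrable[OF g] by simp
  show "(\<lambda>x. f x * g x) \<in> borel_measurable M" using L2_borel[OF f] L2_borel[OF g] by simp
  have "a * b \<le> a\<^sup>2 + b\<^sup>2" if "0 \<le> a" "0 \<le> b" for a b :: real
    using mult_le_half_squares[of 1 a b] by simp (smt (verit) zero_le_power2)
  thus "AE x in M. norm (f x * g x) \<le> norm ((cmod (f x))\<^sup>2 + (cmod (g x))\<^sup>2)"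
    by (simp add: norm_mult)
qed

text \<open>The weighted inequality \<open>mult_le_half_squares\<close> is integrated with a free
  weight, and the weight is optimized afterwards. Nothing is normalized, so functions of norm 0 need
  no separate treatment here.\<close>

lemma L2_Cauchy_Schwarz_abs:
  assumes f: "f \<in> L2_functions M" and g: "g \<in> L2_functions M"
  shows "(\<integral>x. cmod (f x * g x) \<partial>M) \<le> L2_norm M f * L2_norm M g"
  unfolding L2_norm_def
proof (rule le_sqrt_multI)
  fix r :: real assume r: "0 < r"
  have "(\<integral>x. cmod (f x * g x) \<partial>M) \<le> (\<integral>x. (r * (cmod (f x))\<^sup>2 + (cmod (g x))\<^sup>2 / r) / 2 \<partial>M)"
    using L2_mult_integrable[OF f g] L2_integrable[OF f] L2_integrable[OF g] mult_le_half_squares[OF r]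
    by (intro integral_mono integrable_norm) (auto simp: norm_mult)
  also have "\<dots> = (r * (\<integral>x. (cmod (f x))\<^sup>2 \<partial>M) + (\<integral>x. (cmod (g x))\<^sup>2 \<partial>M) / r) / 2"
    using L2_integrable[OF f] L2_integrable[OF g] by simp
  finally show "(\<integral>x. cmod (f x * g x) \<partial>M) \<le> (r * (\<integral>x. (cmod (f x))\<^sup>2 \<partial>M) + (\<integral>x. (cmod (g x))\<^sup>2 \<partial>M) / r) / 2" .
qed simp_all

lemma L2_Cauchy_Schwarz:
  assumes "f \<in> L2_functions M" and "g \<in> L2_functions M"
  shows "cmod (\<integral>x. f x * g x \<partial>M) \<le> L2_norm M f * L2_norm M g"
  using L2_Cauchy_Schwarz_abs[OF assms] integral_norm_bound[of M "\<lambda>x. f x * g x"] by linarith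

lemma cmod_add_sq: "(cmod (a + b))\<^sup>2 = (cmod a)\<^sup>2 + 2 * Re (a * cnj b) + (cmod b)\<^sup>2"
  unfolding cmod_power2 by (simp add: power2_eq_square algebra_simps)

lemma L2_norm_sq_add:
  assumes f: "f \<in> L2_functions M" and g: "g \<in> L2_functions M"
  shows "f + g \<in> L2_functions M"
    "(L2_norm M (f + g))\<^sup>2 = (L2_norm M f)\<^sup>2 + 2 * Re (\<integral>x. f x * cnj (g x) \<partial>M) + (L2_norm M g)\<^sup>2"
proof -
  note int = L2_mult_integrable[OF f L2_cnj[OF g]]
  have 1: "integrable M (\<lambda>x. (cmod (f x))\<^sup>2 + 2 * Re (f x * cnj (g x)) + (cmod (g x))\<^sup>2)"
    using L2_integrable[OF f] L2_integrable[OF g] int by (simp del: Re_complex_of_real times_complex.sel)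
  show "f + g \<in> L2_functions M"
    unfolding L2_functions_def plus_fun_def mem_Collect_eq cmod_add_sq
    using 1 L2_borel[OF f] L2_borel[OF g] by simp
  have "(\<integral>x. Re (f x * cnj (g x)) \<partial>M) = Re (\<integral>x. f x * cnj (g x) \<partial>M)" using int by (rule integral_Re)
  thus "(L2_norm M (f + g))\<^sup>2 = (L2_norm M f)\<^sup>2 + 2 * Re (\<integral>x. f x * cnj (g x) \<partial>M) + (L2_norm M g)\<^sup>2"
    unfolding L2_norm_sq plus_fun_def cmod_add_sq
    using L2_integrable[OF f] L2_integrable[OF g] int
    by (simp del: Re_complex_of_real times_complex.sel)
qed

lemma L2_add: "f \<in> L2_functions M \<Longrightarrow> g \<in> L2_functions M \<Longrightarrow> f + g \<in> L2_functions M"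
  by (rule L2_norm_sq_add)

lemma L2_norm_triangle:
  assumes f: "f \<in> L2_functions M" and g: "g \<in> L2_functions M"
  shows "L2_norm M (f + g) \<le> L2_norm M f + L2_norm M g"
proof (rule power2_le_imp_le)
  have "Re (\<integral>x. f x * cnj (g x) \<partial>M) \<le> L2_norm M f * L2_norm M g"
    using L2_Cauchy_Schwarz[OF f L2_cnj[OF g]] complex_Re_le_cmod[of "\<integral>x. f x * cnj (g x) \<partial>M"]
    by (simp add: L2_norm_cnj)
  thus "(L2_norm M (f + g))\<^sup>2 \<le> (L2_norm M f + L2_norm M g)\<^sup>2"
    unfolding L2_norm_sq_add(2)[OF f g] by (simp add: power2_sum)
qed simp

lemma fun_diff_eq_cscale: "(f :: 'y \<Rightarrow> complex) - g = f + (- 1) *\<^sub>c g"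
  by (simp add: fun_eq_iff cscale_fun_def cscale_complex_def)

lemma fun_sum_apply: "(\<Sum>r\<in>R. f r) x = (\<Sum>r\<in>R. f r x)"
  by (induction R rule: infinite_finite_induct) simp_all

lemma L2_norm_sq_diff:
  assumes f: "f \<in> L2_functions M" and g: "g \<in> L2_functions M"
  shows "(L2_norm M (f - g))\<^sup>2 = (L2_norm M f)\<^sup>2 - 2 * Re (\<integral>x. f x * cnj (g x) \<partial>M) + (L2_norm M g)\<^sup>2"
proof -
  have "(\<lambda>x. f x * cnj (((- 1) *\<^sub>c g) x)) = (\<lambda>x. - (f x * cnj (g x)))"
    by (simp add: fun_eq_iff cscale_fun_def cscale_complex_def)
  thus ?thesis unfolding fun_diff_eq_cscale L2_norm_sq_add(2)[OF f L2_scale[OF g]]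
    by (simp add: L2_norm_scale)
qed

lemma L2_diff: "f \<in> L2_functions M \<Longrightarrow> g \<in> L2_functions M \<Longrightarrow> f - g \<in> L2_functions M"
  by (simp add: fun_diff_eq_cscale L2_add L2_scale)

lemma L2_norm_minus_commute: "L2_norm M (f - g) = L2_norm M (g - f)"
  by (simp add: L2_norm_def norm_minus_commute)

lemma L2_norm_triangle_diff:
  assumes "f \<in> L2_functions M" and "g \<in> L2_functions M" and "h \<in> L2_functions M"
  shows "L2_norm M (f - h) \<le> L2_norm M (f - g) + L2_norm M (g - h)"
  using L2_norm_triangle[OF L2_diff[OF assms(1,2)] L2_diff[OF assms(2,3)]] by simp

lemma L2_norm_cong_AE:
  assumes "AE x in M. f x = g x" "f \<in> borel_measurable M" "g \<in> borel_measurable M"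
  shows "L2_norm M f = L2_norm M g"
  unfolding L2_norm_def using assms by (intro arg_cong[of _ _ sqrt] integral_cong_AE) auto

lemma L2_integrable_finite:
  assumes "finite_measure M" "f \<in> L2_functions M"
  shows "integrable M f"
proof -
  have "(\<lambda>x. 1) \<in> L2_functions M"
    using finite_measure.integrable_const[OF assms(1)] by (simp add: L2_functions_def)
  from L2_mult_integrable[OF assms(2) this] show ?thesis by simp
qed

lemma L2_norm_const_1: "finite_measure M \<Longrightarrow> L2_norm M (\<lambda>x. 1) = sqrt (measure M (space M))"
  by (simp add: L2_norm_def)

lemma L1_le_L2:
  assumes "finite_measure M" "f \<in> L2_functions M"
  shows "(\<integral>x. cmod (f x) \<partial>M) \<le> sqrt (measure M (space M)) * L2_norm M f"
proof -
  have "(\<lambda>x. 1) \<in> L2_functions M"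
    using finite_measure.integrable_const[OF assms(1)] by (simp add: L2_functions_def)
  from L2_Cauchy_Schwarz_abs[OF this assms(2)] show ?thesis using L2_norm_const_1[OF assms(1)] by simp
qed

lemma bounded_in_L2:
  assumes "finite_measure M" "f \<in> borel_measurable M" "\<And>x. x \<in> space M \<Longrightarrow> cmod (f x) \<le> C"
  shows "f \<in> L2_functions M"
proof -
  have "integrable M (\<lambda>x. (cmod (f x))\<^sup>2)"
    using assms by (intro finite_measure.integrable_const_bound[of M _ "C\<^sup>2"])
      (auto intro!: AE_I2 power_mono)
  thus ?thesis using assms by (simp add: L2_functions_def)
qed

section \<open>Finite sums as integrals, and completeness of L2\<close>

lemma integrable_count_space_finite_support:
  fixes f :: "'c \<Rightarrow> 'b::{banach, second_countable_topology}"
  assumes "finite S" "S \<subseteq> A" "\<And>x. x \<in> A \<Longrightarrow> x \<notin> S \<Longrightarrow> f x = 0"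
  shows "integrable (count_space A) f"
proof -
  have "(\<integral>\<^sup>+x. ennreal (norm (f x)) \<partial>count_space A) = (\<Sum>x\<in>S. ennreal (norm (f x)))"
    by (rule nn_integral_count_space') (use assms in auto)
  thus ?thesis by (simp add: integrable_iff_bounded)
qed

lemma integral_count_space_finite_support:
  fixes f :: "'c \<Rightarrow> 'b::{banach, second_countable_topology}"
  assumes "finite S" "S \<subseteq> A" "\<And>x. x \<in> A \<Longrightarrow> x \<notin> S \<Longrightarrow> f x = 0"
  shows "(\<integral>x. f x \<partial>count_space A) = (\<Sum>x\<in>S. f x)"
proof -
  have sub: "{x \<in> A. f x \<noteq> 0} \<subseteq> S" using assms(3) by blast
  have "(\<integral>x. f x \<partial>count_space A) = (\<Sum>x | x \<in> A \<and> f x \<noteq> 0. f x)"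
    by (rule lebesgue_integral_count_space_finite_support) (use finite_subset[OF sub assms(1)] in simp)
  also have "\<dots> = (\<Sum>x\<in>S. f x)" by (rule sum.mono_neutral_left) (use assms sub in auto)
  finally show ?thesis .
qed

lemma summable_L1_AE_summable:
  fixes d :: "nat \<Rightarrow> 'y \<Rightarrow> complex"
  assumes int: "\<And>i. integrable M (d i)" and s: "summable (\<lambda>i. \<integral>x. cmod (d i x) \<partial>M)"
  shows "AE x in M. summable (\<lambda>i. cmod (d i x))"
proof -
  have [measurable]: "d i \<in> borel_measurable M" for i using int by auto
  have "(\<integral>\<^sup>+x. (\<Sum>i. ennreal (cmod (d i x))) \<partial>M) = (\<Sum>i. \<integral>\<^sup>+x. ennreal (cmod (d i x)) \<partial>M)"
    by (rule nn_integral_suminf) simp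
  also have "\<dots> = (\<Sum>i. ennreal (\<integral>x. cmod (d i x) \<partial>M))"
    using int by (subst nn_integral_eq_integral) auto
  also have "\<dots> \<noteq> \<infinity>" using s by (simp add: suminf_ennreal2)
  finally have "AE x in M. (\<Sum>i. ennreal (cmod (d i x))) \<noteq> \<infinity>"
    by (intro nn_integral_noteq_infinite) auto
  thus ?thesis by eventually_elim (rule summable_suminf_not_top, auto)
qed

text \<open>Riesz-Fischer. On a finite measure space the L2 norm controls the L1 norm, so a
  subsequence with increments below 2^-i converges almost everywhere, and Fatou turns this into
  convergence in norm. The subsequence is part of the result because pointwise bounds on h are later
  passed to the limit.\<close>

theorem L2_complete:
  fixes h :: "nat \<Rightarrow> 'y \<Rightarrow> complex"
  assumes fin: "finite_measure M" and h: "\<And>i. h i \<in> L2_functions M"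
    and Cauchy: "\<And>e. 0 < e \<Longrightarrow> \<exists>N. \<forall>i\<ge>N. \<forall>j\<ge>N. L2_norm M (h i - h j) < e"
  obtains g r where "g \<in> L2_functions M" "(\<lambda>i. L2_norm M (h i - g)) \<longlonglongrightarrow> 0" "strict_mono (r::nat \<Rightarrow> nat)"
    "AE x in M. (\<lambda>i. h (r i) x) \<longlonglongrightarrow> g x"
proof -
  have [measurable]: "h i \<in> borel_measurable M" for i using h by (rule L2_borel)
  have ex: "\<exists>N>k. \<forall>j\<ge>N. L2_norm M (h j - h N) \<le> (1/2) ^ i" for i k :: nat
  proof -
    obtain N where N: "\<forall>a\<ge>N. \<forall>b\<ge>N. L2_norm M (h a - h b) < (1/2) ^ i"
      using Cauchy[of "(1/2) ^ i"] by auto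
    show ?thesis by (rule exI[of _ "max N (Suc k)"]) (use N in \<open>auto intro!: less_imp_le\<close>)
  qed
  have "\<exists>r. \<forall>i. (\<forall>j\<ge>r i. L2_norm M (h j - h (r i)) \<le> (1/2) ^ i) \<and> r i < r (Suc i)"
    by (rule dependent_nat_choice) (use ex in blast)+
  then obtain r where r: "\<And>i j. r i \<le> j \<Longrightarrow> L2_norm M (h j - h (r i)) \<le> (1/2) ^ i"
    and r_Suc: "\<And>i. r i < r (Suc i)" by blast
  have mono: "strict_mono r" using r_Suc by (simp add: strict_mono_Suc_iff)
  define d where "d i = h (r (Suc i)) - h (r i)" for i
  have dL2: "d i \<in> L2_functions M" for i unfolding d_def by (intro L2_diff h)
  have "(\<integral>x. cmod (d i x) \<partial>M) \<le> sqrt (measure M (space M)) * (1/2) ^ i" for i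
    using L1_le_L2[OF fin dL2[of i]] r[of i "r (Suc i)"] r_Suc[of i]
      mult_left_mono[of "L2_norm M (d i)" "(1/2) ^ i" "sqrt (measure M (space M))"]
    unfolding d_def by simp
  hence "summable (\<lambda>i. \<integral>x. cmod (d i x) \<partial>M)"
    by (intro summable_comparison_test'[OF summable_mult[OF summable_geometric[of "1/2::real"]]]) auto
  hence "AE x in M. summable (\<lambda>i. cmod (d i x))"
    using L2_integrable_finite[OF fin dL2] by (rule summable_L1_AE_summable[rotated])
  hence conv: "AE x in M. convergent (\<lambda>i. h (r i) x)"
  proof eventually_elim
    case (elim x)
    hence "summable (\<lambda>i. d i x)" by (rule summable_norm_cancel)
    hence "convergent (\<lambda>k. \<Sum>i<k. d i x)" by (simp add: summable_iff_convergent)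
    moreover have "(\<Sum>i<k. d i x) = h (r k) x - h (r 0) x" for k
      by (induction k) (simp_all add: d_def)
    ultimately have "convergent (\<lambda>k. (h (r k) x - h (r 0) x) + h (r 0) x)"
      by (intro convergent_add convergent_const) simp
    thus ?case by simp
  qed
  define g where "g x = lim (\<lambda>i. h (r i) x)" for x
  have [measurable]: "g \<in> borel_measurable M" unfolding g_def by (rule borel_measurable_lim_metric) simp
  have lim: "AE x in M. (\<lambda>i. h (r i) x) \<longlonglongrightarrow> g x"
    using conv by eventually_elim (simp add: g_def convergent_LIMSEQ_iff)
  \<comment> \<open>The limit is taken in j while i stays fixed. This one bound yields both that g
    is square-integrable and how fast the subsequence approaches it.\<close>
  have Fatou: "(\<integral>\<^sup>+x. ennreal ((cmod (g x - h (r i) x))\<^sup>2) \<partial>M) \<le> ennreal (((1/2) ^ i)\<^sup>2)" for i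
  proof -
    have "(\<integral>\<^sup>+x. ennreal ((cmod (g x - h (r i) x))\<^sup>2) \<partial>M)
        = (\<integral>\<^sup>+x. liminf (\<lambda>j. ennreal ((cmod (h (r j) x - h (r i) x))\<^sup>2)) \<partial>M)"
    proof (rule nn_integral_cong_AE, use lim in eventually_elim)
      case (elim x)
      hence "(\<lambda>j. ennreal ((cmod (h (r j) x - h (r i) x))\<^sup>2)) \<longlonglongrightarrow> ennreal ((cmod (g x - h (r i) x))\<^sup>2)"
        by (intro tendsto_intros)
      thus ?case by (simp only: lim_imp_Liminf[OF trivial_limit_sequentially])
    qed
    also have "\<dots> \<le> liminf (\<lambda>j. \<integral>\<^sup>+x. ennreal ((cmod (h (r j) x - h (r i) x))\<^sup>2) \<partial>M)"
      by (rule nn_integral_liminf) simp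
    also have "\<dots> \<le> ennreal (((1/2) ^ i)\<^sup>2)"
    proof (rule order_trans[OF Liminf_mono Liminf_const[THEN eq_refl]], rule eventually_sequentiallyI[of i])
      fix j assume "i \<le> j"
      hence le: "r i \<le> r j" using mono by (simp add: strict_mono_less_eq)
      have "(\<integral>\<^sup>+x. ennreal ((cmod (h (r j) x - h (r i) x))\<^sup>2) \<partial>M) = ennreal ((L2_norm M (h (r j) - h (r i)))\<^sup>2)"
        using L2_integrable[OF L2_diff[OF h h]] unfolding L2_norm_sq fun_diff_def
        by (subst nn_integral_eq_integral) auto
      also have "\<dots> \<le> ennreal (((1/2) ^ i)\<^sup>2)" by (intro ennreal_leI power_mono r le) simp
      finally show "(\<integral>\<^sup>+x. ennreal ((cmod (h (r j) x - h (r i) x))\<^sup>2) \<partial>M) \<le> ennreal (((1/2) ^ i)\<^sup>2)" .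
    qed simp
    finally show ?thesis .
  qed
  have gh: "g - h (r i) \<in> L2_functions M" for i
  proof -
    have "(\<integral>\<^sup>+x. ennreal ((cmod (g x - h (r i) x))\<^sup>2) \<partial>M) < \<infinity>"
      using Fatou[of i] by (rule le_less_trans) simp
    thus ?thesis unfolding L2_functions_def by (simp add: integrable_iff_bounded fun_diff_def)
  qed
  have gL2: "g \<in> L2_functions M" using L2_add[OF gh[of 0] h[of "r 0"]] by simp
  have norm_gh: "L2_norm M (h (r i) - g) \<le> (1/2) ^ i" for i
  proof -
    have "ennreal ((L2_norm M (g - h (r i)))\<^sup>2) \<le> ennreal (((1/2) ^ i)\<^sup>2)"
      using Fatou[of i] L2_integrable[OF gh[of i]] unfolding L2_norm_sq fun_diff_def
      by (subst (asm) nn_integral_eq_integral) auto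
    hence "(L2_norm M (g - h (r i)))\<^sup>2 \<le> ((1/2) ^ i)\<^sup>2" by simp
    hence "L2_norm M (g - h (r i)) \<le> (1/2) ^ i" by (rule power2_le_imp_le) simp
    thus ?thesis by (simp add: L2_norm_minus_commute)
  qed
  have "(\<lambda>i. L2_norm M (h i - g)) \<longlonglongrightarrow> 0"
  proof (rule LIMSEQ_I)
    fix e :: real assume "0 < e"
    then obtain i where i: "(1/2::real) ^ i < e / 2" using real_arch_pow_inv[of "e/2" "1/2"] by auto
    have "norm (L2_norm M (h j - g) - 0) < e" if "r i \<le> j" for j
      using L2_norm_triangle_diff[OF h[of j] h[of "r i"] gL2] r[OF that] norm_gh[of i] i by simp
    thus "\<exists>N. \<forall>j\<ge>N. norm (L2_norm M (h j - g) - 0) < e" by blast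
  qed
  from that[OF gL2 this mono lim] show ?thesis .
qed

section \<open>Test functions and distributions\<close>

lemma test_functions_locally_constant:
  assumes "f \<in> test_functions Y" "x \<in> topspace Y"
  obtains V where "openin Y V" "x \<in> V" "\<And>y. y \<in> V \<Longrightarrow> f y = f x"
  using assms unfolding test_functions_def by blast

lemma test_functions_outside: "f \<in> test_functions Y \<Longrightarrow> x \<notin> topspace Y \<Longrightarrow> f x = 0"
  unfolding test_functions_def by blast

lemma test_functions_compact: "f \<in> test_functions Y \<Longrightarrow> compactin Y (Y closure_of {x \<in> topspace Y. f x \<noteq> 0})"
  unfolding test_functions_def by blast

lemma test_functions_subset_closureI:
  assumes "compactin Y (Y closure_of A)" "B \<subseteq> A"
  shows "compactin Y (Y closure_of B)"
  by (rule closed_compactin[OF assms(1) closure_of_mono[OF assms(2)]]) simp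

lemma test_functions_zero: "0 \<in> test_functions Y"
  unfolding test_functions_def by (auto intro: openin_topspace)

lemma test_functions_add:
  assumes f: "f \<in> test_functions Y" and g: "g \<in> test_functions Y"
  shows "f + g \<in> test_functions Y"
  unfolding test_functions_def
proof (intro CollectI conjI ballI allI impI)
  fix x assume x: "x \<in> topspace Y"
  obtain V where V: "openin Y V" "x \<in> V" "\<forall>y\<in>V. f y = f x"
    using f x unfolding test_functions_def by blast
  obtain W where W: "openin Y W" "x \<in> W" "\<forall>y\<in>W. g y = g x"
    using g x unfolding test_functions_def by blast
  have "(f + g) y = (f + g) x" if "y \<in> V \<inter> W" for y
    using V(3) W(3) that by (metis IntD1 IntD2 plus_fun_apply)
  thus "\<exists>V. openin Y V \<and> x \<in> V \<and> (\<forall>y\<in>V. (f + g) y = (f + g) x)"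
    using openin_Int[OF V(1) W(1)] V(2) W(2) by blast
next
  have "compactin Y (Y closure_of ({x \<in> topspace Y. f x \<noteq> 0} \<union> {x \<in> topspace Y. g x \<noteq> 0}))"
    using f g unfolding test_functions_def closure_of_Un by (auto intro: compactin_Un)
  thus "compactin Y (Y closure_of {x \<in> topspace Y. (f + g) x \<noteq> 0})"
    by (rule test_functions_subset_closureI) auto
qed (use f g in \<open>auto simp: test_functions_def\<close>)

lemma test_functions_scale:
  assumes f: "f \<in> test_functions Y"
  shows "c *\<^sub>c f \<in> test_functions Y"
  unfolding test_functions_def
proof (intro CollectI conjI ballI allI impI)
  fix x assume x: "x \<in> topspace Y"
  then obtain V where V: "openin Y V" "x \<in> V" "\<forall>y\<in>V. f y = f x"
    using f unfolding test_functions_def by blast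
  have "(c *\<^sub>c f) y = (c *\<^sub>c f) x" if "y \<in> V" for y
    using V(3) that unfolding cscale_fun_def by metis
  thus "\<exists>V. openin Y V \<and> x \<in> V \<and> (\<forall>y\<in>V. (c *\<^sub>c f) y = (c *\<^sub>c f) x)"
    using V(1,2) by blast
next
  have "compactin Y (Y closure_of {x \<in> topspace Y. f x \<noteq> 0})"
    using f unfolding test_functions_def by blast
  thus "compactin Y (Y closure_of {x \<in> topspace Y. (c *\<^sub>c f) x \<noteq> 0})"
    by (rule test_functions_subset_closureI) (auto simp: cscale_fun_def cscale_complex_def)
qed (use f in \<open>auto simp: test_functions_def cscale_fun_def cscale_complex_def\<close>)

lemma clinear_on_add: "clinear_on V T \<Longrightarrow> x \<in> V \<Longrightarrow> y \<in> V \<Longrightarrow> T (x + y) = T x + T y"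
  and clinear_on_scale: "clinear_on V T \<Longrightarrow> x \<in> V \<Longrightarrow> T (c *\<^sub>c x) = c *\<^sub>c T x"
  by (simp_all add: clinear_on_def)

lemma clinear_on_test_diff:
  fixes T :: "('y \<Rightarrow> complex) \<Rightarrow> complex"
  assumes "clinear_on (test_functions Y) T" "f \<in> test_functions Y" "g \<in> test_functions Y"
  shows "T (f - g) = T f - T g"
  using assms by (simp add: fun_diff_eq_cscale clinear_on_add clinear_on_scale test_functions_scale cscale_complex_def)

lemma clinear_on_test_zero:
  fixes T :: "('y \<Rightarrow> complex) \<Rightarrow> complex"
  assumes "clinear_on (test_functions Y) T"
  shows "T 0 = 0"
  using clinear_on_test_diff[OF assms test_functions_zero test_functions_zero] by (simp add: zero_fun_def)

lemma test_functions_sum: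
  assumes "finite R" "\<And>r. r \<in> R \<Longrightarrow> f r \<in> test_functions Y"
  shows "(\<Sum>r\<in>R. f r) \<in> test_functions Y"
  using assms by (induction R rule: finite_induct) (auto simp: test_functions_zero test_functions_add)

lemma clinear_on_test_sum:
  fixes T :: "('y \<Rightarrow> complex) \<Rightarrow> complex"
  assumes T: "clinear_on (test_functions Y) T" and "finite R" "\<And>r. r \<in> R \<Longrightarrow> f r \<in> test_functions Y"
  shows "T (\<Sum>r\<in>R. f r) = (\<Sum>r\<in>R. T (f r))"
  using assms(2,3)
proof (induction R rule: finite_induct)
  case empty
  thus ?case using clinear_on_test_zero[OF T] by (simp add: zero_fun_def)
next
  case (insert r R)
  hence "sum f R \<in> test_functions Y" by (intro test_functions_sum) auto
  hence "T (f r + sum f R) = T (f r) + T (sum f R)" using insert by (intro clinear_on_add[OF T]) auto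
  moreover have "T (sum f R) = (\<Sum>r\<in>R. T (f r))" using insert by blast
  ultimately show ?case unfolding sum.insert[OF insert.hyps] by metis
qed

section \<open>Continuity for seminorm topologies\<close>

lemma topspace_seminorm_topology [simp]: "topspace (seminorm_topology V P) = V"
  unfolding seminorm_topology_def topology_generated_by_topspace by auto

lemma openin_seminorm_ball:
  "p \<in> P \<Longrightarrow> x \<in> V \<Longrightarrow> 0 < e \<Longrightarrow> openin (seminorm_topology V P) {y \<in> V. p (y - x) < e}"
  unfolding seminorm_topology_def by (rule topology_generated_by_Basis) auto

text \<open>Only preimages of subbasic balls have to be examined. Their centres x range over all of
  W, not just over the image of T, and r is not assumed subadditive; hence the hypothesis compares r
  (T y - x) with r (T y0 - x) directly.\<close>

lemma continuous_map_seminorm_topologyI: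
  fixes T :: "'v::group_add \<Rightarrow> 'w::minus"
  assumes into: "T ` V \<subseteq> W"
    and bound: "\<And>r. r \<in> Q \<Longrightarrow> \<exists>p\<in>P. \<exists>K\<ge>0. p 0 = 0 \<and>
      (\<forall>x\<in>W. \<forall>y0\<in>V. \<forall>y\<in>V. r (T y - x) \<le> r (T y0 - x) + K * p (y - y0))"
  shows "continuous_map (seminorm_topology V P) (seminorm_topology W Q) T"
  unfolding seminorm_topology_def[of W Q]
proof (rule continuous_on_generated_topo)
  show "T ` topspace (seminorm_topology V P) \<subseteq> \<Union> (insert W {{y \<in> W. r (y - x) < e} |r x e. r \<in> Q \<and> x \<in> W \<and> 0 < e})"
    using into by auto
  fix O' assume "O' \<in> insert W {{y \<in> W. r (y - x) < e} |r x e. r \<in> Q \<and> x \<in> W \<and> 0 < e}"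
  then consider "O' = W" | r x e where "O' = {y \<in> W. r (y - x) < e}" "r \<in> Q" "x \<in> W" "0 < e" by auto
  thus "openin (seminorm_topology V P) (T -` O' \<inter> topspace (seminorm_topology V P))"
  proof cases
    case 1
    hence "T -` O' \<inter> topspace (seminorm_topology V P) = topspace (seminorm_topology V P)" using into by auto
    thus ?thesis by (metis openin_topspace)
  next
    case (2 r x e)
    obtain p K where p: "p \<in> P" "0 \<le> K" "p 0 = 0"
      "\<And>y0 y. y0 \<in> V \<Longrightarrow> y \<in> V \<Longrightarrow> r (T y - x) \<le> r (T y0 - x) + K * p (y - y0)"
      using bound[OF 2(2)] 2(3) by blast
    show ?thesis
    proof (subst openin_subopen, intro ballI)
      fix y0 assume "y0 \<in> T -` O' \<inter> topspace (seminorm_topology V P)"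
      hence y0: "y0 \<in> V" "r (T y0 - x) < e" using 2 by auto
      \<comment> \<open>The denominator K + 1 instead of K covers K = 0 and makes the estimate below
        strict.\<close>
      define d where "d = (e - r (T y0 - x)) / (K + 1)"
      have d: "0 < d" using y0 p(2) by (simp add: d_def)
      have "K * a < e - r (T y0 - x)" if "a < d" for a
      proof -
        have "K * a \<le> K * d" using that p(2) by (simp add: mult_left_mono)
        also have "\<dots> < (K + 1) * d" using d by simp
        also have "\<dots> = e - r (T y0 - x)" using p(2) by (simp add: d_def)
        finally show ?thesis .
      qed
      hence "{y \<in> V. p (y - y0) < d} \<subseteq> T -` O' \<inter> topspace (seminorm_topology V P)"
        using p(4)[OF y0(1)] into 2(1) by fastforce
      moreover have "y0 \<in> {y \<in> V. p (y - y0) < d}" using y0 d p(3) by simp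
      moreover have "openin (seminorm_topology V P) {y \<in> V. p (y - y0) < d}"
        using p(1) y0(1) d by (rule openin_seminorm_ball)
      ultimately show "\<exists>T'. openin (seminorm_topology V P) T' \<and> y0 \<in> T' \<and>
          T' \<subseteq> T -` O' \<inter> topspace (seminorm_topology V P)" by blast
    qed
  qed
qed

lemma seminorm_on_cmod_linear:
  fixes T :: "'v::{plus,cscale} \<Rightarrow> complex"
  assumes T: "clinear_on V T"
  shows "seminorm_on V (\<lambda>f. cmod (T f))"
  unfolding seminorm_on_def using clinear_on_add[OF T] clinear_on_scale[OF T]
  by (simp add: cscale_complex_def norm_mult norm_triangle_ineq)

text \<open>The modulus of a linear functional is one of the seminorms that define the topology, so
  the preimage of a disc contains a ball for this very seminorm. Linear functionals on test
  functions are thus automatically continuous.\<close>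

lemma clinear_on_test_continuous:
  fixes T :: "('y \<Rightarrow> complex) \<Rightarrow> complex"
  assumes T: "clinear_on (test_functions Y) T"
  shows "continuous_map (test_topology Y) euclidean T"
  unfolding continuous_map_def
proof (intro conjI allI impI)
  fix O' :: "complex set" assume "openin euclidean O'"
  hence O': "open O'" by simp
  show "openin (test_topology Y) {x \<in> topspace (test_topology Y). T x \<in> O'}"
  proof (subst openin_subopen, intro ballI)
    fix x assume "x \<in> {x \<in> topspace (test_topology Y). T x \<in> O'}"
    hence x: "x \<in> test_functions Y" "T x \<in> O'" by (auto simp: test_topology_def)
    obtain e where e: "e > 0" "\<And>z. dist z (T x) < e \<Longrightarrow> z \<in> O'" using O' x(2) by (metis open_dist)
    let ?B = "{y \<in> test_functions Y. cmod (T (y - x)) < e}"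
    have "openin (test_topology Y) ?B"
      unfolding test_topology_def
      by (rule openin_seminorm_ball) (use x e seminorm_on_cmod_linear[OF T] in auto)
    moreover have "x \<in> ?B" using x e clinear_on_test_zero[OF T] by simp
    moreover have "?B \<subseteq> {x \<in> topspace (test_topology Y). T x \<in> O'}"
      using e(2) clinear_on_test_diff[OF T _ x(1)] by (auto simp: test_topology_def dist_norm)
    ultimately show "\<exists>B. openin (test_topology Y) B \<and> x \<in> B \<and> B \<subseteq> {x \<in> topspace (test_topology Y). T x \<in> O'}"
      by blast
  qed
qed simp

lemma distributionsI:
  assumes "clinear_on (test_functions Y) T" "\<And>f. f \<notin> test_functions Y \<Longrightarrow> T f = 0"
  shows "T \<in> distributions Y"
  using assms clinear_on_test_continuous[OF assms(1)] by (simp add: distributions_def)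

lemma distributions_linear: "T \<in> distributions Y \<Longrightarrow> clinear_on (test_functions Y) T"
  and distributions_outside: "T \<in> distributions Y \<Longrightarrow> f \<notin> test_functions Y \<Longrightarrow> T f = 0"
  by (simp_all add: distributions_def)

lemma distributions_add:
  assumes S: "S \<in> distributions Y" and T: "T \<in> distributions Y"
  shows "S + T \<in> distributions Y"
proof (rule distributionsI)
  show "clinear_on (test_functions Y) (S + T)"
    using clinear_on_add[OF distributions_linear[OF S]] clinear_on_scale[OF distributions_linear[OF S]]
      clinear_on_add[OF distributions_linear[OF T]] clinear_on_scale[OF distributions_linear[OF T]]
    by (simp add: clinear_on_def cscale_complex_def algebra_simps)
qed (use distributions_outside[OF S] distributions_outside[OF T] in simp)

lemma distributions_scale:
  assumes T: "T \<in> distributions Y"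
  shows "c *\<^sub>c T \<in> distributions Y"
proof (rule distributionsI)
  show "clinear_on (test_functions Y) (c *\<^sub>c T)"
    using clinear_on_add[OF distributions_linear[OF T]] clinear_on_scale[OF distributions_linear[OF T]]
    by (simp add: clinear_on_def cscale_fun_def cscale_complex_def algebra_simps)
qed (use distributions_outside[OF T] in \<open>simp add: cscale_fun_def cscale_complex_def\<close>)

lemma distributions_diff: "S \<in> distributions Y \<Longrightarrow> T \<in> distributions Y \<Longrightarrow> S - T \<in> distributions Y"
  by (simp add: fun_diff_eq_cscale distributions_add distributions_scale)

text \<open>For a fixed test function f, the modulus of A y f is a seminorm in y and hence belongs
  to the family that defines the source topology; weak continuity follows from linearity.\<close>

lemma distribution_operatorsI:
  assumes lin: "clinear_on (test_functions Y) A" and dist: "\<And>f. f \<in> test_functions Y \<Longrightarrow> A f \<in> distributions Y"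
    and out: "\<And>f. f \<notin> test_functions Y \<Longrightarrow> A f = 0"
  shows "A \<in> distribution_operators Y"
proof -
  have lin': "clinear_on (test_functions Y) (\<lambda>f. A f g)" for g
    using clinear_on_add[OF lin] clinear_on_scale[OF lin] by (simp add: clinear_on_def cscale_fun_def)
  have "continuous_map (test_topology Y) (weak_dual_topology Y) A"
    unfolding test_topology_def weak_dual_topology_def
  proof (rule continuous_map_seminorm_topologyI)
    show "A ` test_functions Y \<subseteq> distributions Y" using dist by blast
    fix r assume "r \<in> {\<lambda>T. cmod (T f) | f. f \<in> test_functions Y}"
    then obtain f where r: "r = (\<lambda>T. cmod (T f))" by blast
    have "cmod (A y f - x f) \<le> cmod (A y0 f - x f) + 1 * cmod (A (y - y0) f)"
      if "y \<in> test_functions Y" "y0 \<in> test_functions Y" for x y y0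
      using clinear_on_test_diff[OF lin'[of f] that] norm_triangle_ineq[of "A y0 f - x f" "A y f - A y0 f"] by simp
    moreover have "cmod (A 0 f) = 0" using clinear_on_test_zero[OF lin'[of f]] by simp
    ultimately show "\<exists>p\<in>{p. seminorm_on (test_functions Y) p}. \<exists>K\<ge>0. p 0 = 0 \<and>
      (\<forall>x\<in>distributions Y. \<forall>y0\<in>test_functions Y. \<forall>y\<in>test_functions Y. r (A y - x) \<le> r (A y0 - x) + K * p (y - y0))"
      using seminorm_on_cmod_linear[OF lin'[of f]]
      by (intro bexI[of _ "\<lambda>y. cmod (A y f)"] exI[of _ 1]) (auto simp: r)
  qed
  thus ?thesis using assms by (simp add: distribution_operators_def)
qed

section \<open>Local fields\<close>

lemma real_inverse_uniqueI: "(a::real) * b = 1 \<Longrightarrow> b = inverse a"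
  by (simp add: inverse_unique)

context complete_ultrametric_field
begin

lemma absk_0 [simp]: "absk 0 = 0"
  by (metis absk_dist diff_self dist_self)

lemma absk_nonneg [simp]: "0 \<le> absk x"
  by (metis absk_dist diff_zero zero_le_dist)

lemma absk_eq_0_iff [simp]: "absk x = 0 \<longleftrightarrow> x = 0"
  by (metis absk_dist diff_zero dist_eq_0_iff)

lemma absk_pos_iff [simp]: "0 < absk x \<longleftrightarrow> x \<noteq> 0"
  using absk_nonneg[of x] absk_eq_0_iff[of x] by linarith

lemma absk_1 [simp]: "absk 1 = 1"
proof -
  have "absk 1 = absk 1 * absk 1" using absk_mult[of 1 1] by simp
  moreover have "absk 1 \<noteq> 0" by simp
  ultimately show ?thesis by simp
qed

lemma absk_minus [simp]: "absk (- x) = absk x"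
proof -
  have "absk (0 - x) = absk (x - 0)" by (metis absk_dist dist_commute)
  thus ?thesis by simp
qed

lemma absk_minus_commute: "absk (x - y) = absk (y - x)"
  by (metis absk_dist dist_commute)

lemma absk_inverse: "absk (inverse x) = inverse (absk x)"
proof (cases "x = 0")
  case False
  hence "absk x * absk (inverse x) = 1" by (simp flip: absk_mult)
  thus ?thesis by (rule real_inverse_uniqueI)
qed simp

lemma absk_divide: "absk (x / y) = absk x / absk y"
  by (simp add: field_class.field_divide_inverse absk_mult absk_inverse divide_inverse)

lemma absk_power: "absk (x ^ k) = absk x ^ k"
  by (induction k) (simp_all add: absk_mult)

lemma absk_add_le: "absk x \<le> c \<Longrightarrow> absk y \<le> c \<Longrightarrow> absk (x + y) \<le> c"
  using absk_ultrametric[of x y] by linarith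

lemma absk_diff_le: "absk x \<le> c \<Longrightarrow> absk y \<le> c \<Longrightarrow> absk (x - y) \<le> c"
  using absk_add_le[of x c "- y"] by simp

lemma absk_add_less: "absk x < c \<Longrightarrow> absk y < c \<Longrightarrow> absk (x + y) < c"
  using absk_ultrametric[of x y] by linarith

lemma absk_add_eq:
  assumes "absk y < absk x"
  shows "absk (x + y) = absk x"
proof (rule antisym)
  show "absk (x + y) \<le> absk x" using assms absk_ultrametric[of x y] by linarith
  have "absk x \<le> max (absk (x + y)) (absk y)"
    using absk_ultrametric[of "x + y" "- y"] by simp
  thus "absk x \<le> absk (x + y)" using assms by linarith
qed

lemma absk_eq_1I: "absk (x - 1) < 1 \<Longrightarrow> absk x = 1"
  using absk_add_eq[of "x - 1" 1] by (simp add: algebra_simps)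

end

context local_field_quantization
begin

text \<open>1 / q is the value of some uniformizer, which lies below 1, so q exceeds 1. Any two
  uniformizers divide each other in the ring of integers; the fixed \<pi> therefore has the
  normalized value too.\<close>

lemma q_ge_2: "2 \<le> q" and absk_pi: "absk \<pi> = 1 / q"
proof -
  obtain p where p: "is_uniformizer (p::'k)" "absk p = 1 / q"
    using absk_normalized unfolding q_def by blast
  have p1: "absk p < 1" "p \<noteq> 0"
  proof -
    have "p \<in> {p * y | y. y \<in> integers}"
      by (auto simp: integers_def intro!: exI[of _ 1])
    thus "absk p < 1" using p unfolding is_uniformizer_def by blast
  qed (use p in \<open>auto simp: is_uniformizer_def\<close>)
  have "1 / q > 0" using p(2) p1(2) by (metis absk_pos_iff)
  hence "q > 0" by simp
  hence "q > 1" using p(2) p1(1) by (simp add: divide_less_eq)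
  hence "1 < card (residue_field :: 'k set set)" unfolding q_def by simp
  thus "2 \<le> q" unfolding q_def by simp
  have le: "absk a \<le> absk b" if "is_uniformizer a" "is_uniformizer b" for a b :: 'k
  proof -
    have "a \<in> {a * y | y. y \<in> integers}"
      by (auto simp: integers_def intro!: exI[of _ 1])
    hence "absk a < 1" using that unfolding is_uniformizer_def by blast
    hence "a \<in> {b * y | y. y \<in> integers}" using that unfolding is_uniformizer_def by blast
    then obtain y where "a = b * y" "absk y \<le> 1" by (auto simp: integers_def)
    thus ?thesis by (simp add: absk_mult mult_left_le)
  qed
  show "absk \<pi> = 1 / q" using le[OF uniformizer p(1)] le[OF p(1) uniformizer] p(2) by simp
qed

lemma q_pos [simp]: "0 < q" and q_gt_1 [simp]: "1 < q" and q_nz [simp]: "q \<noteq> 0"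
  using q_ge_2 by auto

lemma pi_nz [simp]: "\<pi> \<noteq> 0"
  using uniformizer unfolding is_uniformizer_def by blast

lemma q_powi_le_iff [simp]: "q powi i \<le> q powi j \<longleftrightarrow> i \<le> j"
  by (metis q_gt_1 power_int_increasing power_int_strict_increasing less_eq_real_def not_le order_less_irrefl order_less_le_trans)

lemma q_powi_less_iff [simp]: "q powi i < q powi j \<longleftrightarrow> i < j"
  by (meson not_le q_powi_le_iff)

lemma q_powi_pos [simp]: "0 < q powi i" "0 \<le> q powi i"
  by (simp_all add: zero_less_power_int less_imp_le)

lemma absk_powi_pi: "absk (\<pi> powi i) = q powi (- i)"
proof -
  have *: "absk (\<pi> powi int k) = q powi (- int k)" for k
    by (simp add: absk_power absk_pi power_int_minus power_one_over inverse_eq_divide)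
  show ?thesis
  proof (cases "0 \<le> i")
    case True
    thus ?thesis using *[of "nat i"] by simp
  next
    case False
    thus ?thesis using *[of "nat (- i)"]
      by (simp add: power_int_minus absk_inverse flip: ) (metis absk_inverse inverse_inverse_eq power_int_minus)
  qed
qed

text \<open>Scaling by a power of \<pi> leads to y with 1 <= |y| < q. Then |\<pi> y| < 1, so \<pi> y
  is \<pi> times an element of value at most 1, which forces |y| = 1.\<close>

lemma absk_eq_powi:
  fixes x :: 'k
  assumes "x \<noteq> 0"
  obtains i where "absk x = q powi i"
proof -
  define k where "k = \<lfloor>log q (absk x)\<rfloor>"
  have pos: "0 < absk x" using assms by simp
  have k1: "q powi k \<le> absk x"
  proof -
    have "q powr (of_int k) \<le> absk x" unfolding k_def
      using pos by (metis of_int_floor_le powr_le_cancel_iff powr_log_cancel q_gt_1 q_nz q_pos less_irrefl)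
    thus ?thesis using powr_real_of_int'[of q k] q_pos by (simp del: powr_real_of_int')
  qed
  have k2: "absk x < q powi (k + 1)"
  proof -
    have "absk x < q powr (of_int (k + 1))" unfolding k_def
      using pos by (metis floor_correct powr_less_cancel_iff powr_log_cancel q_gt_1 q_nz q_pos less_irrefl)
    thus ?thesis by (metis powr_real_of_int' q_pos less_imp_le q_nz)
  qed
  define y where "y = x * \<pi> powi k"
  have y: "absk y = absk x * q powi (- k)" by (simp add: y_def absk_mult absk_powi_pi)
  have y1: "1 \<le> absk y" using k1 by (simp add: y power_int_minus field_simps)
  have y2: "absk y < q" using k2 by (simp add: y power_int_minus field_simps power_int_add)
  have "absk (\<pi> * y) < 1" using y2 by (simp add: absk_mult absk_pi field_simps)
  then obtain w where "\<pi> * y = \<pi> * w" "absk w \<le> 1"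
    using uniformizer unfolding is_uniformizer_def integers_def by blast
  hence "absk y = 1" using y1 by simp
  hence "absk x = q powi k" by (simp add: y power_int_minus field_simps)
  thus ?thesis by (rule that)
qed

lemma absk_less_powi_iff: "absk (x::'k) < q powi (i + 1) \<longleftrightarrow> absk x \<le> q powi i"
proof (cases "x = 0")
  case False
  then obtain j where "absk x = q powi j" by (rule absk_eq_powi)
  thus ?thesis by simp
qed auto

text \<open>The coset of \<pi>^i O through a; a larger index means a smaller ball. Both
  \<open>U\<close> and the classes in \<open>\<Gamma>\<close> are of this form, with index n and -n,
  so all statements about either become statements about balls.\<close>

definition cb :: "'k \<Rightarrow> int \<Rightarrow> 'k set" where
  "cb a i = {x. absk (x - a) \<le> q powi (- i)}"

lemma mem_cb_self [simp]: "a \<in> cb a i"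
  by (simp add: cb_def)

lemma mem_cb_sym: "x \<in> cb y i \<longleftrightarrow> y \<in> cb x i"
  by (simp add: cb_def absk_minus_commute)

lemma mem_cb_trans: "x \<in> cb y i \<Longrightarrow> y \<in> cb z i \<Longrightarrow> x \<in> cb z i"
  using absk_add_le[of "x - y" _ "y - z"] by (simp add: cb_def)

lemma cb_eq: "x \<in> cb a i \<Longrightarrow> cb x i = cb a i"
  using mem_cb_trans mem_cb_sym by blast

lemma cb_mono: "i \<le> j \<Longrightarrow> cb a j \<subseteq> cb a i"
  unfolding cb_def using q_powi_le_iff[of "-j" "-i"] by (auto intro: order_trans)

lemma cb_subset: "x \<in> cb a i \<Longrightarrow> i \<le> j \<Longrightarrow> cb x j \<subseteq> cb a i"
  using cb_mono cb_eq by blast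

lemma cb_image_add: "(\<lambda>t. a + t) -` cb a i = cb 0 i"
  by (auto simp: cb_def)

lemma integers_eq_cb: "integers = cb 0 0"
  by (auto simp: integers_def cb_def)

lemma powi_mult_integers: "{a + \<pi> powi i * x | x. x \<in> integers} = cb a i"
proof (intro set_eqI iffI)
  fix y assume "y \<in> cb a i"
  define x where "x = (y - a) * \<pi> powi (- i)"
  have "y = a + \<pi> powi i * x" by (simp add: x_def power_int_minus field_simps)
  moreover have "absk x \<le> 1"
    using \<open>y \<in> cb a i\<close> mult_right_mono[of "absk (y - a)" "q powi (- i)" "q powi i"]
    by (simp add: x_def cb_def absk_mult absk_powi_pi flip: power_int_add)
  ultimately show "y \<in> {a + \<pi> powi i * x | x. x \<in> integers}" by (auto simp: integers_def)
next
  fix y assume "y \<in> {a + \<pi> powi i * x | x. x \<in> integers}"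
  thus "y \<in> cb a i"
    by (auto simp: integers_def cb_def absk_mult absk_powi_pi mult_left_le)
qed

lemma U_eq_cb: "U = cb 1 (int n)"
  unfolding U_def powi_mult_integers[symmetric] by simp

lemma cls_eq_cb: "cls t = cb t (- int n)"
  unfolding cls_def powi_mult_integers[symmetric] by (simp add: power_int_minus)

section \<open>Representatives of balls\<close>

lemma residue_representatives:
  obtains Z :: "'k set" where "finite Z" "Z \<subseteq> integers" "card Z = card (residue_field :: 'k set set)"
    "\<And>x. x \<in> integers \<Longrightarrow> \<exists>z\<in>Z. absk (x - z) < 1"
    "\<And>x y. x \<in> Z \<Longrightarrow> y \<in> Z \<Longrightarrow> absk (x - y) < 1 \<Longrightarrow> x = y"
proof -
  define R where "R = {(x, y). x \<in> integers \<and> y \<in> integers \<and> absk (x - y :: 'k) < 1}"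
  have res: "residue_field = integers // R" by (simp add: residue_field_def R_def)
  have eq: "equiv integers R"
  proof (rule equivI)
    show "trans R"
    proof (rule transI)
      fix x y z assume "(x, y) \<in> R" "(y, z) \<in> R"
      thus "(x, z) \<in> R" using absk_add_less[of "x - y" 1 "y - z"] by (simp add: R_def)
    qed
  qed (auto simp: refl_on_def sym_def R_def absk_minus_commute)
  define g where "g = (\<lambda>C::'k set. SOME x. x \<in> C)"
  have g: "g C \<in> C" if "C \<in> residue_field" for C
    using that in_quotient_imp_non_empty[OF eq] unfolding res g_def
    by (metis all_not_in_conv someI)
  have gi: "g C \<in> integers" if "C \<in> residue_field" for C
    using g[OF that] that in_quotient_imp_subset[OF eq] unfolding res by blast
  have inj: "C = D" if "C \<in> residue_field" "D \<in> residue_field" "absk (g C - g D) < 1" for C D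
    using quotient_eqI[OF eq that(1,2)[unfolded res] g[OF that(1)] g[OF that(2)]] that gi
    by (simp add: R_def)
  show ?thesis
  proof (rule that[of "g ` residue_field"])
    show "finite (g ` residue_field)" by (rule finite_imageI[OF finite_residue_field])
    show "g ` residue_field \<subseteq> integers" using gi by blast
    show "card (g ` residue_field) = card (residue_field :: 'k set set)"
      by (rule card_image) (metis (no_types, lifting) inj_onI inj absk_0 diff_self zero_less_one)
    show "\<exists>z\<in>g ` residue_field. absk (x - z) < 1" if "x \<in> integers" for x
    proof -
      have "R `` {x} \<in> residue_field" unfolding res using that by (rule quotientI)
      from g[OF this] this show ?thesis by (auto simp: R_def)
    qed
    show "x = y" if "x \<in> g ` residue_field" "y \<in> g ` residue_field" "absk (x - y) < 1" for x y
      using that inj by blast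
  qed
qed

text \<open>A system of representatives for the cosets of \<pi>^m O inside \<open>cb a i\<close>.
  The cardinality is included because all volumes are computed from it.\<close>

definition reps :: "'k \<Rightarrow> int \<Rightarrow> int \<Rightarrow> 'k set \<Rightarrow> bool" where
  "reps a i m R \<longleftrightarrow> finite R \<and> real (card R) = q powi (m - i) \<and> cb a i = (\<Union>r\<in>R. cb r m) \<and>
     (\<forall>x\<in>R. \<forall>y\<in>R. x \<in> cb y m \<longrightarrow> x = y)"

lemma reps_eq: "reps a i m R \<Longrightarrow> cb a i = (\<Union>r\<in>R. cb r m)"
  by (simp add: reps_def)

lemma reps_cover:
  assumes "reps a i m R" "x \<in> cb a i"
  obtains r where "r \<in> R" "x \<in> cb r m"
  using assms(2) unfolding reps_eq[OF assms(1)] by blast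

lemma reps_finite: "reps a i m R \<Longrightarrow> finite R"
  by (simp add: reps_def)

lemma reps_inj: "reps a i m R \<Longrightarrow> x \<in> R \<Longrightarrow> y \<in> R \<Longrightarrow> x \<in> cb y m \<Longrightarrow> x = y"
  by (simp add: reps_def)

text \<open>By refinement: each ball of level m splits into q balls of level m + 1, whose centres
  are shifted by residue representatives scaled with \<pi>^m.\<close>

lemma reps_exist:
  assumes "i \<le> m"
  obtains R where "reps a i m R"
proof -
  have "\<exists>R. reps a i m R" using assms
  proof (induction m rule: int_ge_induct)
    case base
    show ?case by (rule exI[of _ "{a}"]) (simp add: reps_def)
  next
    case (step m)
    then obtain R where R: "reps a i m R" by blast
    obtain Z :: "'k set" where Z: "finite Z" "Z \<subseteq> integers" "card Z = card (residue_field :: 'k set set)"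
      "\<And>x. x \<in> integers \<Longrightarrow> \<exists>z\<in>Z. absk (x - z) < 1"
      "\<And>x y. x \<in> Z \<Longrightarrow> y \<in> Z \<Longrightarrow> absk (x - y) < 1 \<Longrightarrow> x = y"
      by (rule residue_representatives) blast
    define f where "f = (\<lambda>(r, z). r + \<pi> powi m * z)"
    have in_cb: "f (r, z) \<in> cb r m" if "z \<in> Z" for r z
      using that Z(2) by (auto simp: f_def simp flip: powi_mult_integers)
    have key: "r = r' \<and> z = z'" if "r \<in> R" "r' \<in> R" "z \<in> Z" "z' \<in> Z" "f (r, z) \<in> cb (f (r', z')) (m + 1)" for r r' z z'
    proof -
      have "f (r, z) \<in> cb (f (r', z')) m" using that(5) cb_mono[of m "m + 1"] by auto
      hence "r \<in> cb r' m" using in_cb that(3,4) by (meson mem_cb_sym mem_cb_trans)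
      hence r: "r = r'" using R that(1,2) by (simp add: reps_def)
      have "absk (\<pi> powi m * (z - z')) \<le> q powi (- (m + 1))"
        using that(5) by (simp add: r f_def cb_def algebra_simps)
      moreover have "q powi (- (m + 1)) = q powi (- m) * q powi (- 1)"
        using power_int_add[of q "- m" "- 1"] by simp
      ultimately have "q powi (- m) * absk (z - z') \<le> q powi (- m) * q powi (- 1)"
        unfolding absk_mult absk_powi_pi by argo
      hence "absk (z - z') \<le> q powi (- 1)" using mult_le_cancel_left_pos[of "q powi (- m)"] q_powi_pos(1) by blast
      hence "absk (z - z') \<le> inverse q" by (simp add: power_int_minus)
      also have "\<dots> < 1" using q_gt_1 by (simp add: field_simps)
      finally show ?thesis using r Z(5) that(3,4) by blast
    qed
    have inj: "inj_on f (R \<times> Z)" using key by (auto intro!: inj_onI)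
    have "reps a i (m + 1) (f ` (R \<times> Z))"
      unfolding reps_def
    proof (intro conjI ballI impI)
      show "finite (f ` (R \<times> Z))" using R Z(1) by (auto simp: reps_def)
      have "real (card (f ` (R \<times> Z))) = q powi (m - i) * q"
        using R by (simp add: card_image[OF inj] card_cartesian_product reps_def Z(3) q_def)
      also have "\<dots> = q powi (m + 1 - i)" using power_int_add_1[of q "m - i"] by (simp add: algebra_simps)
      finally show "real (card (f ` (R \<times> Z))) = q powi (m + 1 - i)" .
      show "cb a i = (\<Union>r\<in>f ` (R \<times> Z). cb r (m + 1))"
      proof (intro set_eqI iffI)
        fix x assume "x \<in> cb a i"
        then obtain r where r: "r \<in> R" "x \<in> cb r m" using R unfolding reps_def by blast
        then obtain y where y: "x = r + \<pi> powi m * y" "y \<in> integers"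
          by (auto simp flip: powi_mult_integers)
        then obtain z where z: "z \<in> Z" "absk (y - z) < 1" using Z(4) by blast
        have "absk (y - z) \<le> q powi (- 1)" using z(2) absk_less_powi_iff[of "y - z" "- 1"] by simp
        hence "absk (\<pi> powi m * (y - z)) \<le> q powi (- m) * q powi (- 1)"
          by (simp add: absk_mult absk_powi_pi)
        also have "\<dots> = q powi (- (m + 1))" using power_int_add[of q "- m" "- 1"] by simp
        finally have "x \<in> cb (f (r, z)) (m + 1)" by (simp add: y f_def cb_def algebra_simps)
        thus "x \<in> (\<Union>r\<in>f ` (R \<times> Z). cb r (m + 1))" using r z by blast
      next
        fix x assume "x \<in> (\<Union>r\<in>f ` (R \<times> Z). cb r (m + 1))"
        then obtain r z where rz: "r \<in> R" "z \<in> Z" "x \<in> cb (f (r, z)) (m + 1)" by blast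
        hence "x \<in> cb r m" using in_cb[of z r] cb_subset[of "f (r, z)" r m "m + 1"] by auto
        thus "x \<in> cb a i" using R rz(1) unfolding reps_def by blast
      qed
      show "x = y" if "x \<in> f ` (R \<times> Z)" "y \<in> f ` (R \<times> Z)" "x \<in> cb y (m + 1)" for x y
        using that key by blast
    qed
    thus ?case by blast
  qed
  thus ?thesis using that by blast
qed

lemma reps_subset: "reps a i m R \<Longrightarrow> R \<subseteq> cb a i"
  unfolding reps_def by force

text \<open>Pigeonhole: separated points lie in different balls of level m, and if there are as many
  points as balls, no ball is missed.\<close>

lemma repsI:
  assumes R: "reps a i m R" and S: "finite S" "S \<subseteq> cb a i" "card S = card R"
    "\<And>x y. x \<in> S \<Longrightarrow> y \<in> S \<Longrightarrow> x \<in> cb y m \<Longrightarrow> x = y" and "i \<le> m"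
  shows "reps a i m S"
proof -
  have "\<exists>r. r \<in> R \<and> s \<in> cb r m" if "s \<in> S" for s using reps_cover[OF R] S(2) that by (metis subsetD)
  then obtain f where f: "\<And>s. s \<in> S \<Longrightarrow> f s \<in> R" "\<And>s. s \<in> S \<Longrightarrow> s \<in> cb (f s) m" by metis
  have "inj_on f S"
  proof (rule inj_onI)
    fix x y assume "x \<in> S" "y \<in> S" "f x = f y"
    thus "x = y" using f(2)[of x] f(2)[of y] S(4)[of x y] cb_eq[of y "f y" m] by simp
  qed
  hence "card (f ` S) = card R" using S(3) by (simp add: card_image)
  moreover have "f ` S \<subseteq> R" "finite R" using f(1) R by (auto simp: reps_def)
  ultimately have "f ` S = R" by (metis card_subset_eq)
  have "cb a i \<subseteq> (\<Union>r\<in>S. cb r m)"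
  proof
    fix x assume "x \<in> cb a i"
    then obtain r where "r \<in> R" "x \<in> cb r m" by (rule reps_cover[OF R])
    moreover then obtain t where "t \<in> S" "r = f t" using \<open>f ` S = R\<close> by blast
    ultimately have "x \<in> cb t m" using f(2)[of t] by (metis cb_eq)
    thus "x \<in> (\<Union>r\<in>S. cb r m)" using \<open>t \<in> S\<close> by blast
  qed
  moreover have "(\<Union>r\<in>S. cb r m) \<subseteq> cb a i" using S(2) cb_subset \<open>i \<le> m\<close> by blast
  ultimately have "cb a i = (\<Union>r\<in>S. cb r m)" by (rule equalityI)
  thus ?thesis using R S(1,3,4) unfolding reps_def by simp
qed

end

section \<open>Residue characteristic two\<close>

text \<open>Used only where all nonzero integers are invertible; there it is the inclusion of the
  prime field Q.\<close>

definition rat_embed :: "rat \<Rightarrow> 'a::field" where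
  "rat_embed r = of_int (fst (quotient_of r)) / of_int (snd (quotient_of r))"

context
  assumes two_nz: "(2::'a::complete_ultrametric_field) \<noteq> 0" and two_small: "absk (2::'a) < 1"
begin

lemma absk_of_int_le_1: "absk (of_int m :: 'a) \<le> 1"
proof -
  have nat: "absk (of_nat k :: 'a) \<le> 1" for k
    by (induction k) (auto intro!: absk_add_le)
  show ?thesis using nat[of "nat m"] nat[of "nat (- m)"]
    by (cases "0 \<le> m") (simp_all add: of_nat_nat)
qed

lemma absk_of_int_odd:
  assumes "odd m"
  shows "absk (of_int m :: 'a) = 1"
proof -
  obtain k where k: "m = 2 * k + 1" using assms by (rule oddE)
  have "absk (2 * of_int k :: 'a) \<le> absk (2::'a) * 1"
    unfolding absk_mult by (intro mult_left_mono absk_of_int_le_1) simp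
  hence "absk (2 * of_int k :: 'a) < absk (1::'a)" using two_small by simp
  from absk_add_eq[OF this] show ?thesis by (simp add: k add.commute)
qed

text \<open>Odd integers have value 1, so the value of an integer is decided by its power of 2. In
  particular no nonzero integer vanishes in the field, which therefore contains Q.\<close>

lemma absk_of_int:
  assumes "m \<noteq> 0"
  shows "absk (of_int m :: 'a) = absk (2::'a) ^ multiplicity 2 m"
proof -
  obtain b where b: "m = 2 ^ multiplicity 2 m * b" "\<not> 2 dvd b"
    using multiplicity_decompose'[of m 2] assms by auto
  have "(of_int m :: 'a) = 2 ^ multiplicity 2 m * of_int b" by (subst b(1)) simp
  thus ?thesis using absk_of_int_odd[of b] b(2) by (simp add: absk_mult absk_power)
qed

lemma of_int_nz: "m \<noteq> 0 \<Longrightarrow> (of_int m :: 'a) \<noteq> 0"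
  using absk_of_int[of m] two_nz by (metis absk_eq_0_iff power_not_zero)

lemma rat_embed_eq:
  assumes r: "r = of_int a / of_int b" and b: "b \<noteq> 0"
  shows "(rat_embed r :: 'a) = of_int a / of_int b"
proof -
  obtain c d where cd: "quotient_of r = (c, d)" by (cases "quotient_of r")
  have d: "d \<noteq> 0" using quotient_of_denom_pos[OF cd] by simp
  have "of_int c / of_int d = (of_int a / of_int b :: rat)" using quotient_of_div[OF cd] r by simp
  hence "of_int (c * b) = (of_int (a * d) :: rat)" using b d by (simp add: field_simps)
  hence "c * b = a * d" by (simp only: of_int_eq_iff)
  hence "of_int c * of_int b = (of_int a * of_int d :: 'a)" by (metis of_int_mult)
  thus ?thesis using of_int_nz[OF b] of_int_nz[OF d] by (simp add: rat_embed_def cd field_simps)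
qed

lemma rat_fraction: "\<exists>a b. r = of_int a / of_int b \<and> b \<noteq> 0" for r :: rat
proof -
  obtain c d where cd: "quotient_of r = (c, d)" by (cases "quotient_of r")
  thus ?thesis using quotient_of_div[OF cd] quotient_of_denom_pos[OF cd] by (intro exI[of _ c] exI[of _ d]) auto
qed

lemma rat_embed_1: "rat_embed 1 = (1::'a)"
  using rat_embed_eq[of 1 1 1] by simp

lemma rat_embed_0: "rat_embed 0 = (0::'a)"
  using rat_embed_eq[of 0 0 1] by simp

lemma rat_embed_add: "rat_embed (r + s) = (rat_embed r + rat_embed s :: 'a)"
proof -
  obtain a b where r: "r = of_int a / of_int b" "b \<noteq> 0" using rat_fraction by blast
  obtain c d where s: "s = of_int c / of_int d" "d \<noteq> 0" using rat_fraction by blast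
  have "r + s = of_int (a * d + c * b) / of_int (b * d)" using r s by (simp add: field_simps)
  from rat_embed_eq[OF this] r s
  have "rat_embed (r + s) = (of_int (a * d + c * b) / of_int (b * d) :: 'a)" by simp
  thus ?thesis using rat_embed_eq[OF r] rat_embed_eq[OF s] of_int_nz[OF r(2)] of_int_nz[OF s(2)]
    by (simp add: add_frac_eq)
qed

lemma rat_embed_mult: "rat_embed (r * s) = (rat_embed r * rat_embed s :: 'a)"
proof -
  obtain a b where r: "r = of_int a / of_int b" "b \<noteq> 0" using rat_fraction by blast
  obtain c d where s: "s = of_int c / of_int d" "d \<noteq> 0" using rat_fraction by blast
  have "r * s = of_int (a * c) / of_int (b * d)" using r s by simp
  from rat_embed_eq[OF this] r s
  have "rat_embed (r * s) = (of_int (a * c) / of_int (b * d) :: 'a)" by simp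
  thus ?thesis using rat_embed_eq[OF r] rat_embed_eq[OF s] by simp
qed

lemma rat_embed_diff: "rat_embed (r - s) = (rat_embed r - rat_embed s :: 'a)"
  using rat_embed_add[of "r - s" s] by (simp add: algebra_simps)

lemma rat_embed_inverse:
  assumes "r \<noteq> 0"
  shows "rat_embed (inverse r) = inverse (rat_embed r :: 'a)"
proof -
  have "rat_embed r * rat_embed (inverse r) = (1::'a)"
    using rat_embed_mult[of r "inverse r"] rat_embed_1 assms by simp
  thus ?thesis by (metis inverse_unique)
qed

text \<open>The field may give 2 a value other than 1/2. Raising its absolute value to this power
  makes it restrict to the 2-adic absolute value on Q.\<close>

definition two_adic_exponent :: real where
  "two_adic_exponent = ln 2 / - ln (absk (2::'a))"

lemma two_adic_exponent_pos: "0 < two_adic_exponent"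
proof -
  have "ln (absk (2::'a)) < 0" using two_small two_nz by simp
  thus ?thesis by (simp add: two_adic_exponent_def divide_pos_neg)
qed

lemma absk_2_powr: "absk (2::'a) powr two_adic_exponent = 1 / 2"
proof -
  have "ln (absk (2::'a)) < 0" using two_small two_nz by simp
  hence "two_adic_exponent * ln (absk (2::'a)) = - ln 2" by (simp add: two_adic_exponent_def)
  thus ?thesis using two_nz by (simp add: powr_def exp_minus inverse_eq_divide)
qed

lemma absk_rat_embed: "absk (rat_embed r :: 'a) powr two_adic_exponent = padic_abs 2 r"
proof (cases "r = 0")
  case True
  thus ?thesis by (simp add: rat_embed_0 padic_abs_def)
next
  case False
  obtain c d where cd: "quotient_of r = (c, d)" by (cases "quotient_of r")
  have d: "d \<noteq> 0" using quotient_of_denom_pos[OF cd] by simp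
  have c: "c \<noteq> 0" using quotient_of_div[OF cd] False by auto
  have pow: "(absk (2::'a) ^ k) powr two_adic_exponent = (1 / 2) ^ k" for k
  proof -
    have "(absk (2::'a) ^ k) powr two_adic_exponent = (absk (2::'a) powr two_adic_exponent) ^ k"
      using two_nz by (simp add: powr_powr mult.commute flip: powr_realpow)
    thus ?thesis by (simp add: absk_2_powr)
  qed
  have "absk (rat_embed r :: 'a) powr two_adic_exponent = (1 / 2) ^ multiplicity 2 c / (1 / 2) ^ multiplicity 2 d"
    by (simp add: rat_embed_def cd absk_divide absk_of_int[OF c] absk_of_int[OF d] powr_divide pow)
  also have "\<dots> = 2 powi (int (multiplicity 2 d) - int (multiplicity 2 c))"
    by (simp add: power_int_diff power_one_over field_simps)
  finally show ?thesis using False by (simp add: padic_abs_def cd)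
qed

text \<open>The renormalized absolute value has the same balls with changed radii, so completeness
  and density may be verified for the original one.\<close>

lemma powr_two_adic_less_iff:
  assumes "0 < e"
  shows "absk (x::'a) powr two_adic_exponent < e \<longleftrightarrow> absk x < e powr (1 / two_adic_exponent)"
proof -
  let ?c = two_adic_exponent
  have e: "(e powr (1 / ?c)) powr ?c = e" using two_adic_exponent_pos assms by (simp add: powr_powr)
  show ?thesis
  proof
    assume "absk x < e powr (1 / ?c)"
    hence "absk x powr ?c < (e powr (1 / ?c)) powr ?c"
      using two_adic_exponent_pos by (intro powr_less_mono2) auto
    thus "absk x powr ?c < e" by (simp only: e)
  next
    assume "absk x powr ?c < e"
    show "absk x < e powr (1 / ?c)"
    proof (rule ccontr)
      assume "\<not> absk x < e powr (1 / ?c)"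
      hence "(e powr (1 / ?c)) powr ?c \<le> absk x powr ?c"
        using two_adic_exponent_pos by (intro powr_mono2) auto
      thus False using \<open>absk x powr ?c < e\<close> by (simp only: e)
    qed
  qed
qed

definition rat_closure :: "'a set" where
  "rat_closure = {x. \<forall>e>0. \<exists>r. absk (x - rat_embed r) < e}"

lemma rat_closureD:
  assumes "x \<in> rat_closure" "0 < e"
  obtains r where "absk (x - rat_embed r) < e"
  using assms unfolding rat_closure_def by blast

lemma rat_embed_in_closure: "rat_embed r \<in> rat_closure"
  unfolding rat_closure_def by (auto intro!: exI[of _ r])

lemma rat_closure_diff:
  assumes "x \<in> rat_closure" "y \<in> rat_closure"
  shows "x - y \<in> rat_closure"
  unfolding rat_closure_def
proof (intro CollectI allI impI)
  fix e :: real assume e: "0 < e"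
  obtain r where r: "absk (x - rat_embed r) < e" using assms(1) e by (rule rat_closureD)
  obtain s where s: "absk (y - rat_embed s) < e" using assms(2) e by (rule rat_closureD)
  have "absk ((x - rat_embed r) + - (y - rat_embed s)) < e" using r s by (intro absk_add_less) (simp_all add: absk_minus_commute)
  thus "\<exists>r. absk (x - y - rat_embed r) < e"
    by (intro exI[of _ "r - s"]) (simp add: rat_embed_diff algebra_simps)
qed

lemma rat_closure_mult:
  assumes "x \<in> rat_closure" "y \<in> rat_closure"
  shows "x * y \<in> rat_closure"
  unfolding rat_closure_def
proof (intro CollectI allI impI)
  fix e :: real assume e: "0 < e"
  have pos: "0 < absk x + 1" "0 < absk y + 1" using absk_nonneg[of x] absk_nonneg[of y] by linarith+
  have "0 < min 1 (e / (absk y + 1))" using e pos by simp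
  with assms(1) obtain r where r: "absk (x - rat_embed r) < min 1 (e / (absk y + 1))" by (rule rat_closureD)
  have "0 < e / (absk x + 1)" using e pos by simp
  with assms(2) obtain s where s: "absk (y - rat_embed s) < e / (absk x + 1)" by (rule rat_closureD)
  have "absk (x - rat_embed r) \<le> absk x + 1"
    using r absk_nonneg[of x] unfolding min_less_iff_conj by linarith
  hence "absk (rat_embed r :: 'a) \<le> absk x + 1"
    using absk_diff_le[of x "absk x + 1" "x - rat_embed r"] by simp
  hence "absk (rat_embed r * (y - rat_embed s)) \<le> (absk x + 1) * absk (y - rat_embed s)"
    unfolding absk_mult by (intro mult_right_mono) auto
  also have "\<dots> < (absk x + 1) * (e / (absk x + 1))" using s pos by (intro mult_strict_left_mono) auto
  finally have 1: "absk (rat_embed r * (y - rat_embed s)) < e" using pos by simp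
  have "absk ((x - rat_embed r) * y) \<le> absk (x - rat_embed r) * (absk y + 1)"
    unfolding absk_mult by (intro mult_left_mono) auto
  also have "\<dots> < e / (absk y + 1) * (absk y + 1)" using r pos by (intro mult_strict_right_mono) auto
  finally have 2: "absk ((x - rat_embed r) * y) < e" using pos by simp
  have "absk ((x - rat_embed r) * y + rat_embed r * (y - rat_embed s)) < e"
    using 2 1 by (rule absk_add_less)
  thus "\<exists>r. absk (x * y - rat_embed r) < e"
    by (intro exI[of _ "r * s"]) (simp add: rat_embed_mult algebra_simps)
qed

text \<open>A rational r closer to x than |x| has |r| = |x|, so the difference of the inverses has
  the value |x - r| / |x|^2.\<close>

lemma rat_closure_inverse:
  assumes x: "x \<in> rat_closure"
  shows "inverse x \<in> rat_closure"
proof (cases "x = 0")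
  case True
  thus ?thesis using x by simp
next
  case False
  show ?thesis unfolding rat_closure_def
  proof (intro CollectI allI impI)
    fix e :: real assume e: "0 < e"
    have pos: "0 < absk x" using False by simp
    have "0 < min (absk x) (e * (absk x * absk x))" using e pos by simp
    with x obtain r where r: "absk (x - rat_embed r) < min (absk x) (e * (absk x * absk x))" by (rule rat_closureD)
    have ar: "absk (rat_embed r :: 'a) = absk x"
      using absk_add_eq[of "rat_embed r - x" x] r by (simp add: absk_minus_commute)
    hence nz: "(rat_embed r :: 'a) \<noteq> 0" using pos by auto
    hence r0: "r \<noteq> 0" using rat_embed_0 by auto
    have "inverse x - inverse (rat_embed r) = - (x - rat_embed r) / (x * rat_embed r)"
      using False nz by (simp add: field_simps)
    hence "absk (inverse x - inverse (rat_embed r)) = absk (x - rat_embed r) / (absk x * absk x)"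
      by (simp only: absk_divide absk_minus absk_mult ar)
    also have "\<dots> < e" using r pos by (simp add: divide_less_eq)
    finally show "\<exists>r. absk (inverse x - rat_embed r) < e"
      using rat_embed_inverse[OF r0] by metis
  qed
qed

lemma rat_closure_complete:
  fixes X :: "nat \<Rightarrow> 'a"
  assumes X: "range X \<subseteq> rat_closure"
    and C: "\<forall>e>0. \<exists>N. \<forall>i\<ge>N. \<forall>j\<ge>N. absk (X i - X j) powr two_adic_exponent < e"
  shows "\<exists>x\<in>rat_closure. (\<lambda>i. absk (X i - x) powr two_adic_exponent) \<longlonglongrightarrow> 0"
proof -
  have "Cauchy X"
  proof (rule metric_CauchyI)
    fix e :: real assume e: "0 < e"
    have "0 < e powr two_adic_exponent" using e by simp
    then obtain N where "\<forall>i\<ge>N. \<forall>j\<ge>N. absk (X i - X j) powr two_adic_exponent < e powr two_adic_exponent" using C by blast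
    moreover have "(e powr two_adic_exponent) powr (1 / two_adic_exponent) = e"
      using e two_adic_exponent_pos by (simp add: powr_powr)
    ultimately show "\<exists>M. \<forall>m\<ge>M. \<forall>n\<ge>M. dist (X m) (X n) < e"
      using e by (auto simp: powr_two_adic_less_iff absk_dist)
  qed
  then obtain x where x: "X \<longlonglongrightarrow> x" using Cauchy_convergent convergent_def by blast
  have x_lim: "\<exists>N. \<forall>i\<ge>N. absk (X i - x) < e" if "0 < e" for e
    using metric_LIMSEQ_D[OF x that] by (simp add: absk_dist)
  have "x \<in> rat_closure"
    unfolding rat_closure_def
  proof (intro CollectI allI impI)
    fix e :: real assume e: "0 < e"
    obtain N where N: "absk (X N - x) < e" using x_lim[OF e] by blast
    have "X N \<in> rat_closure" using X by blast
    then obtain r where r: "absk (X N - rat_embed r) < e" using e by (rule rat_closureD)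
    have "absk (- (X N - x) + (X N - rat_embed r)) < e" using N r by (intro absk_add_less) (simp_all add: absk_minus_commute)
    thus "\<exists>r. absk (x - rat_embed r) < e" by (intro exI[of _ r]) simp
  qed
  moreover have "(\<lambda>i. absk (X i - x) powr two_adic_exponent) \<longlonglongrightarrow> 0"
  proof (rule LIMSEQ_I)
    fix e :: real assume e: "0 < e"
    hence "0 < e powr (1 / two_adic_exponent)" by simp
    from x_lim[OF this] show "\<exists>N. \<forall>i\<ge>N. norm (absk (X i - x) powr two_adic_exponent - 0) < e"
      using e by (simp add: powr_two_adic_less_iff)
  qed
  ultimately show ?thesis by blast
qed

text \<open>The field operations pass to the closure by continuity and completeness comes from the
  ambient field. The renormalized absolute value satisfies the triangle inequality because a
  positive power of an ultrametric absolute value is ultrametric.\<close>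

lemma rat_closure_copy_of_Q2: "is_copy_of_Qp 2 rat_closure"
  unfolding is_copy_of_Qp_def
proof (intro conjI ballI exI[of _ "\<lambda>x. absk x powr two_adic_exponent"] exI[of _ "rat_embed :: rat \<Rightarrow> 'a"] allI impI)
  show "1 \<in> rat_closure" using rat_embed_in_closure[of 1] by (simp add: rat_embed_1)
  fix x y :: 'a
  show "absk (x + y) powr two_adic_exponent \<le> absk x powr two_adic_exponent + absk y powr two_adic_exponent"
  proof -
    have "absk (x + y) powr two_adic_exponent \<le> max (absk x) (absk y) powr two_adic_exponent"
      using two_adic_exponent_pos absk_ultrametric by (intro powr_mono2) auto
    also have "\<dots> \<le> absk x powr two_adic_exponent + absk y powr two_adic_exponent" by (simp add: max_def)
    finally show ?thesis .
  qed
next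
  fix x :: 'a and e :: real assume x: "x \<in> rat_closure" and e: "0 < e"
  have "0 < e powr (1 / two_adic_exponent)" using e by simp
  with x obtain r where "absk (x - rat_embed r) < e powr (1 / two_adic_exponent)" by (rule rat_closureD)
  thus "\<exists>r. absk (x - rat_embed r) powr two_adic_exponent < e" using powr_two_adic_less_iff[OF e] by blast
qed (auto simp: rat_closure_diff rat_closure_mult rat_closure_inverse rat_embed_in_closure rat_embed_1
  rat_embed_add rat_embed_mult absk_rat_embed absk_mult powr_mult intro: rat_closure_complete[rule_format])

end

text \<open>By contraposition: |2| <= 1 always holds, so the alternative is |2| < 1. The hypothesis
  on the characteristic excludes 2 = 0, and then the closure of Q would be a copy of Q_2.\<close>

lemma absk_2_eq_1:
  assumes "CHAR('a::complete_ultrametric_field) \<noteq> 2" and "\<not> extends_Qp 2 TYPE('a)"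
  shows "absk (2::'a) = 1"
proof (rule ccontr)
  assume ne: "absk (2::'a) \<noteq> 1"
  have "absk (1 + 1 :: 'a) \<le> 1" by (rule absk_add_le) simp_all
  hence small: "absk (2::'a) < 1" using ne by simp
  have nz: "(2::'a) \<noteq> 0"
  proof
    assume "(2::'a) = 0"
    hence "of_nat 2 = (0::'a)" by simp
    hence "CHAR('a) dvd 2" by (simp only: of_nat_eq_0_iff_char_dvd)
    hence "CHAR('a) \<in> {1, 2}" by (metis dvd_imp_le insertCI le_SucE le_zero_eq numeral_2_eq_2 One_nat_def dvd_0_left_iff zero_less_Suc)
    thus False using assms(1) CHAR_not_1' by auto
  qed
  from rat_closure_copy_of_Q2[OF nz small] assms(2) show False unfolding extends_Qp_def by blast
qed

section \<open>Integration of locally constant functions\<close>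

context local_field_quantization
begin

lemma mem_cb_common: "x \<in> cb r m \<Longrightarrow> x \<in> cb s m \<Longrightarrow> r \<in> cb s m"
  using mem_cb_trans[of r x m s] mem_cb_sym[of r x m] by simp

lemma space_dt [simp]: "space dt = UNIV"
  using sets_eq_imp_space_eq[OF haar_sets] by simp

lemma open_cb: "open (cb a i)"
  unfolding open_dist
proof
  fix x assume x: "x \<in> cb a i"
  have "y \<in> cb a i" if "dist y x < q powi (- i)" for y
  proof -
    have "y \<in> cb x i" using that by (simp add: cb_def absk_dist)
    thus ?thesis using cb_eq[OF x] by simp
  qed
  thus "\<exists>e>0. \<forall>y. dist y x < e \<longrightarrow> y \<in> cb a i" using q_powi_pos(1) by blast
qed

lemma closed_cb: "closed (cb a i)"
proof -
  have "- cb a i = (\<Union>x\<in>- cb a i. cb x i)"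
    using mem_cb_common mem_cb_self by (auto simp: mem_cb_sym[of _ a])
  hence "open (- cb a i)" by (metis open_UN open_cb)
  thus ?thesis by (simp add: closed_def)
qed

lemma mem_cb_minus: "t \<in> cb 0 (- i) \<longleftrightarrow> absk t \<le> q powi i"
  by (simp add: cb_def)

lemma compact_cb: "compact (cb a i)"
  unfolding compact_eq_totally_bounded
proof (intro conjI allI impI)
  show "complete (cb a i)" using closed_cb by (simp add: complete_eq_closed)
  fix e :: real assume e: "0 < e"
  obtain k :: nat where k: "(1/q) ^ k < e" using real_arch_pow_inv[OF e, of "1/q"] by (auto simp: field_simps)
  define l where "l = max i (int k)"
  have l: "i \<le> l" "int k \<le> l" by (auto simp: l_def)
  obtain R where R: "reps a i l R" using l(1) by (rule reps_exist)
  have "q powi (- l) \<le> q powi (- int k)" unfolding q_powi_le_iff using l by simp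
  also have "\<dots> < e" using k by (simp add: power_int_minus power_one_over inverse_eq_divide)
  finally have "cb r l \<subseteq> ball r e" for r
    by (auto simp: cb_def dist_commute absk_dist)
  thus "\<exists>k. finite k \<and> cb a i \<subseteq> (\<Union>x\<in>k. ball x e)"
    using reps_finite[OF R] reps_eq[OF R] by (intro exI[of _ R]) auto
qed

lemma sets_cb [measurable, simp]: "cb a i \<in> sets dt"
  using open_cb haar_sets by simp

lemma translation_measurable: "(\<lambda>t. a + t) \<in> measurable dt dt"
proof -
  have "continuous_on UNIV (\<lambda>t::'k. a + t)"
    by (simp add: continuous_on_iff absk_dist algebra_simps) blast
  hence "(\<lambda>t. a + t) \<in> borel_measurable borel" by (rule borel_measurable_continuous_onI)
  thus ?thesis using measurable_cong_sets[OF haar_sets haar_sets] by simp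
qed

lemma emeasure_cb_translate: "emeasure dt (cb a i) = emeasure dt (cb 0 i)"
proof -
  have "emeasure dt (cb a i) = emeasure (distr dt dt (\<lambda>t. a + t)) (cb a i)"
    by (simp add: haar_invariant)
  also have "\<dots> = emeasure dt (cb 0 i)"
    by (simp add: emeasure_distr[OF translation_measurable] cb_image_add)
  finally show ?thesis .
qed

lemma reps_disjoint: "reps a i m R \<Longrightarrow> disjoint_family_on (\<lambda>r. cb r m) R"
  unfolding disjoint_family_on_def by (auto dest: mem_cb_common reps_inj)

lemma emeasure_reps:
  assumes "reps a i m R"
  shows "emeasure dt (cb a i) = ennreal (q powi (m - i)) * emeasure dt (cb 0 m)"
proof -
  have "emeasure dt (cb a i) = (\<Sum>r\<in>R. emeasure dt (cb r m))"
    unfolding reps_eq[OF assms]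
    by (rule sum_emeasure[symmetric]) (use reps_disjoint[OF assms] reps_finite[OF assms] in auto)
  also have "\<dots> = of_nat (card R) * emeasure dt (cb 0 m)"
    by (subst emeasure_cb_translate) simp
  also have "of_nat (card R) = ennreal (q powi (m - i))"
    using assms by (simp add: reps_def ennreal_of_nat_eq_real_of_nat)
  finally show ?thesis .
qed

text \<open>The normalization fixes the ball of level 0, and translation invariance with counting
  reaches the others: for i >= 0 the integers are cut into balls of level i, for i <= 0 the ball is
  cut into translates of the integers.\<close>

lemma emeasure_cb: "emeasure dt (cb a i) = ennreal (q powi (- i))"
proof -
  have 1: "emeasure dt (cb 0 0) = 1" using haar_normalized by (simp add: integers_eq_cb)
  have "emeasure dt (cb 0 i) = ennreal (q powi (- i))"
  proof (cases "0 \<le> i")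
    case True
    then obtain R where "reps 0 0 i R" by (rule reps_exist)
    from emeasure_reps[OF this] have *: "ennreal (q powi i) * emeasure dt (cb 0 i) = 1" by (simp add: 1)
    have "emeasure dt (cb 0 i) = ennreal (q powi (- i) * q powi i) * emeasure dt (cb 0 i)"
      by (simp flip: power_int_add)
    also have "\<dots> = ennreal (q powi (- i)) * (ennreal (q powi i) * emeasure dt (cb 0 i))"
      by (simp add: ennreal_mult mult.assoc)
    finally show ?thesis by (simp add: *)
  next
    case False
    hence "i \<le> 0" by simp
    then obtain R where "reps 0 i 0 R" by (rule reps_exist)
    from emeasure_reps[OF this] show ?thesis by (simp add: 1)
  qed
  thus ?thesis by (simp add: emeasure_cb_translate[of a])
qed

lemma measure_cb: "measure dt (cb a i) = q powi (- i)"
  by (simp add: measure_def emeasure_cb)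

section \<open>Locally constant functions and their integrals over balls\<close>

definition loc_const :: "int \<Rightarrow> 'k set \<Rightarrow> ('k \<Rightarrow> 'b) \<Rightarrow> bool" where
  "loc_const m A f \<longleftrightarrow> (\<forall>x\<in>A. \<forall>y\<in>A. x \<in> cb y m \<longrightarrow> f x = f y)"

lemma loc_constI: "(\<And>x y. x \<in> A \<Longrightarrow> y \<in> A \<Longrightarrow> x \<in> cb y m \<Longrightarrow> f x = f y) \<Longrightarrow> loc_const m A f"
  unfolding loc_const_def by blast

lemma loc_constD: "loc_const m A f \<Longrightarrow> x \<in> A \<Longrightarrow> y \<in> A \<Longrightarrow> x \<in> cb y m \<Longrightarrow> f x = f y"
  unfolding loc_const_def by blast

lemma loc_const_mono: "loc_const m A f \<Longrightarrow> m \<le> m' \<Longrightarrow> loc_const m' A f"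
  unfolding loc_const_def using cb_mono by blast

lemma has_integral_cb:
  fixes f :: "'k \<Rightarrow> 'b::{banach, second_countable_topology}"
  assumes R: "reps a i m R" and f: "loc_const m (cb a i) f" and "i \<le> m"
  shows "has_bochner_integral dt (\<lambda>x. indicator (cb a i) x *\<^sub>R f x) (q powi (- m) *\<^sub>R (\<Sum>r\<in>R. f r))"
proof -
  have eq: "indicator (cb a i) x *\<^sub>R f x = (\<Sum>r\<in>R. indicator (cb r m) x *\<^sub>R f r)" for x
  proof (cases "x \<in> cb a i")
    case True
    then obtain r where r: "r \<in> R" "x \<in> cb r m" by (rule reps_cover[OF R])
    have nin: "x \<notin> cb s m" if "s \<in> R" "s \<noteq> r" for s
    proof
      assume "x \<in> cb s m"
      from mem_cb_common[OF r(2) this] have "r = s" by (rule reps_inj[OF R r(1) that(1)])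
      thus False using that(2) by simp
    qed
    have "(\<Sum>s\<in>R. indicator (cb s m) x *\<^sub>R f s) = (\<Sum>s\<in>R. if s = r then f r else 0)"
    proof (rule sum.cong)
      fix s assume "s \<in> R"
      thus "indicator (cb s m) x *\<^sub>R f s = (if s = r then f r else 0)"
        using r(2) nin[of s] by (cases "s = r") simp_all
    qed simp
    also have "\<dots> = f r" using r(1) reps_finite[OF R] by simp
    also have "\<dots> = f x" using loc_constD[OF f True _ r(2)] r(1) reps_subset[OF R] by auto
    finally show ?thesis using True by simp
  next
    case False
    hence "x \<notin> cb r m" if "r \<in> R" for r using that unfolding reps_eq[OF R] by blast
    hence "(\<Sum>r\<in>R. indicator (cb r m) x *\<^sub>R f r) = 0" by (intro sum.neutral) simp
    thus ?thesis using False by simp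
  qed
  have "has_bochner_integral dt (\<lambda>x. \<Sum>r\<in>R. indicator (cb r m) x *\<^sub>R f r) (\<Sum>r\<in>R. q powi (- m) *\<^sub>R f r)"
  proof (rule has_bochner_integral_sum)
    fix r assume "r \<in> R"
    have "has_bochner_integral dt (indicator (cb r m)) (measure dt (cb r m))"
      by (rule has_bochner_integral_real_indicator) (simp_all add: emeasure_cb)
    thus "has_bochner_integral dt (\<lambda>x. indicator (cb r m) x *\<^sub>R f r) (q powi (- m) *\<^sub>R f r)"
      unfolding measure_cb by (rule has_bochner_integral_scaleR_left)
  qed
  thus ?thesis unfolding eq scaleR_sum_right .
qed

lemma integral_cb:
  fixes f :: "'k \<Rightarrow> 'b::{banach, second_countable_topology}"
  assumes "reps a i m R" "loc_const m (cb a i) f" "i \<le> m"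
  shows "(LINT x:cb a i|dt. f x) = q powi (- m) *\<^sub>R (\<Sum>r\<in>R. f r)"
  unfolding set_lebesgue_integral_def using has_integral_cb[OF assms] by (rule has_bochner_integral_integral_eq)

lemma integrable_cb:
  fixes f :: "'k \<Rightarrow> 'b::{banach, second_countable_topology}"
  assumes "loc_const m (cb a i) f"
  shows "set_integrable dt (cb a i) f"
proof -
  obtain R where "reps a i (max i m) R" by (rule reps_exist[of i "max i m"]) auto
  from has_integral_cb[OF this loc_const_mono[OF assms]] show ?thesis
    unfolding set_integrable_def by (auto simp: integrable.simps)
qed

text \<open>An isometry sends a system of representatives to separated points of the same number,
  which again form such a system by counting. Both integrals are then the same finite sum, and this
  replaces every change of variables below.\<close>

lemma integral_cb_isometry:
  fixes f :: "'k \<Rightarrow> 'b::{banach, second_countable_topology}"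
  assumes \<sigma>: "\<And>x. x \<in> cb a i \<Longrightarrow> \<sigma> x \<in> cb b i"
    and iso: "\<And>x y. x \<in> cb a i \<Longrightarrow> y \<in> cb a i \<Longrightarrow> absk (\<sigma> x - \<sigma> y) = absk (x - y)"
    and f: "loc_const m (cb b i) f"
  shows "(LINT x:cb a i|dt. f (\<sigma> x)) = (LINT x:cb b i|dt. f x)"
proof -
  define l where "l = max i m"
  have l: "i \<le> l" "loc_const l (cb b i) f" using loc_const_mono[OF f] by (auto simp: l_def)
  obtain R where R: "reps a i l R" using l(1) by (rule reps_exist)
  obtain S where S: "reps b i l S" using l(1) by (rule reps_exist)
  have sub: "R \<subseteq> cb a i" using R by (rule reps_subset)
  have inj: "inj_on \<sigma> R"
    using iso sub by (intro inj_onI) (metis subsetD absk_0 absk_eq_0_iff eq_iff_diff_eq_0)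
  have "reps b i l (\<sigma> ` R)"
  proof (rule repsI[OF S _ _ _ _ l(1)])
    show "\<sigma> ` R \<subseteq> cb b i" using \<sigma> sub by blast
    have "real (card R) = real (card S)" using R S by (simp add: reps_def)
    thus "card (\<sigma> ` R) = card S" by (simp add: card_image[OF inj])
    show "x = y" if "x \<in> \<sigma> ` R" "y \<in> \<sigma> ` R" "x \<in> cb y l" for x y
    proof -
      from that(1,2) obtain x' y' where *: "x' \<in> R" "y' \<in> R" "x = \<sigma> x'" "y = \<sigma> y'"
        by (elim imageE)
      have "x' \<in> cb y' l" using that(3) iso[of x' y'] subsetD[OF sub] * by (simp add: cb_def)
      thus ?thesis using reps_inj[OF R] * by blast
    qed
  qed (use reps_finite[OF R] in simp)
  note S' = integral_cb[OF this l(2) l(1)]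
  have "loc_const l (cb a i) (\<lambda>x. f (\<sigma> x))"
    by (rule loc_constI, rule loc_constD[OF l(2)]) (use \<sigma> iso in \<open>auto simp: cb_def\<close>)
  from integral_cb[OF R this l(1)] show ?thesis using S' by (simp add: sum.reindex[OF inj])
qed

section \<open>The additive character\<close>

lemma char_0 [simp]: "\<Psi> 0 = 1"
  by (rule char_trivial) (simp add: integers_def)

lemma char_minus: "\<Psi> (- t) = cnj (\<Psi> t)"
proof -
  have "\<Psi> t * \<Psi> (- t) = 1" by (simp flip: char_add)
  moreover have "\<Psi> t * cnj (\<Psi> t) = 1" by (simp add: complex_norm_square[symmetric] char_unitary)
  moreover have "\<Psi> t \<noteq> 0" using char_unitary[of t] by auto
  ultimately show ?thesis by (metis mult_left_cancel)
qed

lemma char_mult_cong: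
  assumes "absk t \<le> q powi m" "x \<in> cb y m"
  shows "\<Psi> (t * x) = \<Psi> (t * y)"
proof -
  have "absk (t * (x - y)) \<le> q powi m * q powi (- m)"
    unfolding absk_mult using assms by (intro mult_mono) (auto simp: cb_def)
  hence "t * (x - y) \<in> integers" by (simp add: integers_def flip: power_int_add)
  moreover have "t * x = t * y + t * (x - y)" by (simp add: algebra_simps)
  ultimately show ?thesis by (metis char_add char_trivial mult.right_neutral)
qed

text \<open>Start from an integer z with \<Psi>(z / \<pi>) different from 1 and rescale: h = z /
  (\<pi> t) lies in the ball because |t| is at least q^(m+1).\<close>

lemma char_nontrivial_on_cb:
  assumes "\<not> absk t \<le> q powi m"
  obtains h where "h \<in> cb 0 m" "\<Psi> (t * h) \<noteq> 1"
proof -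
  obtain z where z: "absk z \<le> 1" "\<Psi> (inverse \<pi> * z) \<noteq> 1"
    using char_nontrivial by (auto simp: integers_def)
  have t: "q powi (m + 1) \<le> absk t" using assms absk_less_powi_iff[of t m] by simp
  hence t0: "0 < absk t" using q_powi_pos(1) less_le_trans by blast
  have "absk (inverse \<pi> * z / t) = q * absk z / absk t"
    by (simp add: absk_divide absk_mult absk_inverse absk_pi)
  also have "\<dots> \<le> q / q powi (m + 1)" using z(1) t t0 q_pos by (intro frac_le) (auto simp: less_imp_le)
  also have "\<dots> = q powi (- m)" by (simp add: power_int_add power_int_minus field_simps)
  finally have "inverse \<pi> * z / t \<in> cb 0 m" by (simp add: cb_def)
  moreover have "\<Psi> (t * (inverse \<pi> * z / t)) \<noteq> 1" using z t0 by simp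
  ultimately show ?thesis by (rule that)
qed

lemma loc_const_char:
  assumes "t \<noteq> 0 \<Longrightarrow> absk t \<le> q powi m"
  shows "loc_const m A (\<lambda>x. \<Psi> (t * x))"
  using assms char_mult_cong[of t m] by (cases "t = 0") (auto intro!: loc_constI)

lemma ex_powi_bound: "\<exists>m. l \<le> m \<and> absk (t::'k) \<le> q powi m"
proof (cases "t = 0")
  case False
  then obtain i where "absk t = q powi i" by (rule absk_eq_powi)
  thus ?thesis by (intro exI[of _ "max l i"]) simp
qed auto

text \<open>If the character is trivial on the ball around 0 it is constant on the ball around a.
  Otherwise translation by some h multiplies the integral by \<Psi>(t h), which differs from
  1.\<close>

lemma integral_char_cb:
  "(LINT x:cb a i|dt. \<Psi> (t * x)) = (if absk t \<le> q powi i then of_real (q powi (- i)) * \<Psi> (t * a) else 0)"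
proof (cases "absk t \<le> q powi i")
  case True
  obtain R where R: "reps a i i R" using order_refl by (rule reps_exist)
  have "(\<Sum>r\<in>R. \<Psi> (t * r)) = (\<Sum>r\<in>R. \<Psi> (t * a))"
    using reps_subset[OF R] char_mult_cong[OF True] by (intro sum.cong) auto
  also have "\<dots> = \<Psi> (t * a)" using R by (simp add: reps_def)
  finally show ?thesis
    using integral_cb[OF R loc_const_char order_refl, of t] True by (simp add: scaleR_conv_of_real)
next
  case False
  then obtain h where h: "h \<in> cb 0 i" "\<Psi> (t * h) \<noteq> 1" by (rule char_nontrivial_on_cb)
  obtain m where m: "absk t \<le> q powi m" using ex_powi_bound by blast
  let ?I = "LINT x:cb a i|dt. \<Psi> (t * x)"
  have "?I = (LINT x:cb a i|dt. \<Psi> (t * (x + h)))"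
  proof (rule integral_cb_isometry[symmetric])
    show "x + h \<in> cb a i" if "x \<in> cb a i" for x
      using that h absk_add_le[of "x - a" _ h] by (simp add: cb_def algebra_simps)
    show "loc_const m (cb a i) (\<lambda>x. \<Psi> (t * x))" using m by (intro loc_const_char)
  qed simp
  also have "\<dots> = (LINT x:cb a i|dt. \<Psi> (t * h) * \<Psi> (t * x))"
    by (simp add: algebra_simps char_add)
  also have "\<dots> = \<Psi> (t * h) * ?I" by simp
  finally have "?I * (1 - \<Psi> (t * h)) = 0" by (simp add: algebra_simps)
  thus ?thesis using h False by simp
qed

end

section \<open>The compact group \<open>U\<close>\<close>

text \<open>The field hypotheses are condensed into |2| = 1, which is what makes squaring and
  \<open>\<phi>\<close> isometries of \<open>U\<close>.\<close>

locale odd_quantization = local_field_quantization \<pi> dt \<Psi> n \<theta>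
  for \<pi> :: "'k::nonarch_local_field" and dt \<Psi> n \<theta> +
  assumes n_pos: "1 \<le> n" and absk_2: "absk (2 :: 'k) = 1" and absk_theta: "absk \<theta> = 1"
begin

abbreviation N :: int where "N \<equiv> int n"

lemma U_absk: "u \<in> U \<Longrightarrow> absk u = 1"
proof -
  assume "u \<in> U"
  hence "absk (u - 1) \<le> q powi (- N)" by (simp add: U_eq_cb cb_def)
  also have "\<dots> < q powi 0" unfolding q_powi_less_iff using n_pos by simp
  finally show ?thesis by (intro absk_eq_1I) simp
qed

lemma U_nz: "u \<in> U \<Longrightarrow> u \<noteq> 0"
  using U_absk[of u] by auto

lemma one_in_U [simp]: "1 \<in> U"
  by (simp add: U_eq_cb)

lemma cb_mult:
  assumes "x' \<in> cb x m" "y' \<in> cb y m" "absk x' = 1" "absk y = 1"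
  shows "x' * y' \<in> cb (x * y) m"
proof -
  have "x' * y' - x * y = x' * (y' - y) + (x' - x) * y" by (simp add: algebra_simps)
  thus ?thesis using assms absk_add_le[of "x' * (y' - y)" _ "(x' - x) * y"] by (simp add: cb_def absk_mult)
qed

lemma absk_inverse_diff:
  assumes "absk x = 1" "absk (y::'k) = 1"
  shows "absk (inverse x - inverse y) = absk (x - y)"
proof -
  have nz: "x \<noteq> 0" "y \<noteq> 0" using assms by auto
  have "inverse x - inverse y = (y - x) * (inverse x * inverse y)" using nz by (simp add: field_simps)
  thus ?thesis using assms by (simp add: absk_mult absk_inverse absk_minus_commute)
qed

lemma cb_inverse: "x' \<in> cb x m \<Longrightarrow> absk x' = 1 \<Longrightarrow> absk x = 1 \<Longrightarrow> inverse x' \<in> cb (inverse x) m"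
  by (simp add: cb_def absk_inverse_diff)

lemma U_mult: "u \<in> U \<Longrightarrow> v \<in> U \<Longrightarrow> u * v \<in> U"
  using cb_mult[of u 1 N v 1] U_absk by (simp add: U_eq_cb)

lemma U_inverse: "u \<in> U \<Longrightarrow> inverse u \<in> U"
  using cb_inverse[of u 1 N] U_absk by (simp add: U_eq_cb)

lemma U_mult_congr:
  "x \<in> U \<Longrightarrow> x' \<in> U \<Longrightarrow> y \<in> U \<Longrightarrow> y' \<in> U \<Longrightarrow> x' \<in> cb x m \<Longrightarrow> y' \<in> cb y m \<Longrightarrow> x' * y' \<in> cb (x * y) m"
  by (rule cb_mult) (auto simp: U_absk)

lemma U_inverse_congr: "x \<in> U \<Longrightarrow> x' \<in> U \<Longrightarrow> x' \<in> cb x m \<Longrightarrow> inverse x' \<in> cb (inverse x) m"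
  by (rule cb_inverse) (auto simp: U_absk)

lemmas U_intros = U_mult U_inverse one_in_U
lemmas congr_intros = U_mult_congr U_inverse_congr mem_cb_self U_intros

lemma space_U [simp]: "space U_measure = U"
  by (simp add: U_measure_def space_restrict_space)

lemma sets_U_measure: "sets U_measure = (\<inter>) U ` sets dt"
  by (simp add: U_measure_def sets_restrict_space)

lemma U_sets: "U \<in> sets dt"
  by (simp add: U_eq_cb)

lemma emeasure_U_measure: "A \<subseteq> U \<Longrightarrow> emeasure U_measure A = emeasure dt A"
  unfolding U_measure_def using U_sets by (subst emeasure_restrict_space) auto

lemma finite_U [simp]: "finite_measure U_measure"
  by (rule finite_measureI) (simp add: emeasure_U_measure, simp add: U_eq_cb emeasure_cb)

lemma measure_U: "measure U_measure U = q powi (- N)"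
  by (simp add: measure_def emeasure_U_measure) (simp add: U_eq_cb emeasure_cb)

lemma cb_in_sets_U: "u \<in> U \<Longrightarrow> N \<le> m \<Longrightarrow> cb u m \<in> sets U_measure"
  unfolding sets_U_measure using cb_subset[of u 1 N m]
  by (intro image_eqI[of _ _ "cb u m"]) (auto simp: U_eq_cb)

abbreviation I :: "('k \<Rightarrow> 'b::{banach, second_countable_topology}) \<Rightarrow> 'b" where
  "I f \<equiv> integral\<^sup>L U_measure f"

lemma I_eq_set_integral: "I f = (LINT x:cb 1 N|dt. f x)"
  unfolding U_measure_def set_lebesgue_integral_def U_eq_cb
  by (subst integral_restrict_space) simp_all

lemma I_integrable:
  fixes f :: "'k \<Rightarrow> 'b::{banach, second_countable_topology}"
  assumes "loc_const m U f"
  shows "integrable U_measure f"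
  unfolding U_measure_def using integrable_cb[of m 1 N f] assms U_sets
  by (simp add: integrable_restrict_space U_eq_cb set_integrable_def)

lemma loc_const_borel:
  fixes f :: "'k \<Rightarrow> 'b::{banach, second_countable_topology}"
  shows "loc_const m U f \<Longrightarrow> f \<in> borel_measurable U_measure"
  by (rule borel_measurable_integrable[OF I_integrable])

lemma I_reps:
  fixes f :: "'k \<Rightarrow> 'b::{banach, second_countable_topology}"
  assumes "reps 1 N m R" "loc_const m U f" "N \<le> m"
  shows "I f = q powi (- m) *\<^sub>R (\<Sum>r\<in>R. f r)"
  unfolding I_eq_set_integral using assms by (intro integral_cb) (simp_all add: U_eq_cb)

lemma I_cong: "(\<And>x. x \<in> U \<Longrightarrow> f x = g x) \<Longrightarrow> I f = I g"
  by (rule Bochner_Integration.integral_cong) simp_all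

lemma I_isometry:
  fixes f :: "'k \<Rightarrow> 'b::{banach, second_countable_topology}"
  assumes "\<And>x. x \<in> U \<Longrightarrow> \<sigma> x \<in> U" "\<And>x y. x \<in> U \<Longrightarrow> y \<in> U \<Longrightarrow> absk (\<sigma> x - \<sigma> y) = absk (x - y)"
    and "loc_const m U f"
  shows "I (\<lambda>x. f (\<sigma> x)) = I f"
  unfolding I_eq_set_integral using assms by (intro integral_cb_isometry) (simp_all add: U_eq_cb)

lemma I_mult_left:
  fixes f :: "'k \<Rightarrow> 'b::{banach, second_countable_topology}"
  assumes "c \<in> U" "loc_const m U f"
  shows "I (\<lambda>x. f (c * x)) = I f"
  by (rule I_isometry[OF _ _ assms(2)])
    (use assms in \<open>auto simp: U_mult absk_mult U_absk simp flip: right_diff_distrib\<close>)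

lemma I_inverse:
  fixes f :: "'k \<Rightarrow> 'b::{banach, second_countable_topology}"
  assumes "loc_const m U f"
  shows "I (\<lambda>x. f (inverse x)) = I f"
  by (rule I_isometry[OF _ _ assms]) (auto simp: U_inverse absk_inverse_diff U_absk)

text \<open>Fubini without product measures: f is constant on products of balls of one level, so
  both iterated integrals are the same finite double sum.\<close>

lemma I_swap:
  fixes f :: "'k \<Rightarrow> 'k \<Rightarrow> 'b::{banach, second_countable_topology}"
  assumes f: "\<And>x x' y y'. x \<in> U \<Longrightarrow> x' \<in> U \<Longrightarrow> y \<in> U \<Longrightarrow> y' \<in> U \<Longrightarrow> x' \<in> cb x m \<Longrightarrow> y' \<in> cb y m
    \<Longrightarrow> f x' y' = f x y"
  shows "I (\<lambda>x. I (f x)) = I (\<lambda>y. I (\<lambda>x. f x y))"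
proof -
  define l where "l = max N m"
  have l: "N \<le> l" "m \<le> l" by (auto simp: l_def)
  obtain R where R: "reps 1 N l R" using l(1) by (rule reps_exist)
  have RU: "R \<subseteq> U" using reps_subset[OF R] by (simp add: U_eq_cb)
  have f': "f x' y' = f x y" if "x \<in> U" "x' \<in> U" "y \<in> U" "y' \<in> U" "x' \<in> cb x l" "y' \<in> cb y l" for x x' y y'
    using f[OF that(1-4)] that(5,6) cb_mono[OF l(2)] by blast
  have 1: "I (f x) = q powi (- l) *\<^sub>R (\<Sum>r\<in>R. f x r)" if "x \<in> U" for x
    by (rule I_reps[OF R _ l(1)], rule loc_constI, rule f') (use that in auto)
  have 2: "I (\<lambda>x. f x y) = q powi (- l) *\<^sub>R (\<Sum>r\<in>R. f r y)" if "y \<in> U" for y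
    by (rule I_reps[OF R _ l(1)], rule loc_constI, rule f') (use that in auto)
  have 3: "I (\<lambda>x. I (f x)) = q powi (- l) *\<^sub>R (\<Sum>r\<in>R. I (f r))"
  proof (rule I_reps[OF R _ l(1)], rule loc_constI)
    fix x y assume "x \<in> U" "y \<in> U" "x \<in> cb y l"
    thus "I (f x) = I (f y)" by (intro I_cong f') auto
  qed
  have 4: "I (\<lambda>y. I (\<lambda>x. f x y)) = q powi (- l) *\<^sub>R (\<Sum>r\<in>R. I (\<lambda>x. f x r))"
  proof (rule I_reps[OF R _ l(1)], rule loc_constI)
    fix x y assume "x \<in> U" "y \<in> U" "x \<in> cb y l"
    thus "I (\<lambda>u. f u x) = I (\<lambda>u. f u y)" by (intro I_cong f') auto
  qed
  have "(\<Sum>r\<in>R. I (f r)) = (\<Sum>r\<in>R. q powi (- l) *\<^sub>R (\<Sum>s\<in>R. f r s))"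
    using RU by (intro sum.cong refl 1) auto
  also have "\<dots> = (\<Sum>s\<in>R. q powi (- l) *\<^sub>R (\<Sum>r\<in>R. f r s))"
    by (simp add: scaleR_sum_right) (rule sum.swap)
  also have "\<dots> = (\<Sum>s\<in>R. I (\<lambda>x. f x s))"
    using RU by (intro sum.cong refl 2[symmetric]) auto
  finally show ?thesis using 3 4 by simp
qed

lemma I_indicator_cb:
  fixes c :: "'b::{banach, second_countable_topology, real_normed_algebra_1}"
  assumes "u \<in> U" "N \<le> m"
  shows "I (\<lambda>x. of_bool (x \<in> cb u m) * c) = of_real (q powi (- m)) * c"
proof -
  have sub: "cb u m \<subseteq> U" using cb_subset assms by (simp add: U_eq_cb)
  have "I (\<lambda>x. of_bool (x \<in> cb u m) * c) = I (\<lambda>x. indicator (cb u m) x *\<^sub>R c)"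
    by (intro I_cong) (simp add: indicator_def)
  also have "\<dots> = measure U_measure (cb u m) *\<^sub>R c"
  proof (subst integral_scaleR_left)
    show "integrable U_measure (\<lambda>x. indicator (cb u m) x :: real)"
      using cb_in_sets_U[OF assms] finite_measure.emeasure_finite[OF finite_U]
      by (intro integrable_real_indicator) (auto simp: top.not_eq_extremum)
    show "I (indicator (cb u m)) *\<^sub>R c = measure U_measure (cb u m) *\<^sub>R c"
      using sub by (simp add: Int_absorb2)
  qed
  also have "measure U_measure (cb u m) = q powi (- m)"
    by (simp add: measure_def emeasure_U_measure[OF sub] emeasure_cb)
  finally show ?thesis by (simp add: scaleR_conv_of_real)
qed

lemma loc_const_of_bool_cb: "loc_const m A (\<lambda>x. of_bool (x \<in> cb u m))"
proof (rule loc_constI)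
  fix x y assume "x \<in> cb y m"
  hence "x \<in> cb u m \<longleftrightarrow> y \<in> cb u m" using mem_cb_trans[of _ _ m u] mem_cb_sym[of x y m] by blast
  thus "of_bool (x \<in> cb u m) = of_bool (y \<in> cb u m)" by simp
qed

lemma I_char_cb:
  assumes u: "u \<in> U" and m: "N \<le> m" and t: "\<not> absk t \<le> q powi m"
  shows "I (\<lambda>x. of_bool (x \<in> cb u m) * \<Psi> (t * x)) = 0"
proof -
  have sub: "cb u m \<subseteq> U" using cb_subset u m by (simp add: U_eq_cb)
  have "I (\<lambda>x. of_bool (x \<in> cb u m) * \<Psi> (t * x)) = (LINT x:cb u m|dt. \<Psi> (t * x))"
    unfolding I_eq_set_integral set_lebesgue_integral_def
    by (intro Bochner_Integration.integral_cong refl) (use sub in \<open>auto simp: indicator_def U_eq_cb\<close>)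
  thus ?thesis using t by (simp add: integral_char_cb)
qed

section \<open>Test functions on U\<close>

lemma compact_U: "compact U"
  by (simp add: U_eq_cb compact_cb)

text \<open>Finitely many balls of constancy cover the compact \<open>U\<close>; within such a ball
  every smaller ball is a ball of constancy as well, so the largest of the levels serves
  everywhere.\<close>

lemma uniformly_loc_const:
  assumes "\<And>x. x \<in> U \<Longrightarrow> \<exists>m. \<forall>y\<in>cb x m \<inter> U. f y = f x"
  shows "\<exists>m\<ge>N. loc_const m U f"
proof -
  obtain \<mu> where \<mu>: "\<And>x y. x \<in> U \<Longrightarrow> y \<in> cb x (\<mu> x) \<Longrightarrow> y \<in> U \<Longrightarrow> f y = f x"
    using assms by (metis IntI)
  have "U \<subseteq> (\<Union>x\<in>U. cb x (\<mu> x))" by auto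
  then obtain C where C: "C \<subseteq> U" "finite C" "U \<subseteq> (\<Union>x\<in>C. cb x (\<mu> x))"
    using compactE_image[OF compact_U, of U "\<lambda>x. cb x (\<mu> x)"] open_cb by metis
  define m where "m = Max (insert N (\<mu> ` C))"
  have m: "N \<le> m" "\<And>x. x \<in> C \<Longrightarrow> \<mu> x \<le> m" using C(2) by (auto simp: m_def)
  have "loc_const m U f"
  proof (rule loc_constI)
    fix x y assume xy: "x \<in> U" "y \<in> U" "x \<in> cb y m"
    then obtain z where z: "z \<in> C" "y \<in> cb z (\<mu> z)" using C(3) by blast
    have "x \<in> cb z (\<mu> z)" using xy(3) cb_subset[OF z(2) m(2)[OF z(1)]] by blast
    thus "f x = f y" using \<mu> z C(1) xy by (metis subsetD)
  qed
  thus ?thesis using m(1) by blast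
qed

lemma topspace_U_top [simp]: "topspace U_top = U"
  by (simp add: U_top_def)

lemma compact_space_U_top: "compact_space U_top"
  using compact_U by (simp add: U_top_def compact_space_subtopology)

lemma openin_U_top_cb: "openin U_top (U \<inter> cb u m)"
  unfolding U_top_def openin_subtopology using open_cb by (auto simp: Int_commute)

lemma openin_U_top_cbE:
  assumes "openin U_top V" "x \<in> V"
  obtains m where "cb x m \<inter> U \<subseteq> V"
proof -
  obtain T where T: "open T" "V = T \<inter> U" using assms(1) by (auto simp: U_top_def openin_subtopology)
  obtain e where e: "e > 0" "\<And>y. dist y x < e \<Longrightarrow> y \<in> T" using T assms(2) by (metis IntD1 open_dist)
  obtain k :: nat where k: "(1/q) ^ k < e" using real_arch_pow_inv[OF e(1), of "1/q"] by (auto simp: field_simps)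
  have "cb x (int k) \<subseteq> T"
    using k e(2) by (auto simp: cb_def absk_dist power_int_minus power_one_over inverse_eq_divide)
  thus ?thesis using T that by blast
qed

text \<open>Compactness of \<open>U\<close> enters twice: it makes the level uniform in one
  direction and supplies compact supports in the other.\<close>

lemma test_functions_U_iff:
  "f \<in> test_functions U_top \<longleftrightarrow> (\<exists>m\<ge>N. loc_const m U f) \<and> (\<forall>x. x \<notin> U \<longrightarrow> f x = 0)"
proof (intro iffI conjI)
  assume f: "f \<in> test_functions U_top"
  show "\<exists>m\<ge>N. loc_const m U f"
  proof (rule uniformly_loc_const)
    fix x assume "x \<in> U"
    then obtain V where V: "openin U_top V" "x \<in> V" "\<And>y. y \<in> V \<Longrightarrow> f y = f x"
      using test_functions_locally_constant[OF f, of x] by auto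
    obtain m where "cb x m \<inter> U \<subseteq> V" using V(1,2) by (rule openin_U_top_cbE)
    thus "\<exists>m. \<forall>y\<in>cb x m \<inter> U. f y = f x" using V(3) by blast
  qed
next
  assume "(\<exists>m\<ge>N. loc_const m U f) \<and> (\<forall>x. x \<notin> U \<longrightarrow> f x = 0)"
  then obtain m where m: "loc_const m U f" and out: "\<forall>x. x \<notin> U \<longrightarrow> f x = 0" by blast
  have "\<exists>V. openin U_top V \<and> x \<in> V \<and> (\<forall>y\<in>V. f y = f x)" if "x \<in> U" for x
  proof -
    have "f y = f x" if "y \<in> U \<inter> cb x m" for y
      using that \<open>x \<in> U\<close> by (intro loc_constD[OF m]) auto
    thus ?thesis using openin_U_top_cb[of x m] that mem_cb_self[of x m] by blast
  qed
  thus "f \<in> test_functions U_top"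
    using out closedin_compact_space[OF compact_space_U_top] by (simp add: test_functions_def)
qed (auto simp: test_functions_def)

lemma test_U_loc_const:
  assumes "f \<in> test_functions U_top"
  obtains m where "N \<le> m" "loc_const m U f"
  using assms unfolding test_functions_U_iff by blast

lemma test_U_outside: "f \<in> test_functions U_top \<Longrightarrow> x \<notin> U \<Longrightarrow> f x = 0"
  by (simp add: test_functions_U_iff)

lemma loc_const_test_U: "loc_const m U f \<Longrightarrow> (\<And>x. x \<notin> U \<Longrightarrow> f x = 0) \<Longrightarrow> f \<in> test_functions U_top"
  unfolding test_functions_U_iff using loc_const_mono[of m U f "max N m"] by (metis max.cobounded1 max.cobounded2)

lemma test_U_L2: "f \<in> test_functions U_top \<Longrightarrow> f \<in> L2_functions U_measure"
proof -
  assume "f \<in> test_functions U_top"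
  then obtain m where m: "loc_const m U f" by (rule test_U_loc_const)
  have "integrable U_measure (\<lambda>x. (cmod (f x))\<^sup>2)"
    by (rule I_integrable[of m], rule loc_constI) (use loc_constD[OF m] in metis)
  thus ?thesis using loc_const_borel[OF m] by (simp add: L2_functions_def)
qed

section \<open>Bounded operators on \<open>L\<^sup>2(U)\<close>\<close>

abbreviation "norm2 \<equiv> L2_norm U_measure"
abbreviation "L2U \<equiv> L2_functions U_measure"
abbreviation "test_U \<equiv> test_functions U_top"

abbreviation "opnorm \<equiv> operator_norm U_top U_measure"
abbreviation "bounded_ops \<equiv> bounded_operators U_top U_measure"

definition ball_ind :: "'k \<Rightarrow> int \<Rightarrow> 'k \<Rightarrow> complex" where
  "ball_ind u m x = of_bool (x \<in> cb u m)"

lemma ball_ind_test: "u \<in> U \<Longrightarrow> N \<le> m \<Longrightarrow> ball_ind u m \<in> test_U"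
  using loc_const_of_bool_cb[of m U u] cb_subset[of u 1 N m]
  by (intro loc_const_test_U[of m]) (auto simp: ball_ind_def[abs_def] U_eq_cb)

lemma test_U_cnj: "f \<in> test_U \<Longrightarrow> (\<lambda>x. cnj (f x)) \<in> test_U"
  unfolding test_functions_U_iff loc_const_def by (metis complex_cnj_zero)

lemma test_U_expand:
  assumes R: "reps 1 N m R" and f: "f \<in> test_U" "loc_const m U f" and m: "N \<le> m"
  shows "f = (\<Sum>r\<in>R. f r *\<^sub>c ball_ind r m)"
proof
  fix x
  have "(\<Sum>r\<in>R. f r *\<^sub>c ball_ind r m) x = (\<Sum>r\<in>R. f r * ball_ind r m x)"
    by (simp add: fun_sum_apply cscale_fun_def cscale_complex_def)
  also have "\<dots> = f x"
  proof (cases "x \<in> U")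
    case True
    then obtain r where r: "r \<in> R" "x \<in> cb r m" using reps_cover[OF R] by (auto simp: U_eq_cb)
    have "f s * ball_ind s m x = (if s = r then f x else 0)" if "s \<in> R" for s
    proof (cases "s = r")
      case True
      have "r \<in> U" using r(1) reps_subset[OF R] by (auto simp: U_eq_cb)
      thus ?thesis using True r loc_constD[OF f(2) \<open>x \<in> U\<close>, of r] by (simp add: ball_ind_def)
    next
      case False
      hence "x \<notin> cb s m" using mem_cb_common[OF r(2), of s] reps_inj[OF R r(1) that] by blast
      thus ?thesis using False by (simp add: ball_ind_def)
    qed
    thus ?thesis using r(1) reps_finite[OF R] by simp
  next
    case False
    hence "x \<notin> cb r m" if "r \<in> R" for r using that reps_eq[OF R] by (auto simp: U_eq_cb)
    thus ?thesis using test_U_outside[OF f(1) False] by (auto simp: ball_ind_def intro!: sum.neutral)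
  qed
  finally show "f x = (\<Sum>r\<in>R. f r *\<^sub>c ball_ind r m) x" by simp
qed

lemma I_of_bool_cb: "u \<in> U \<Longrightarrow> N \<le> m \<Longrightarrow> I (\<lambda>x. cmod (ball_ind u m x)) = q powi (- m)"
  using I_indicator_cb[of u m "1::real"] by (simp add: ball_ind_def of_bool_def if_distrib[of cmod] cong: if_cong)

text \<open>The averages of \<open>L\<close> over balls form a martingale that is bounded in \<open>L\<^sup>2\<close>; its increments are
  orthogonal, so it converges.\<close>

theorem Riesz_representation:
  assumes L: "clinear_on test_U L" and bound: "\<And>\<phi>. \<phi> \<in> test_U \<Longrightarrow> cmod (L \<phi>) \<le> C * norm2 \<phi>" and "0 \<le> C"
  obtains h hs where "h \<in> L2U" "\<And>\<phi>. \<phi> \<in> test_U \<Longrightarrow> L \<phi> = I (\<lambda>x. h x * \<phi> x)" "norm2 h \<le> C"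
    "\<And>i::nat. hs i \<in> test_U" "(\<lambda>i. norm2 (hs i - h)) \<longlonglongrightarrow> 0"
    "\<And>D. (\<And>\<phi>. \<phi> \<in> test_U \<Longrightarrow> cmod (L \<phi>) \<le> D * I (\<lambda>x. cmod (\<phi> x))) \<Longrightarrow> AE x in U_measure. cmod (h x) \<le> D"
proof -
  define hs :: "nat \<Rightarrow> 'k \<Rightarrow> complex" where
    "hs i x = (if x \<in> U then of_real (q powi (N + int i)) * L (ball_ind x (N + int i)) else 0)" for i x
  have lc: "loc_const (N + int i) U (hs i)" for i
  proof (rule loc_constI)
    fix x y assume "x \<in> U" "y \<in> U" "x \<in> cb y (N + int i)"
    moreover hence "ball_ind x (N + int i) = ball_ind y (N + int i)" using cb_eq by (simp add: ball_ind_def fun_eq_iff)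
    ultimately show "hs i x = hs i y" by (simp add: hs_def)
  qed
  have test: "hs i \<in> test_U" for i using lc by (rule loc_const_test_U) (simp add: hs_def)
  note hsL2 = test_U_L2[OF test]
  \<comment> \<open>A function of level i is a combination of indicators of balls of that level, on
    which \<open>hs i\<close> reproduces L by its definition.\<close>
  have rep: "I (\<lambda>x. hs i x * \<phi> x) = L \<phi>" if \<phi>: "\<phi> \<in> test_U" "loc_const (N + int i) U \<phi>" for \<phi> i
  proof -
    let ?m = "N + int i"
    obtain R where R: "reps 1 N ?m R" using reps_exist[of N ?m] by auto
    have RU: "R \<subseteq> U" using reps_subset[OF R] by (simp add: U_eq_cb)
    have "loc_const ?m U (\<lambda>x. hs i x * \<phi> x)"
      by (rule loc_constI) (metis loc_constD[OF lc] loc_constD[OF \<phi>(2)])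
    hence "I (\<lambda>x. hs i x * \<phi> x) = q powi (- ?m) *\<^sub>R (\<Sum>r\<in>R. hs i r * \<phi> r)"
      by (rule I_reps[OF R]) simp
    also have "\<dots> = (\<Sum>r\<in>R. q powi (- ?m) *\<^sub>R (hs i r * \<phi> r))" by (rule scaleR_sum_right)
    also have "\<dots> = (\<Sum>r\<in>R. L (\<phi> r *\<^sub>c ball_ind r ?m))"
    proof (rule sum.cong[OF refl])
      fix r assume "r \<in> R"
      hence r: "r \<in> U" using RU by blast
      have "L (\<phi> r *\<^sub>c ball_ind r ?m) = \<phi> r * L (ball_ind r ?m)"
        using clinear_on_scale[OF L ball_ind_test[OF r, of ?m]] by (simp add: cscale_complex_def)
      moreover have "of_real (q powi (- ?m)) * of_real (q powi ?m) = (1::complex)"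
        by (simp flip: of_real_mult power_int_add)
      ultimately show "q powi (- ?m) *\<^sub>R (hs i r * \<phi> r) = L (\<phi> r *\<^sub>c ball_ind r ?m)"
        using r unfolding scaleR_conv_of_real hs_def by (simp flip: mult.assoc)
    qed
    also have "\<dots> = L (\<Sum>r\<in>R. \<phi> r *\<^sub>c ball_ind r ?m)"
      using RU reps_finite[OF R] by (intro clinear_on_test_sum[OF L, symmetric] test_functions_scale ball_ind_test) auto
    also have "\<dots> = L \<phi>" using test_U_expand[OF R \<phi>] by simp
    finally show ?thesis .
  qed
  define a where "a i = (norm2 (hs i))\<^sup>2" for i
  \<comment> \<open>The conjugate of \<open>hs i\<close> also has level j, so pairing it with
    \<open>hs j\<close> or with \<open>hs i\<close> gives the same value of L. This is the
    orthogonality of the increments.\<close>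
  have mixed: "I (\<lambda>x. hs j x * cnj (hs i x)) = of_real (a i)" if "i \<le> j" for i j
  proof -
    have *: "loc_const (N + int k) U (\<lambda>x. cnj (hs i x))" if "i \<le> k" for k
    proof -
      have "loc_const (N + int i) U (\<lambda>x. cnj (hs i x))" by (rule loc_constI) (metis loc_constD[OF lc])
      thus ?thesis by (rule loc_const_mono) (use that in simp)
    qed
    have "I (\<lambda>x. hs j x * cnj (hs i x)) = L (\<lambda>x. cnj (hs i x))"
      using that by (intro rep test_U_cnj test *)
    also have "\<dots> = I (\<lambda>x. hs i x * cnj (hs i x))"
      by (intro rep[symmetric] test_U_cnj test *) simp
    also have "\<dots> = I (\<lambda>x. of_real ((cmod (hs i x))\<^sup>2))" by (simp only: complex_norm_square)
    also have "\<dots> = of_real (a i)" unfolding a_def L2_norm_sq by (rule integral_complex_of_real)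
    finally show ?thesis .
  qed
  \<comment> \<open>Tested on the conjugate of \<open>hs i\<close>, the bound on L says that the
    squared norm of \<open>hs i\<close> is at most C times its norm.\<close>
  have norm_hs: "norm2 (hs i) \<le> C" for i
  proof -
    have "(norm2 (hs i))\<^sup>2 = cmod (I (\<lambda>x. hs i x * cnj (hs i x)))" unfolding mixed[OF order_refl] by (simp add: a_def del: of_real_power)
    also have "I (\<lambda>x. hs i x * cnj (hs i x)) = L (\<lambda>x. cnj (hs i x))"
      by (intro rep test_U_cnj test loc_constI) (metis loc_constD[OF lc])
    also have "cmod \<dots> \<le> C * norm2 (hs i)" using bound[OF test_U_cnj[OF test[of i]]] by (simp add: L2_norm_cnj)
    finally have "norm2 (hs i) * norm2 (hs i) \<le> C * norm2 (hs i)" by (simp add: power2_eq_square)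
    thus ?thesis using \<open>0 \<le> C\<close> by (cases "norm2 (hs i) = 0") (auto simp: less_le)
  qed
  have diff: "(norm2 (hs j - hs i))\<^sup>2 = a j - a i" if "i \<le> j" for i j
    unfolding L2_norm_sq_diff[OF hsL2 hsL2] mixed[OF that] by (simp add: a_def)
  have "incseq a"
  proof (rule incseq_SucI)
    fix i show "a i \<le> a (Suc i)" using diff[of i "Suc i"] zero_le_power2[of "norm2 (hs (Suc i) - hs i)"] by simp
  qed
  moreover have "\<forall>i. a i \<le> C\<^sup>2" unfolding a_def using norm_hs by (simp add: power_mono)
  ultimately obtain l where "a \<longlonglongrightarrow> l" using incseq_convergent by blast
  hence "Cauchy a" by (rule LIMSEQ_imp_Cauchy)
  have "\<exists>K. \<forall>i\<ge>K. \<forall>j\<ge>K. norm2 (hs i - hs j) < e" if "0 < e" for e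
  proof -
    obtain K where K: "\<And>i j. K \<le> i \<Longrightarrow> K \<le> j \<Longrightarrow> norm (a i - a j) < e\<^sup>2"
      using CauchyD[OF \<open>Cauchy a\<close>, of "e\<^sup>2"] \<open>0 < e\<close> by auto
    have 1: "norm2 (hs i - hs j) < e" if "K \<le> i" "K \<le> j" "j \<le> i" for i j
    proof (rule power2_less_imp_less)
      show "(norm2 (hs i - hs j))\<^sup>2 < e\<^sup>2" unfolding diff[OF that(3)] using K[OF that(1,2)] by simp
    qed (use \<open>0 < e\<close> in simp)
    have "norm2 (hs i - hs j) < e" if "K \<le> i" "K \<le> j" for i j
      using 1[OF that] 1[OF that(2,1)] L2_norm_minus_commute[of U_measure "hs i" "hs j"] by (cases "j \<le> i") auto
    thus ?thesis by blast
  qed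
  then obtain g r where g: "g \<in> L2U" "(\<lambda>i. norm2 (hs i - g)) \<longlonglongrightarrow> 0" "strict_mono (r::nat \<Rightarrow> nat)"
    "AE x in U_measure. (\<lambda>i. hs (r i) x) \<longlonglongrightarrow> g x"
    by (rule L2_complete[OF finite_U hsL2])
  show ?thesis
  proof (rule that[OF g(1) _ _ test g(2)])
    fix \<phi> assume \<phi>: "\<phi> \<in> test_U"
    obtain m where m: "loc_const m U \<phi>" using \<phi> by (rule test_U_loc_const)
    have "(\<lambda>i. norm2 (hs i - g) * norm2 \<phi>) \<longlonglongrightarrow> 0 * norm2 \<phi>" by (intro tendsto_intros g)
    moreover have "cmod (L \<phi> - I (\<lambda>x. g x * \<phi> x)) \<le> norm2 (hs i - g) * norm2 \<phi>" if "nat m \<le> i" for i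
    proof -
      have "L \<phi> - I (\<lambda>x. g x * \<phi> x) = I (\<lambda>x. hs i x * \<phi> x) - I (\<lambda>x. g x * \<phi> x)"
        using that by (subst rep[OF \<phi> loc_const_mono[OF m]]) auto
      also have "\<dots> = I (\<lambda>x. hs i x * \<phi> x - g x * \<phi> x)"
        by (intro Bochner_Integration.integral_diff[symmetric] L2_mult_integrable hsL2 g test_U_L2 \<phi>)
      also have "\<dots> = I (\<lambda>x. (hs i - g) x * \<phi> x)" by (simp add: algebra_simps)
      finally show ?thesis using L2_Cauchy_Schwarz[OF L2_diff[OF hsL2 g(1)] test_U_L2[OF \<phi>]] by simp
    qed
    ultimately have "cmod (L \<phi> - I (\<lambda>x. g x * \<phi> x)) \<le> 0 * norm2 \<phi>"
      by (intro LIMSEQ_le_const) blast+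
    thus "L \<phi> = I (\<lambda>x. g x * \<phi> x)" by simp
  next
    have "(\<lambda>i. C + norm2 (hs i - g)) \<longlonglongrightarrow> C + 0" by (intro tendsto_intros g)
    moreover have "norm2 g \<le> C + norm2 (hs i - g)" for i
      using L2_norm_triangle[OF hsL2[of i] L2_diff[OF g(1) hsL2[of i]]] norm_hs[of i]
        L2_norm_minus_commute[of U_measure g "hs i"] by simp
    ultimately have "norm2 g \<le> C + 0" by (intro LIMSEQ_le_const) blast+
    thus "norm2 g \<le> C" by simp
  next
    fix D assume D: "\<And>\<phi>. \<phi> \<in> test_U \<Longrightarrow> cmod (L \<phi>) \<le> D * I (\<lambda>x. cmod (\<phi> x))"
    \<comment> \<open>The bound by D is applied to the indicator of a ball, whose L1 norm is exactly
      the volume by which \<open>hs\<close> divides.\<close>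
    have hsD: "cmod (hs i x) \<le> D" if "x \<in> U" for i x
    proof -
      let ?m = "N + int i"
      have "cmod (hs i x) = q powi ?m * cmod (L (ball_ind x ?m))" using that by (simp add: hs_def norm_mult norm_power_int abs_of_pos)
      also have "\<dots> \<le> q powi ?m * (D * q powi (- ?m))"
        using D[OF ball_ind_test[OF that, of ?m]] I_of_bool_cb[OF that, of ?m] by (intro mult_left_mono) auto
      also have "\<dots> = D * (q powi ?m * q powi (- ?m))" by simp
      also have "\<dots> = D" by (simp flip: power_int_add)
      finally show ?thesis .
    qed
    have "AE x in U_measure. x \<in> U" by (rule AE_I2) simp
    with g(4) show "AE x in U_measure. cmod (g x) \<le> D"
    proof eventually_elim
      case (elim x)
      thus ?case using hsD by (intro LIMSEQ_le_const2[OF tendsto_norm[OF elim(1)]]) blast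
    qed
  qed
qed

section \<open>Test functions separate and approximate L2 functions\<close>

definition balls_U :: "'k set set" where
  "balls_U = insert {} {cb u m | u m. u \<in> U \<and> N \<le> m}"

lemma balls_UI: "u \<in> U \<Longrightarrow> N \<le> m \<Longrightarrow> cb u m \<in> balls_U"
  unfolding balls_U_def by blast

lemma balls_UE:
  assumes "b \<in> balls_U"
  obtains "b = {}" | u m where "b = cb u m" "u \<in> U" "N \<le> m"
  using assms unfolding balls_U_def by blast

text \<open>An open set is the union of the balls it contains. Centres are restricted to finitely
  many representatives at each level, which keeps this union countable.\<close>

lemma countable_balls_cover: "open A \<Longrightarrow> U \<inter> A \<in> sigma_sets U balls_U"
proof -
  assume A: "open A"
  have "\<exists>R. reps 1 N (N + int i) R" for i using reps_exist[of N "N + int i"] by auto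
  then obtain R where R: "\<And>i. reps 1 N (N + int i) (R i)" by metis
  define B where "B = (\<Union>i. (\<lambda>r. cb r (N + int i)) ` R i) \<inter> {b. b \<subseteq> A}"
  have RU: "r \<in> U" if "r \<in> R i" for r i using that reps_subset[OF R] by (auto simp: U_eq_cb)
  have "countable B" unfolding B_def
    by (intro countable_Int1 countable_UN countable_image) (auto intro: countable_finite reps_finite[OF R])
  moreover have "b \<in> sigma_sets U balls_U" if "b \<in> B" for b
  proof -
    from that have "b \<in> (\<Union>i. (\<lambda>r. cb r (N + int i)) ` R i)" unfolding B_def by (rule IntD1)
    then obtain r i where "r \<in> R i" "b = cb r (N + int i)" by (elim UN_E imageE)
    thus ?thesis using balls_UI[OF RU, of r i "N + int i"] by (auto intro: sigma_sets.Basic)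
  qed
  ultimately have "\<Union>B \<in> sigma_sets U balls_U" by (rule sigma_sets_UNION)
  moreover have "\<Union>B = U \<inter> A"
  proof (intro equalityI subsetI)
    fix x assume "x \<in> \<Union>B"
    then obtain r i where "r \<in> R i" "cb r (N + int i) \<subseteq> A" "x \<in> cb r (N + int i)" unfolding B_def by auto
    thus "x \<in> U \<inter> A" using RU[of r i] cb_subset[of r 1 N "N + int i"] by (auto simp: U_eq_cb)
  next
    fix x assume x: "x \<in> U \<inter> A"
    have "openin U_top (A \<inter> U)" using A by (auto simp: U_top_def openin_subtopology)
    then obtain m where m: "cb x m \<inter> U \<subseteq> A \<inter> U" using x by (elim openin_U_top_cbE) auto
    define i where "i = nat m"
    have i: "cb x (N + int i) \<subseteq> A"
    proof -
      have "cb x (N + int i) \<subseteq> cb x m" by (rule cb_mono) (simp add: i_def)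
      moreover have "cb x (N + int i) \<subseteq> U" using cb_subset[of x 1 N "N + int i"] x by (simp add: U_eq_cb)
      ultimately show ?thesis using m by blast
    qed
    obtain r where r: "r \<in> R i" "x \<in> cb r (N + int i)" using x reps_cover[OF R] by (auto simp: U_eq_cb)
    have "cb r (N + int i) \<in> B" using r i cb_eq[OF r(2)] by (auto simp: B_def)
    thus "x \<in> \<Union>B" using r by blast
  qed
  ultimately show ?thesis by simp
qed

lemma sets_U_measure_balls: "sets U_measure = sigma_sets U balls_U"
proof
  have "sets U_measure = (\<inter>) U ` sigma_sets UNIV {S. open S}"
    unfolding sets_U_measure haar_sets borel_def by simp
  also have "\<dots> = sigma_sets U ((\<inter>) U ` {S. open S})"
  proof (rule sigma_sets_Int)
    show "U \<in> sigma_sets UNIV {S. open S}" by (rule sigma_sets.Basic) (simp add: U_eq_cb open_cb)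
  qed simp
  also have "\<dots> \<subseteq> sigma_sets U balls_U"
    by (rule sigma_sets_mono) (auto intro: countable_balls_cover)
  finally show "sets U_measure \<subseteq> sigma_sets U balls_U" .
  show "sigma_sets U balls_U \<subseteq> sets U_measure"
    using sets.sigma_sets_subset[of balls_U U_measure] cb_in_sets_U by (auto simp: balls_U_def)
qed

text \<open>Two balls are nested or disjoint; the disjoint case is the reason why the empty set
  belongs to the family.\<close>

lemma Int_stable_balls_U: "Int_stable balls_U"
proof (rule Int_stableI)
  have *: "cb u m \<inter> cb v l \<in> balls_U" if "u \<in> U" "v \<in> U" "N \<le> m" "N \<le> l" "m \<le> l" for u v m l
  proof (cases "cb u m \<inter> cb v l = {}")
    case False
    then obtain x where x: "x \<in> cb u m" "x \<in> cb v l" by blast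
    have "cb v l \<subseteq> cb u m" using cb_subset[OF x(1) that(5)] cb_eq[OF x(2)] by simp
    hence "cb u m \<inter> cb v l = cb v l" by blast
    thus ?thesis using balls_UI[OF that(2,4)] by simp
  qed (simp add: balls_U_def)
  fix a b assume "a \<in> balls_U" "b \<in> balls_U"
  moreover {
    fix u m v l assume **: "u \<in> U" "N \<le> m" "v \<in> U" "N \<le> l"
    have "cb u m \<inter> cb v l \<in> balls_U"
    proof (cases "m \<le> l")
      case False
      thus ?thesis using *[of v u l m] ** by (simp add: Int_commute)
    qed (use * ** in simp) }
  moreover have "{} \<in> balls_U" by (simp add: balls_U_def)
  ultimately show "a \<inter> b \<in> balls_U" by (metis balls_UE inf_bot_left inf_bot_right)
qed

text \<open>The integrals of h over balls vanish, and the Dynkin argument extends this to all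
  measurable sets, so the real and imaginary parts vanish almost everywhere. This provides
  uniqueness of representing functions.\<close>

lemma test_U_separating:
  assumes h: "h \<in> L2U" and zero: "\<And>\<phi>. \<phi> \<in> test_U \<Longrightarrow> I (\<lambda>x. h x * \<phi> x) = 0"
  shows "AE x in U_measure. h x = 0"
proof -
  have int: "integrable U_measure h" using h by (intro L2_integrable_finite) auto
  have cb0: "set_lebesgue_integral U_measure (cb u m) h = 0" if "u \<in> U" "N \<le> m" for u m
  proof -
    have "set_lebesgue_integral U_measure (cb u m) h = I (\<lambda>x. h x * ball_ind u m x)"
      unfolding set_lebesgue_integral_def by (intro I_cong) (simp add: ball_ind_def indicator_def)
    thus ?thesis using zero[OF ball_ind_test[OF that]] by simp
  qed
  have setint: "set_integrable U_measure A h" if "A \<in> sets U_measure" for A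
    using that int unfolding set_integrable_def by (rule integrable_mult_indicator)
  have G: "balls_U \<subseteq> Pow U" using cb_subset by (force simp: balls_U_def U_eq_cb)
  have all0: "set_lebesgue_integral U_measure A h = 0" if "A \<in> sets U_measure" for A
    using Int_stable_balls_U G that[unfolded sets_U_measure_balls]
  proof (induction rule: sigma_sets_induct_disjoint)
    case (basic A)
    thus ?case using cb0 by (auto simp: balls_U_def set_lebesgue_integral_def)
  next
    case empty
    show ?case by (simp add: set_lebesgue_integral_def)
  next
    case (compl A)
    hence A: "A \<in> sets U_measure" by (simp add: sets_U_measure_balls)
    have sub: "A \<subseteq> U" using sets.sets_into_space[OF A] by simp
    have U': "U \<in> sets U_measure" using sets.top[of U_measure] by simp
    hence "set_lebesgue_integral U_measure (A \<union> (U - A)) h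
        = set_lebesgue_integral U_measure A h + set_lebesgue_integral U_measure (U - A) h"
      using A by (intro set_integral_Un setint) auto
    moreover have "A \<union> (U - A) = cb 1 N" using sub by (auto simp: U_eq_cb)
    ultimately show ?case using compl cb0[of 1 N] by simp
  next
    case (union A)
    have A: "A i \<in> sets U_measure" for i using union(2) by (auto simp: sets_U_measure_balls)
    hence "set_lebesgue_integral U_measure (\<Union>i. A i) h = (\<Sum>i. set_lebesgue_integral U_measure (A i) h)"
      using union(1) by (intro lebesgue_integral_countable_add setint) (auto simp: disjoint_family_on_def)
    thus ?case using union(3) by simp
  qed
  have "AE x in U_measure. Re (h x) = 0"
  proof (rule density_unique_real)
    show "integrable U_measure (\<lambda>x. Re (h x))" using int by simp
    fix A assume A: "A \<in> sets U_measure"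
    have "(LINT x:A|U_measure. Re (h x)) = Re (set_lebesgue_integral U_measure A h)"
      using setint[OF A] unfolding set_lebesgue_integral_def set_integrable_def
      by (subst integral_Re[symmetric]) auto
    thus "(LINT x:A|U_measure. Re (h x)) = (LINT x:A|U_measure. 0)" using all0[OF A] by simp
  qed simp
  moreover have "AE x in U_measure. Im (h x) = 0"
  proof (rule density_unique_real)
    show "integrable U_measure (\<lambda>x. Im (h x))" using int by simp
    fix A assume A: "A \<in> sets U_measure"
    have "(LINT x:A|U_measure. Im (h x)) = Im (set_lebesgue_integral U_measure A h)"
      using setint[OF A] unfolding set_lebesgue_integral_def set_integrable_def
      by (subst integral_Im[symmetric]) auto
    thus "(LINT x:A|U_measure. Im (h x)) = (LINT x:A|U_measure. 0)" using all0[OF A] by simp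
  qed simp
  ultimately show ?thesis by eventually_elim (simp add: complex_eq_iff)
qed

lemma test_U_separating_eq:
  assumes "g \<in> L2U" "h \<in> L2U" "\<And>\<phi>. \<phi> \<in> test_U \<Longrightarrow> I (\<lambda>x. g x * \<phi> x) = I (\<lambda>x. h x * \<phi> x)"
  shows "AE x in U_measure. g x = h x"
proof -
  have "AE x in U_measure. (g - h) x = 0"
  proof (rule test_U_separating[OF L2_diff[OF assms(1,2)]])
    fix \<phi> assume \<phi>: "\<phi> \<in> test_U"
    have "I (\<lambda>x. (g - h) x * \<phi> x) = I (\<lambda>x. g x * \<phi> x - h x * \<phi> x)" by (simp add: algebra_simps)
    also have "\<dots> = I (\<lambda>x. g x * \<phi> x) - I (\<lambda>x. h x * \<phi> x)"
      by (intro Bochner_Integration.integral_diff L2_mult_integrable assms test_U_L2 \<phi>)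
    finally show "I (\<lambda>x. (g - h) x * \<phi> x) = 0" using assms(3)[OF \<phi>] by simp
  qed
  thus ?thesis by eventually_elim simp
qed

lemma I_mult_add:
  assumes "f \<in> L2U" "g \<in> L2U" "h \<in> L2U"
  shows "I (\<lambda>x. h x * (f + g) x) = I (\<lambda>x. h x * f x) + I (\<lambda>x. h x * g x)"
proof -
  have "I (\<lambda>x. h x * (f + g) x) = I (\<lambda>x. h x * f x + h x * g x)" by (simp add: algebra_simps)
  also have "\<dots> = I (\<lambda>x. h x * f x) + I (\<lambda>x. h x * g x)"
    by (intro Bochner_Integration.integral_add L2_mult_integrable assms)
  finally show ?thesis .
qed

lemma I_mult_scale: "I (\<lambda>x. h x * (c *\<^sub>c f) x) = c * I (\<lambda>x. h x * f x)"
proof -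
  have "I (\<lambda>x. h x * (c *\<^sub>c f) x) = I (\<lambda>x. c * (h x * f x))"
    by (simp add: cscale_fun_def cscale_complex_def mult.left_commute)
  thus ?thesis by simp
qed

lemma I_mult_linear: "h \<in> L2U \<Longrightarrow> clinear_on test_U (\<lambda>\<phi>. I (\<lambda>x. h x * \<phi> x))"
  unfolding clinear_on_def by (auto simp: I_mult_add I_mult_scale test_U_L2 cscale_complex_def simp del: plus_fun_apply)

text \<open>The Riesz theorem is applied to the functional given by h itself. The function it
  produces agrees with h almost everywhere, so h inherits the norm bound and the approximating test
  functions of the construction.\<close>

lemma Riesz_of_L2:
  assumes h: "h \<in> L2U" and "0 \<le> C" and "\<And>\<phi>. \<phi> \<in> test_U \<Longrightarrow> cmod (I (\<lambda>x. h x * \<phi> x)) \<le> C * norm2 \<phi>"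
  shows "norm2 h \<le> C"
    and "\<exists>hs. (\<forall>i::nat. hs i \<in> test_U) \<and> (\<lambda>i. norm2 (hs i - h)) \<longlonglongrightarrow> 0"
proof -
  obtain g hs where g: "g \<in> L2U" "\<And>\<phi>. \<phi> \<in> test_U \<Longrightarrow> I (\<lambda>x. h x * \<phi> x) = I (\<lambda>x. g x * \<phi> x)" "norm2 g \<le> C"
    "\<And>i::nat. hs i \<in> test_U" "(\<lambda>i. norm2 (hs i - g)) \<longlonglongrightarrow> 0"
    by (rule Riesz_representation[OF I_mult_linear[OF h] assms(3,2)]) blast+
  have eq: "AE x in U_measure. g x = h x" by (rule test_U_separating_eq[OF g(1) h]) (use g(2) in simp)
  have "norm2 g = norm2 h"
    using eq L2_borel[OF g(1)] L2_borel[OF h] by (rule L2_norm_cong_AE)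
  thus "norm2 h \<le> C" using g(3) by simp
  have "norm2 (hs i - g) = norm2 (hs i - h)" for i
  proof (rule L2_norm_cong_AE)
    show "AE x in U_measure. (hs i - g) x = (hs i - h) x" using eq by eventually_elim simp
  qed (auto intro: L2_borel L2_diff test_U_L2 g h)
  thus "\<exists>hs. (\<forall>i::nat. hs i \<in> test_U) \<and> (\<lambda>i. norm2 (hs i - h)) \<longlonglongrightarrow> 0" using g(4,5) by auto
qed

lemma test_U_dense:
  assumes "f \<in> L2U"
  obtains hs where "\<And>i::nat. hs i \<in> test_U" "(\<lambda>i. norm2 (hs i - f)) \<longlonglongrightarrow> 0"
  using Riesz_of_L2(2)[OF assms L2_norm_nonneg L2_Cauchy_Schwarz[OF assms test_U_L2]] by blast

text \<open>Representing the form in its second argument first makes it meaningful for arbitrary \<open>L\<^sup>2\<close>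
  functions there, so that no limit of test functions is needed.\<close>

lemma bounded_form_L2_extension:
  assumes T: "T \<in> distribution_operators U_top" and "0 \<le> K"
    and bound: "\<And>f1 f2. f1 \<in> test_U \<Longrightarrow> f2 \<in> test_U \<Longrightarrow> cmod (T f2 f1) \<le> K * norm2 f1 * norm2 f2"
  shows "\<exists>A. is_L2_extension U_top U_measure T A"
proof -
  have lin: "clinear_on test_U T" and out: "\<And>f. f \<notin> test_U \<Longrightarrow> T f = 0"
    using T by (auto simp: distribution_operators_def)
  have Tdist: "T f \<in> distributions U_top" if "f \<in> test_U" for f
    using T that unfolding distribution_operators_def continuous_map_def
    by (auto simp: weak_dual_topology_def test_topology_def)
  have lin1: "clinear_on test_U (\<lambda>f2. T f2 f1)" for f1
    using clinear_on_add[OF lin] clinear_on_scale[OF lin] by (simp add: clinear_on_def cscale_fun_def)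
  have "\<exists>G. G \<in> L2U \<and> (\<forall>f2\<in>test_U. T f2 f1 = I (\<lambda>x. G x * f2 x)) \<and> norm2 G \<le> K * norm2 f1"
    if "f1 \<in> test_U" for f1
    by (rule Riesz_representation[OF lin1[of f1] bound[OF that]]) (use \<open>0 \<le> K\<close> in auto)
  then obtain G where G: "\<And>f1. f1 \<in> test_U \<Longrightarrow> G f1 \<in> L2U"
    "\<And>f1 f2. f1 \<in> test_U \<Longrightarrow> f2 \<in> test_U \<Longrightarrow> T f2 f1 = I (\<lambda>x. G f1 x * f2 x)"
    "\<And>f1. f1 \<in> test_U \<Longrightarrow> norm2 (G f1) \<le> K * norm2 f1" by metis
  \<comment> \<open>Representing functions are unique only up to null sets, so G is linear only
    almost everywhere. That suffices, because G enters through integrals.\<close>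
  have Gadd: "AE x in U_measure. G (f1 + f1') x = (G f1 + G f1') x" if "f1 \<in> test_U" "f1' \<in> test_U" for f1 f1'
  proof (rule test_U_separating_eq)
    fix \<phi> assume \<phi>: "\<phi> \<in> test_U"
    have "I (\<lambda>x. G (f1 + f1') x * \<phi> x) = T \<phi> (f1 + f1')"
      using G(2) test_functions_add that \<phi> by metis
    also have "\<dots> = I (\<lambda>x. G f1 x * \<phi> x) + I (\<lambda>x. G f1' x * \<phi> x)"
      using G(2) that \<phi> clinear_on_add[OF distributions_linear[OF Tdist[OF \<phi>]]] by metis
    also have "\<dots> = I (\<lambda>x. \<phi> x * (G f1 + G f1') x)"
      by (subst I_mult_add) (auto simp: mult.commute G that test_U_L2[OF \<phi>])
    finally show "I (\<lambda>x. G (f1 + f1') x * \<phi> x) = I (\<lambda>x. (G f1 + G f1') x * \<phi> x)" by (simp add: mult.commute)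
  qed (intro G L2_add test_functions_add that)+
  have Gscale: "AE x in U_measure. G (c *\<^sub>c f1) x = (c *\<^sub>c G f1) x" if "f1 \<in> test_U" for c f1
  proof (rule test_U_separating_eq)
    fix \<phi> assume \<phi>: "\<phi> \<in> test_U"
    have "I (\<lambda>x. G (c *\<^sub>c f1) x * \<phi> x) = T \<phi> (c *\<^sub>c f1)"
      using G(2) test_functions_scale that \<phi> by metis
    also have "\<dots> = c * I (\<lambda>x. G f1 x * \<phi> x)"
      using G(2) that \<phi> clinear_on_scale[OF distributions_linear[OF Tdist[OF \<phi>]]] unfolding cscale_complex_def by metis
    also have "\<dots> = I (\<lambda>x. \<phi> x * (c *\<^sub>c G f1) x)"
      by (subst I_mult_scale) (simp add: mult.commute)
    finally show "I (\<lambda>x. G (c *\<^sub>c f1) x * \<phi> x) = I (\<lambda>x. (c *\<^sub>c G f1) x * \<phi> x)" by (simp add: mult.commute)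
  qed (auto intro!: G L2_scale test_functions_scale that)
  have lin2: "clinear_on test_U (\<lambda>f1. I (\<lambda>x. G f1 x * f x))" if f: "f \<in> L2U" for f
    unfolding clinear_on_def
  proof (intro conjI ballI allI)
    fix f1 f1' assume t: "f1 \<in> test_U" "f1' \<in> test_U"
    have "I (\<lambda>x. G (f1 + f1') x * f x) = I (\<lambda>x. f x * (G f1 + G f1') x)"
      using Gadd[OF t] G(1)[THEN L2_borel] t test_functions_add[OF t] L2_borel[OF f]
      by (intro integral_cong_AE) (auto intro!: borel_measurable_times borel_measurable_add simp: mult.commute)
    thus "I (\<lambda>x. G (f1 + f1') x * f x) = I (\<lambda>x. G f1 x * f x) + I (\<lambda>x. G f1' x * f x)"
      using I_mult_add[OF G(1)[OF t(1)] G(1)[OF t(2)] f] by (simp add: mult.commute)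
  next
    fix c f1 assume t: "f1 \<in> test_U"
    have "I (\<lambda>x. G (c *\<^sub>c f1) x * f x) = I (\<lambda>x. f x * (c *\<^sub>c G f1) x)"
      using Gscale[OF t] G(1)[THEN L2_borel] t test_functions_scale[OF t] L2_borel[OF f] L2_borel[OF L2_scale[OF G(1)[OF t]]]
    proof (intro integral_cong_AE borel_measurable_times)
      show "AE x in U_measure. G (c *\<^sub>c f1) x * f x = f x * (c *\<^sub>c G f1) x"
        using Gscale[OF t, of c] by eventually_elim simp
    qed auto
    thus "I (\<lambda>x. G (c *\<^sub>c f1) x * f x) = c *\<^sub>c I (\<lambda>x. G f1 x * f x)"
      unfolding I_mult_scale by (simp add: mult.commute cscale_complex_def)
  qed
  have bound2: "cmod (I (\<lambda>x. G f1 x * f x)) \<le> (K * norm2 f) * norm2 f1" if f: "f \<in> L2U" and t: "f1 \<in> test_U" for f f1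
    using L2_Cauchy_Schwarz[OF G(1)[OF t] f] mult_right_mono[OF G(3)[OF t], of "norm2 f"] by (simp add: mult.commute mult.left_commute)
  define P where "P f h \<longleftrightarrow> h \<in> L2U \<and> (\<forall>f1\<in>test_U. I (\<lambda>x. G f1 x * f x) = I (\<lambda>x. h x * f1 x)) \<and>
    norm2 h \<le> K * norm2 f" for f h
  have "\<exists>h. P f h" if "f \<in> L2U" for f
    unfolding P_def by (rule Riesz_representation[OF lin2[OF that] bound2[OF that]]) (use \<open>0 \<le> K\<close> in auto)
  then obtain A where A': "\<And>f. f \<in> L2U \<Longrightarrow> P f (A f)" by metis
  have A: "\<And>f. f \<in> L2U \<Longrightarrow> A f \<in> L2U"
    "\<And>f f1. f \<in> L2U \<Longrightarrow> f1 \<in> test_U \<Longrightarrow> I (\<lambda>x. A f x * f1 x) = I (\<lambda>x. G f1 x * f x)"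
    "\<And>f. f \<in> L2U \<Longrightarrow> norm2 (A f) \<le> K * norm2 f"
    using A' unfolding P_def by auto
  have "bounded_L2_operator U_measure A"
    unfolding bounded_L2_operator_def
  proof (intro conjI ballI allI exI[of _ K])
    fix f g assume fg: "f \<in> L2U" "g \<in> L2U"
    have "AE x in U_measure. A (f + g) x = (A f + A g) x"
    proof (rule test_U_separating_eq)
      fix \<phi> assume \<phi>: "\<phi> \<in> test_U"
      have "I (\<lambda>x. A (f + g) x * \<phi> x) = I (\<lambda>x. G \<phi> x * (f + g) x)"
        by (rule A(2)[OF L2_add[OF fg] \<phi>])
      also have "\<dots> = I (\<lambda>x. A f x * \<phi> x) + I (\<lambda>x. A g x * \<phi> x)"
        unfolding A(2)[OF fg(1) \<phi>] A(2)[OF fg(2) \<phi>] by (rule I_mult_add[OF fg G(1)[OF \<phi>]])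
      also have "\<dots> = I (\<lambda>x. \<phi> x * (A f + A g) x)"
        by (subst I_mult_add) (auto simp: mult.commute A fg test_U_L2[OF \<phi>])
      finally show "I (\<lambda>x. A (f + g) x * \<phi> x) = I (\<lambda>x. (A f + A g) x * \<phi> x)" by (simp add: mult.commute)
    qed (intro A L2_add fg)+
    thus "AE x in U_measure. A (f + g) x = A f x + A g x" by simp
  next
    fix c f assume f: "f \<in> L2U"
    have "AE x in U_measure. A (c *\<^sub>c f) x = (c *\<^sub>c A f) x"
    proof (rule test_U_separating_eq)
      fix \<phi> assume \<phi>: "\<phi> \<in> test_U"
      have "I (\<lambda>x. A (c *\<^sub>c f) x * \<phi> x) = I (\<lambda>x. G \<phi> x * (c *\<^sub>c f) x)"
        by (rule A(2)[OF L2_scale[OF f] \<phi>])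
      also have "\<dots> = c * I (\<lambda>x. A f x * \<phi> x)"
        unfolding A(2)[OF f \<phi>] by (rule I_mult_scale)
      also have "\<dots> = I (\<lambda>x. \<phi> x * (c *\<^sub>c A f) x)"
        by (subst I_mult_scale) (simp add: mult.commute)
      finally show "I (\<lambda>x. A (c *\<^sub>c f) x * \<phi> x) = I (\<lambda>x. (c *\<^sub>c A f) x * \<phi> x)" by (simp add: mult.commute)
    qed (auto intro!: A L2_scale f)
    thus "AE x in U_measure. A (c *\<^sub>c f) x = c * A f x" by (simp add: cscale_fun_def cscale_complex_def)
  qed (use A in auto)
  moreover have "T \<phi> = distribution_of_function U_top U_measure (A \<phi>)" if \<phi>: "\<phi> \<in> test_U" for \<phi>
    unfolding distribution_of_function_def fun_eq_iff
    using G(2)[OF _ \<phi>] A(2)[OF test_U_L2[OF \<phi>]] distributions_outside[OF Tdist[OF \<phi>]] by simp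
  ultimately show ?thesis unfolding is_L2_extension_def by blast
qed

text \<open>The norm refers to an extension picked by \<open>SOME\<close>, of which only some bound
  C is known. On test functions the form bound and duality give K; by density this extends to all of
  L2, since C multiplies an approximation error that tends to 0.\<close>

lemma operator_norm_le:
  assumes T: "T \<in> bounded_ops" and "0 \<le> K"
    and bound: "\<And>f1 f2. f1 \<in> test_U \<Longrightarrow> f2 \<in> test_U \<Longrightarrow> cmod (T f2 f1) \<le> K * norm2 f1 * norm2 f2"
  shows "opnorm T \<le> K"
proof -
  define A where "A = (SOME A. is_L2_extension U_top U_measure T A)"
  have "\<exists>A. is_L2_extension U_top U_measure T A" using T unfolding bounded_operators_def by blast
  hence ext: "is_L2_extension U_top U_measure T A" unfolding A_def by (rule someI_ex)
  hence bdd: "bounded_L2_operator U_measure A"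
    and TA: "\<And>\<phi>. \<phi> \<in> test_U \<Longrightarrow> T \<phi> = distribution_of_function U_top U_measure (A \<phi>)"
    by (auto simp: is_L2_extension_def)
  obtain C where C: "\<And>f. f \<in> L2U \<Longrightarrow> norm2 (A f) \<le> C * norm2 f"
    using bdd unfolding bounded_L2_operator_def by blast
  have AL2: "A f \<in> L2U" if "f \<in> L2U" for f using bdd that by (auto simp: bounded_L2_operator_def)
  have on_test: "norm2 (A \<phi>) \<le> K * norm2 \<phi>" if \<phi>: "\<phi> \<in> test_U" for \<phi>
  proof (rule Riesz_of_L2(1)[OF AL2[OF test_U_L2[OF \<phi>]]])
    fix \<psi> assume \<psi>: "\<psi> \<in> test_U"
    have "T \<phi> \<psi> = I (\<lambda>x. A \<phi> x * \<psi> x)" using TA[OF \<phi>] \<psi> by (simp add: distribution_of_function_def)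
    thus "cmod (I (\<lambda>x. A \<phi> x * \<psi> x)) \<le> K * norm2 \<phi> * norm2 \<psi>"
      using bound[OF \<psi> \<phi>] by (simp add: mult.commute mult.left_commute)
  qed (use \<open>0 \<le> K\<close> in simp)
  have A_le: "norm2 (A f) \<le> K * norm2 f" if f: "f \<in> L2U" for f
  proof -
    obtain hs where hs: "\<And>i::nat. hs i \<in> test_U" "(\<lambda>i. norm2 (hs i - f)) \<longlonglongrightarrow> 0"
      using test_U_dense[OF f] by blast
    note hsL2 = test_U_L2[OF hs(1)]
    have "norm2 (A f) \<le> K * norm2 f + (K + C) * norm2 (hs i - f)" for i
    proof -
      have fL: "f - hs i \<in> L2U" using f hsL2 by (rule L2_diff)
      have "AE x in U_measure. A ((f - hs i) + hs i) x = A (f - hs i) x + A (hs i) x"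
        using bdd fL hsL2 unfolding bounded_L2_operator_def by blast
      hence "AE x in U_measure. A f x = (A (f - hs i) + A (hs i)) x" by simp
      hence "norm2 (A f) = norm2 (A (f - hs i) + A (hs i))"
        by (rule L2_norm_cong_AE) (intro L2_borel L2_add AL2 f fL hsL2)+
      also have "\<dots> \<le> norm2 (A (f - hs i)) + norm2 (A (hs i))"
        by (intro L2_norm_triangle AL2 fL hsL2)
      also have "\<dots> \<le> C * norm2 (f - hs i) + K * norm2 (hs i)"
        by (intro add_mono C fL on_test hs)
      finally have 1: "norm2 (A f) \<le> C * norm2 (hs i - f) + K * norm2 (hs i)"
        unfolding L2_norm_minus_commute[of U_measure f] .
      have "norm2 (hs i) \<le> norm2 f + norm2 (hs i - f)"
        using L2_norm_triangle[OF f L2_diff[OF hsL2 f], of i] by simp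
      from mult_left_mono[OF this \<open>0 \<le> K\<close>] 1 show ?thesis by (simp only: distrib_left distrib_right)
    qed
    moreover have "(\<lambda>i. K * norm2 f + (K + C) * norm2 (hs i - f)) \<longlonglongrightarrow> K * norm2 f + (K + C) * 0"
      by (intro tendsto_intros hs)
    ultimately have "norm2 (A f) \<le> K * norm2 f + (K + C) * 0" by (intro LIMSEQ_le_const) blast+
    thus ?thesis by simp
  qed
  have "L2_opnorm U_measure A \<le> K"
    unfolding L2_opnorm_def
  proof (rule cSUP_least)
    show "{f \<in> L2U. norm2 f \<le> 1} \<noteq> {}" using zero_in_L2 by (auto intro!: exI[of _ 0] simp: L2_norm_zero)
    fix f assume "f \<in> {f \<in> L2U. norm2 f \<le> 1}"
    thus "norm2 (A f) \<le> K" using A_le[of f] \<open>0 \<le> K\<close> mult_left_mono[of "norm2 f" 1 K] by auto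
  qed
  thus ?thesis by (simp add: operator_norm_def A_def)
qed

text \<open>Boundedness of the chosen extension makes the supremum finite, so it dominates the
  values on the unit ball; scaling and Cauchy-Schwarz then give the form bound. A function of norm 0
  cannot be scaled and is handled through the constant C.\<close>

lemma operator_norm_bound:
  assumes T: "T \<in> bounded_ops"
  shows "0 \<le> opnorm T"
    and "f1 \<in> test_U \<Longrightarrow> f2 \<in> test_U \<Longrightarrow>
      cmod (T f2 f1) \<le> opnorm T * norm2 f1 * norm2 f2"
proof -
  define A where "A = (SOME A. is_L2_extension U_top U_measure T A)"
  have "\<exists>A. is_L2_extension U_top U_measure T A" using T unfolding bounded_operators_def by blast
  hence ext: "is_L2_extension U_top U_measure T A" unfolding A_def by (rule someI_ex)
  hence bdd: "bounded_L2_operator U_measure A"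
    and TA: "\<And>\<phi>. \<phi> \<in> test_U \<Longrightarrow> T \<phi> = distribution_of_function U_top U_measure (A \<phi>)"
    by (auto simp: is_L2_extension_def)
  obtain C where C: "\<And>f. f \<in> L2U \<Longrightarrow> norm2 (A f) \<le> C * norm2 f"
    using bdd unfolding bounded_L2_operator_def by blast
  have AL2: "A f \<in> L2U" if "f \<in> L2U" for f using bdd that by (auto simp: bounded_L2_operator_def)
  have opn: "opnorm T = L2_opnorm U_measure A" by (simp add: operator_norm_def A_def)
  have "bdd_above ((\<lambda>f. norm2 (A f)) ` {f \<in> L2U. norm2 f \<le> 1})"
  proof (rule bdd_aboveI2)
    fix f assume f: "f \<in> {f \<in> L2U. norm2 f \<le> 1}"
    have "norm2 (A f) \<le> C * norm2 f" using f C by blast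
    also have "\<dots> \<le> \<bar>C\<bar> * norm2 f" by (intro mult_right_mono) auto
    also have "\<dots> \<le> \<bar>C\<bar> * 1" using f by (intro mult_left_mono) auto
    finally show "norm2 (A f) \<le> \<bar>C\<bar> * 1" .
  qed
  hence le: "norm2 (A f) \<le> L2_opnorm U_measure A" if "f \<in> L2U" "norm2 f \<le> 1" for f
    unfolding L2_opnorm_def using that by (intro cSUP_upper) auto
  have "norm2 (A 0) \<le> L2_opnorm U_measure A" by (rule le) (simp_all add: zero_in_L2 L2_norm_zero)
  thus nonneg: "0 \<le> opnorm T" unfolding opn using L2_norm_nonneg order_trans by blast
  have A_le: "norm2 (A f) \<le> L2_opnorm U_measure A * norm2 f" if f: "f \<in> L2U" for f
  proof (cases "norm2 f = 0")
    case True
    thus ?thesis using C[OF f] by simp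
  next
    case False
    define c :: complex where "c = of_real (1 / norm2 f)"
    have c: "cmod c = 1 / norm2 f" unfolding c_def norm_of_real by simp
    have "norm2 (c *\<^sub>c f) = 1" using False by (simp add: L2_norm_scale c)
    hence "norm2 (A (c *\<^sub>c f)) \<le> L2_opnorm U_measure A" using L2_scale[OF f] by (intro le) auto
    moreover have "AE x in U_measure. A (c *\<^sub>c f) x = c * A f x"
      using bdd f unfolding bounded_L2_operator_def by blast
    hence "AE x in U_measure. A (c *\<^sub>c f) x = (c *\<^sub>c A f) x" by (simp add: cscale_fun_def cscale_complex_def)
    hence "norm2 (A (c *\<^sub>c f)) = norm2 (c *\<^sub>c A f)"
      by (rule L2_norm_cong_AE) (intro L2_borel L2_scale AL2 f)+
    ultimately have "norm2 (A f) / norm2 f \<le> L2_opnorm U_measure A" by (simp add: L2_norm_scale c)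
    thus ?thesis using False by (simp add: field_simps less_le)
  qed
  show "cmod (T f2 f1) \<le> opnorm T * norm2 f1 * norm2 f2"
    if t: "f1 \<in> test_U" "f2 \<in> test_U"
  proof -
    have "T f2 f1 = I (\<lambda>x. A f2 x * f1 x)" using TA[OF t(2)] t by (simp add: distribution_of_function_def)
    hence "cmod (T f2 f1) \<le> norm2 (A f2) * norm2 f1"
      using L2_Cauchy_Schwarz[OF AL2[OF test_U_L2[OF t(2)]] test_U_L2[OF t(1)]] by simp
    also have "\<dots> \<le> L2_opnorm U_measure A * norm2 f2 * norm2 f1"
      by (intro mult_right_mono A_le test_U_L2 t) simp
    finally show ?thesis by (simp add: opn mult.commute mult.left_commute)
  qed
qed

lemma distribution_operators_diff:
  assumes S: "S \<in> distribution_operators U_top" and T: "T \<in> distribution_operators U_top"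
  shows "S - T \<in> distribution_operators U_top"
proof (rule distribution_operatorsI)
  have *: "A f \<in> distributions U_top" if "A \<in> distribution_operators U_top" "f \<in> test_U" for A f
    using that unfolding distribution_operators_def continuous_map_def
    by (auto simp: weak_dual_topology_def test_topology_def)
  have lin: "clinear_on test_U S" "clinear_on test_U T" using S T by (auto simp: distribution_operators_def)
  show "clinear_on test_U (S - T)"
    unfolding clinear_on_def
    using clinear_on_add[OF lin(1)] clinear_on_add[OF lin(2)] clinear_on_scale[OF lin(1)] clinear_on_scale[OF lin(2)]
    by (auto simp: fun_eq_iff cscale_fun_def cscale_complex_def algebra_simps)
  show "(S - T) f \<in> distributions U_top" if "f \<in> test_U" for f
    using distributions_diff[OF *[OF S that] *[OF T that]] by simp
  show "(S - T) f = 0" if "f \<notin> test_U" for f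
    using S T that by (simp add: distribution_operators_def)
qed

text \<open>The extensions picked by \<open>SOME\<close> for different operators are unrelated, so
  the triangle inequality is proved for the forms on test functions. The centre R is arbitrary, as
  the continuity criterion for seminorm topologies demands.\<close>

lemma operator_norm_triangle_diff:
  assumes R: "R \<in> bounded_ops" and S: "S \<in> bounded_ops"
    and T: "T \<in> bounded_ops" and K: "0 \<le> K"
    and ST: "\<And>f1 f2. f1 \<in> test_U \<Longrightarrow> f2 \<in> test_U \<Longrightarrow> cmod (S f2 f1 - T f2 f1) \<le> K * norm2 f1 * norm2 f2"
  shows "opnorm (S - R) \<le> opnorm (T - R) + K"
proof -
  have diff: "A - B \<in> bounded_ops"
    if A: "A \<in> bounded_ops" and B: "B \<in> bounded_ops" for A B
  proof -
    have "A - B \<in> distribution_operators U_top"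
      using A B by (intro distribution_operators_diff) (auto simp: bounded_operators_def)
    moreover have "\<exists>E. is_L2_extension U_top U_measure (A - B) E"
    proof (rule bounded_form_L2_extension[OF \<open>A - B \<in> distribution_operators U_top\<close>])
      fix f1 f2 assume t: "f1 \<in> test_U" "f2 \<in> test_U"
      have "cmod ((A - B) f2 f1) \<le> cmod (A f2 f1) + cmod (B f2 f1)" by (simp add: norm_triangle_ineq4)
      thus "cmod ((A - B) f2 f1) \<le> (opnorm A + opnorm B) * norm2 f1 * norm2 f2"
        using operator_norm_bound(2)[OF A t] operator_norm_bound(2)[OF B t] by (simp add: algebra_simps)
    qed (use operator_norm_bound(1) A B in simp)
    ultimately show ?thesis by (simp add: bounded_operators_def)
  qed
  show ?thesis
  proof (rule operator_norm_le[OF diff[OF S R]])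
    fix f1 f2 assume t: "f1 \<in> test_U" "f2 \<in> test_U"
    have "(S - R) f2 f1 = (T - R) f2 f1 + (S f2 f1 - T f2 f1)" by simp
    hence "cmod ((S - R) f2 f1) \<le> cmod ((T - R) f2 f1) + cmod (S f2 f1 - T f2 f1)" by (metis norm_triangle_ineq)
    thus "cmod ((S - R) f2 f1) \<le> (opnorm (T - R) + K) * norm2 f1 * norm2 f2"
      using operator_norm_bound(2)[OF diff[OF T R] t] ST[OF t] by (simp add: algebra_simps)
  qed (use operator_norm_bound(1)[OF diff[OF T R]] K in simp)
qed

section \<open>Averages over balls\<close>

abbreviation lev :: "nat \<Rightarrow> int" where "lev k \<equiv> N + int k"
abbreviation lc :: "nat \<Rightarrow> ('k \<Rightarrow> 'b) \<Rightarrow> bool" where "lc K f \<equiv> loc_const (lev K) U f"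

lemma mem_cb_cong:
  assumes "x' \<in> cb x m" "y' \<in> cb y m" "l \<le> m"
  shows "y' \<in> cb x' l \<longleftrightarrow> y \<in> cb x l"
proof -
  have x: "x' \<in> cb x l" and y: "y' \<in> cb y l" using assms cb_mono by blast+
  have "cb x' l = cb x l" using x by (rule cb_eq)
  moreover have "y' \<in> cb x l \<longleftrightarrow> y \<in> cb x l"
    using y mem_cb_trans[of y' y l x] mem_cb_trans[of y y' l x] mem_cb_sym[of y y' l] by blast
  ultimately show ?thesis by simp
qed

lemma lc_mono: "lc k f \<Longrightarrow> k \<le> K \<Longrightarrow> lc K f"
  by (erule loc_const_mono) simp

lemma lc_mult: "lc K f \<Longrightarrow> lc K g \<Longrightarrow> lc K (\<lambda>x. f x * g x)"
  unfolding loc_const_def by metis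

lemma lc_add: "lc K f \<Longrightarrow> lc K g \<Longrightarrow> lc K (\<lambda>x. f x + g x)"
  unfolding loc_const_def by metis

lemma lc_diff: "lc K f \<Longrightarrow> lc K g \<Longrightarrow> lc K (\<lambda>x. f x - g x)"
  unfolding loc_const_def by metis

lemma lc_const: "lc K (\<lambda>x. c)"
  unfolding loc_const_def by simp

lemma lc_comp: "lc K f \<Longrightarrow> lc K (\<lambda>x. g (f x))"
  unfolding loc_const_def by metis

lemma lc_sum: "(\<And>i. i \<in> S \<Longrightarrow> lc K (f i)) \<Longrightarrow> lc K (\<lambda>x. \<Sum>i\<in>S. f i x)"
  unfolding loc_const_def by (intro ballI impI sum.cong refl) blast

lemma lc_ball: "k \<le> K \<Longrightarrow> lc K (\<lambda>x. of_bool (x \<in> cb v (lev k)))"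
  by (rule lc_mono[OF loc_const_of_bool_cb])

text \<open>For v in \<open>U\<close> this is the mean over the ball of volume q^-(n+k) around v; at
  k = 0 that ball is all of \<open>U\<close>.\<close>

definition avg :: "nat \<Rightarrow> ('k \<Rightarrow> complex) \<Rightarrow> 'k \<Rightarrow> complex" where
  "avg k f v = of_real (q powi lev k) * I (\<lambda>x. of_bool (x \<in> cb v (lev k)) * f x)"

text \<open>Level 0 is separated because subtraction on naturals is truncated; the average preceding
  it counts as 0.\<close>

definition avg_diff :: "nat \<Rightarrow> ('k \<Rightarrow> complex) \<Rightarrow> 'k \<Rightarrow> complex" where
  "avg_diff k f v = avg k f v - (if k = 0 then 0 else avg (k - 1) f v)"

text \<open>With \<open>a = q\<^sup>s\<close> this is \<open>J\<^sup>s\<close>, because averaging over balls of radius \<open>q\<^sup>-\<^sup>n\<^sup>-\<^sup>k\<close> is the Fourier cut-off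
  to \<open>\<mu>\<^sub>0 \<le> q\<^sup>k\<close>; the sum stops at \<open>K\<close> as the higher terms vanish on functions of level \<open>K\<close>.\<close>

definition multiplier :: "real \<Rightarrow> nat \<Rightarrow> ('k \<Rightarrow> complex) \<Rightarrow> 'k \<Rightarrow> complex" where
  "multiplier a K f v = (\<Sum>k\<le>K. of_real (a ^ k) * avg_diff k f v)"

lemma avg_integrable:
  assumes "lc K f"
  shows "integrable U_measure (\<lambda>x. of_bool (x \<in> cb v (lev k)) * (f x :: 'b::{banach, second_countable_topology, real_normed_algebra_1}))"
proof (rule I_integrable)
  show "lc (max k K) (\<lambda>x. of_bool (x \<in> cb v (lev k)) * f x)"
    by (intro lc_mult lc_ball lc_mono[OF assms]) auto
qed

lemma avg_cong: "(\<And>x. x \<in> U \<Longrightarrow> f x = g x) \<Longrightarrow> avg k f v = avg k g v"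
  unfolding avg_def by (intro arg_cong2[of _ _ _ _ "(*)"] I_cong) auto

lemma avg_diff_cong: "(\<And>x. x \<in> U \<Longrightarrow> f x = g x) \<Longrightarrow> avg_diff k f v = avg_diff k g v"
  unfolding avg_diff_def using avg_cong[of f g] by simp

lemma multiplier_cong: "(\<And>x. x \<in> U \<Longrightarrow> f x = g x) \<Longrightarrow> multiplier a K f v = multiplier a K g v"
  unfolding multiplier_def using avg_diff_cong[of f g] by simp

lemma avg_lc: "k \<le> K \<Longrightarrow> lc K (avg k f)"
proof (rule lc_mono[rotated])
  show "lc k (avg k f)" by (rule loc_constI) (simp add: avg_def cb_eq)
qed

lemma avg_diff_lc: "k \<le> K \<Longrightarrow> lc K (avg_diff k f)"
  unfolding avg_diff_def by (cases "k = 0") (auto intro!: lc_diff avg_lc lc_const)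

lemma multiplier_lc: "lc K (multiplier a K f)"
  unfolding multiplier_def by (intro lc_sum lc_mult lc_const avg_diff_lc) simp

lemma avg_sum:
  assumes "\<And>i. i \<in> S \<Longrightarrow> lc K (f i)"
  shows "avg k (\<lambda>x. \<Sum>i\<in>S. c i * f i x) v = (\<Sum>i\<in>S. c i * avg k (f i) v)"
proof -
  have "I (\<lambda>x. of_bool (x \<in> cb v (lev k)) * (\<Sum>i\<in>S. c i * f i x))
      = I (\<lambda>x. \<Sum>i\<in>S. c i * (of_bool (x \<in> cb v (lev k)) * f i x))"
    by (simp add: sum_distrib_left mult.left_commute)
  also have "\<dots> = (\<Sum>i\<in>S. I (\<lambda>x. c i * (of_bool (x \<in> cb v (lev k)) * f i x)))"
    by (intro Bochner_Integration.integral_sum integrable_mult_right avg_integrable[of K] assms)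
  finally show ?thesis by (simp add: avg_def sum_distrib_left mult.left_commute)
qed

lemma avg_diff_sum:
  assumes "\<And>i. i \<in> S \<Longrightarrow> lc K (f i)"
  shows "avg_diff k (\<lambda>x. \<Sum>i\<in>S. c i * f i x) v = (\<Sum>i\<in>S. c i * avg_diff k (f i) v)"
proof -
  have "avg k (\<lambda>x. \<Sum>i\<in>S. c i * f i x) v = (\<Sum>i\<in>S. c i * avg k (f i) v)" for k
    by (rule avg_sum) (rule assms)
  thus ?thesis unfolding avg_diff_def by (simp add: sum_subtractf right_diff_distrib)
qed

lemma multiplier_sum:
  assumes "\<And>i. i \<in> S \<Longrightarrow> lc K (f i)"
  shows "multiplier a K (\<lambda>x. \<Sum>i\<in>S. c i * f i x) v = (\<Sum>i\<in>S. c i * multiplier a K (f i) v)"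
proof -
  have "avg_diff k (\<lambda>x. \<Sum>i\<in>S. c i * f i x) v = (\<Sum>i\<in>S. c i * avg_diff k (f i) v)" for k
    by (rule avg_diff_sum) (rule assms)
  hence "multiplier a K (\<lambda>x. \<Sum>i\<in>S. c i * f i x) v = (\<Sum>k\<le>K. \<Sum>i\<in>S. c i * (of_real (a ^ k) * avg_diff k (f i) v))"
    unfolding multiplier_def by (simp add: sum_distrib_left mult.left_commute)
  also have "\<dots> = (\<Sum>i\<in>S. \<Sum>k\<le>K. c i * (of_real (a ^ k) * avg_diff k (f i) v))" by (rule sum.swap)
  finally show ?thesis by (simp add: multiplier_def sum_distrib_left)
qed

lemma multiplier_add:
  assumes "lc K f" "lc K g"
  shows "multiplier a K (\<lambda>x. f x + g x) v = multiplier a K f v + multiplier a K g v"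
  using multiplier_sum[of "{True, False}" K "\<lambda>b. if b then f else g" a "\<lambda>_. 1" v] assms by simp

lemma multiplier_scale:
  assumes "lc K f"
  shows "multiplier a K (\<lambda>x. c * f x) v = c * multiplier a K f v"
  using multiplier_sum[of "{True}" K "\<lambda>b. f" a "\<lambda>_. c" v] assms by simp

lemma avg_self:
  assumes "lc K f" "K \<le> k" "v \<in> U"
  shows "avg k f v = f v"
proof -
  have "I (\<lambda>x. of_bool (x \<in> cb v (lev k)) * f x) = I (\<lambda>x. of_bool (x \<in> cb v (lev k)) * f v)"
    using loc_constD[OF lc_mono[OF assms(1,2)] _ assms(3)] by (intro I_cong) auto
  also have "\<dots> = of_real (q powi (- lev k)) * f v" by (rule I_indicator_cb[OF assms(3)]) simp
  finally show ?thesis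
    unfolding avg_def by (simp flip: of_real_mult power_int_add mult.assoc)
qed

text \<open>A finer average fixes a coarser one, which is already constant at the finer level. In
  the coarse average of a fine one, Fubini integrates out the small ball, whose volume cancels its
  normalization.\<close>

lemma avg_avg:
  assumes f: "lc K f" and v: "v \<in> U"
  shows "avg k (avg l f) v = avg (min k l) f v"
proof (cases "l \<le> k")
  case True
  thus ?thesis using avg_self[OF avg_lc[OF order_refl, of l f] True v] by (simp add: min_absorb2)
next
  case False
  hence kl: "k \<le> l" by simp
  define M where "M = max K l"
  have M: "K \<le> M" "l \<le> M" "k \<le> M" using kl by (auto simp: M_def)
  let ?q = "\<lambda>k. complex_of_real (q powi lev k)"
  have "avg k (avg l f) v = ?q k * (?q l * I (\<lambda>x. I (\<lambda>y. of_bool (x \<in> cb v (lev k)) * (of_bool (y \<in> cb x (lev l)) * f y))))"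
    unfolding avg_def by (simp add: mult.left_commute)
  also have "I (\<lambda>x. I (\<lambda>y. of_bool (x \<in> cb v (lev k)) * (of_bool (y \<in> cb x (lev l)) * f y)))
      = I (\<lambda>y. I (\<lambda>x. of_bool (x \<in> cb v (lev k)) * (of_bool (y \<in> cb x (lev l)) * f y)))"
  proof (rule I_swap[of "lev M"])
    fix x x' y y' assume h: "y \<in> U" "y' \<in> U" "x' \<in> cb x (lev M)" "y' \<in> cb y (lev M)"
    have "x' \<in> cb v (lev k) \<longleftrightarrow> x \<in> cb v (lev k)" using M by (intro mem_cb_cong[OF mem_cb_self h(3)]) simp
    moreover have "y' \<in> cb x' (lev l) \<longleftrightarrow> y \<in> cb x (lev l)" using M by (intro mem_cb_cong[OF h(3,4)]) simp
    moreover have "f y' = f y" using loc_constD[OF lc_mono[OF f M(1)] h(2,1,4)] .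
    ultimately show "of_bool (x' \<in> cb v (lev k)) * (of_bool (y' \<in> cb x' (lev l)) * f y')
      = of_bool (x \<in> cb v (lev k)) * (of_bool (y \<in> cb x (lev l)) * f y)" by simp
  qed
  also have "\<dots> = I (\<lambda>y. of_real (q powi (- lev l)) * (of_bool (y \<in> cb v (lev k)) * f y))"
  proof (rule I_cong)
    fix y assume y: "y \<in> U"
    have "I (\<lambda>x. of_bool (x \<in> cb v (lev k)) * (of_bool (y \<in> cb x (lev l)) * f y))
        = I (\<lambda>x. of_bool (x \<in> cb y (lev l)) * (of_bool (y \<in> cb v (lev k)) * f y))"
    proof (rule I_cong)
      fix x
      have "x \<in> cb v (lev k) \<longleftrightarrow> y \<in> cb v (lev k)" if "x \<in> cb y (lev l)"
        using kl by (intro mem_cb_cong[OF mem_cb_self that]) simp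
      thus "of_bool (x \<in> cb v (lev k)) * (of_bool (y \<in> cb x (lev l)) * f y)
          = of_bool (x \<in> cb y (lev l)) * (of_bool (y \<in> cb v (lev k)) * f y)"
        using mem_cb_sym[of y x "lev l"] by auto
    qed
    also have "\<dots> = of_real (q powi (- lev l)) * (of_bool (y \<in> cb v (lev k)) * f y)"
      by (rule I_indicator_cb[OF y]) simp
    finally show "I (\<lambda>x. of_bool (x \<in> cb v (lev k)) * (of_bool (y \<in> cb x (lev l)) * f y)) = \<dots>" .
  qed
  also have "\<dots> = of_real (q powi (- lev l)) * I (\<lambda>y. of_bool (y \<in> cb v (lev k)) * f y)" by simp
  also have "?q k * (?q l * \<dots>) = ?q k * ((?q l * of_real (q powi (- lev l))) * I (\<lambda>y. of_bool (y \<in> cb v (lev k)) * f y))"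
    by (simp only: mult.assoc)
  also have "?q l * of_real (q powi (- lev l)) = 1" by (simp flip: of_real_mult power_int_add)
  finally show ?thesis using kl by (simp add: avg_def min_absorb1)
qed

lemma avg_contraction:
  assumes f: "lc K f"
  shows "I (\<lambda>v. cmod (avg k f v)) \<le> I (\<lambda>x. cmod (f x))"
proof -
  define M where "M = max K k"
  have M: "K \<le> M" "k \<le> M" by (auto simp: M_def)
  have "I (\<lambda>v. cmod (avg k f v)) \<le> I (\<lambda>v. q powi lev k * I (\<lambda>x. of_bool (x \<in> cb v (lev k)) * cmod (f x)))"
  proof (rule integral_mono)
    show "integrable U_measure (\<lambda>v. cmod (avg k f v))" by (rule I_integrable[OF lc_comp[OF avg_lc[OF order_refl]]])
    show "integrable U_measure (\<lambda>v. q powi lev k * I (\<lambda>x. of_bool (x \<in> cb v (lev k)) * cmod (f x)))"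
      by (rule I_integrable[of "lev k"], rule loc_constI) (simp add: cb_eq)
    fix v
    have "cmod (I (\<lambda>x. of_bool (x \<in> cb v (lev k)) * f x)) \<le> I (\<lambda>x. cmod (of_bool (x \<in> cb v (lev k)) * f x))"
      by (rule integral_norm_bound)
    also have "\<dots> = I (\<lambda>x. of_bool (x \<in> cb v (lev k)) * cmod (f x))"
      by (intro I_cong) (simp add: norm_mult)
    finally show "cmod (avg k f v) \<le> q powi lev k * I (\<lambda>x. of_bool (x \<in> cb v (lev k)) * cmod (f x))"
      unfolding avg_def norm_mult norm_of_real by (simp add: mult_left_mono)
  qed
  also have "\<dots> = q powi lev k * I (\<lambda>v. I (\<lambda>x. of_bool (x \<in> cb v (lev k)) * cmod (f x)))" by simp
  also have "I (\<lambda>v. I (\<lambda>x. of_bool (x \<in> cb v (lev k)) * cmod (f x)))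
      = I (\<lambda>x. I (\<lambda>v. of_bool (x \<in> cb v (lev k)) * cmod (f x)))"
  proof (rule I_swap[of "lev M"])
    fix x x' y y' assume h: "y \<in> U" "y' \<in> U" "x' \<in> cb x (lev M)" "y' \<in> cb y (lev M)"
    have "y' \<in> cb x' (lev k) \<longleftrightarrow> y \<in> cb x (lev k)" using M by (intro mem_cb_cong[OF h(3,4)]) simp
    moreover have "f y' = f y" using loc_constD[OF lc_mono[OF f M(1)] h(2,1,4)] .
    ultimately show "of_bool (y' \<in> cb x' (lev k)) * cmod (f y') = of_bool (y \<in> cb x (lev k)) * cmod (f y)" by simp
  qed
  also have "\<dots> = I (\<lambda>x. q powi (- lev k) * cmod (f x))"
  proof (rule I_cong)
    fix x assume x: "x \<in> U"
    show "I (\<lambda>v. of_bool (x \<in> cb v (lev k)) * cmod (f x)) = q powi (- lev k) * cmod (f x)"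
      using I_indicator_cb[OF x, of "lev k" "cmod (f x)"] by (simp add: mem_cb_sym[of x])
  qed
  also have "q powi lev k * \<dots> = (q powi lev k * q powi (- lev k)) * I (\<lambda>x. cmod (f x))" by simp
  also have "q powi lev k * q powi (- lev k) = 1" by (simp flip: power_int_add)
  finally show ?thesis by simp
qed

lemma avg_avg_diff:
  assumes f: "lc K f" and v: "v \<in> U"
  shows "avg j (avg_diff k f) v = (if k \<le> j then avg_diff k f v else 0)"
proof -
  \<comment> \<open>The difference is encoded as a signed sum over two Booleans so that
    \<open>avg_sum\<close> applies uniformly, the case k = 0 included.\<close>
  have "avg j (avg_diff k f) v = avg j (\<lambda>x. \<Sum>b\<in>{True, False}. (if b then 1 else - 1) * (if b then avg k f else if k = 0 then (\<lambda>_. 0) else avg (k - 1) f) x) v"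
    by (intro avg_cong) (simp add: avg_diff_def)
  also have "\<dots> = (\<Sum>b\<in>{True, False}. (if b then 1 else - 1) * avg j (if b then avg k f else if k = 0 then (\<lambda>_. 0) else avg (k - 1) f) v)"
  proof (rule avg_sum[of _ k])
    fix b :: bool
    have "lc k (avg k f)" "lc k (avg (k - 1) f)" "lc k (\<lambda>_::'k. 0::complex)" by (simp_all add: avg_lc lc_const)
    thus "lc k (if b then avg k f else if k = 0 then (\<lambda>_. 0) else avg (k - 1) f)" by (auto split: if_splits)
  qed
  also have "\<dots> = avg j (avg k f) v - (if k = 0 then 0 else avg j (avg (k - 1) f) v)"
    by (simp add: avg_def[of j "\<lambda>_. 0"])
  also have "\<dots> = (if k \<le> j then avg_diff k f v else 0)"
    unfolding avg_avg[OF f v] by (auto simp: avg_diff_def min_def not_le)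
  finally show ?thesis .
qed

lemma avg_diff_avg_diff:
  assumes f: "lc K f" and v: "v \<in> U"
  shows "avg_diff j (avg_diff k f) v = (if j = k then avg_diff k f v else 0)"
  unfolding avg_diff_def[of j] avg_avg_diff[OF assms] by auto

text \<open>The increments \<open>avg_diff\<close> are idempotent and annihilate each other, so only
  diagonal terms survive and the coefficients multiply.\<close>

lemma multiplier_multiplier:
  assumes f: "lc K f" and v: "v \<in> U"
  shows "multiplier a K (multiplier b K f) v = multiplier (a * b) K f v"
proof -
  have D: "avg_diff j (multiplier b K f) v = of_real (b ^ j) * avg_diff j f v" if "j \<le> K" for j
  proof -
    have "avg_diff j (multiplier b K f) v = (\<Sum>k\<le>K. of_real (b ^ k) * avg_diff j (avg_diff k f) v)"
      unfolding multiplier_def by (rule avg_diff_sum[of _ K]) (simp add: avg_diff_lc)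
    also have "\<dots> = (\<Sum>k\<le>K. if k = j then of_real (b ^ j) * avg_diff j f v else 0)"
      by (intro sum.cong) (auto simp: avg_diff_avg_diff[OF f v])
    finally show ?thesis using that by simp
  qed
  have "multiplier a K (multiplier b K f) v = (\<Sum>j\<le>K. of_real (a ^ j) * (of_real (b ^ j) * avg_diff j f v))"
    unfolding multiplier_def[of a] by (intro sum.cong) (simp_all add: D)
  thus ?thesis by (simp add: multiplier_def power_mult_distrib mult.assoc)
qed

lemma sum_avg_diff: "(\<Sum>k\<le>K. avg_diff k f v) = avg K f v"
  by (induction K) (simp_all add: avg_diff_def)

lemma multiplier_one: "lc K f \<Longrightarrow> v \<in> U \<Longrightarrow> multiplier 1 K f v = f v"
  by (simp add: multiplier_def sum_avg_diff avg_self)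

lemma multiplier_by_parts:
  "multiplier a K f v = of_real (a ^ K) * avg K f v + (\<Sum>k<K. of_real (a ^ k - a ^ Suc k) * avg k f v)"
  by (induction K) (simp_all add: multiplier_def avg_diff_def algebra_simps)

lemma multiplier_contraction:
  assumes f: "lc K f" and a: "0 \<le> a" "a \<le> 1"
  shows "I (\<lambda>v. cmod (multiplier a K f v)) \<le> I (\<lambda>x. cmod (f x))"
proof -
  have pos: "0 \<le> a ^ k - a ^ Suc k" for k using a by (simp add: mult_left_le_one_le)
  have int: "integrable U_measure (\<lambda>v. cmod (avg k f v))" for k
    by (rule I_integrable[OF lc_comp[OF avg_lc[OF order_refl]]])
  have "I (\<lambda>v. cmod (multiplier a K f v))
      \<le> I (\<lambda>v. a ^ K * cmod (avg K f v) + (\<Sum>k<K. (a ^ k - a ^ Suc k) * cmod (avg k f v)))"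
  proof (rule integral_mono)
    show "integrable U_measure (\<lambda>v. cmod (multiplier a K f v))" by (rule I_integrable[OF lc_comp[OF multiplier_lc]])
    show "integrable U_measure (\<lambda>v. a ^ K * cmod (avg K f v) + (\<Sum>k<K. (a ^ k - a ^ Suc k) * cmod (avg k f v)))"
      by (intro Bochner_Integration.integrable_add integrable_mult_right int Bochner_Integration.integrable_sum)
    fix v
    have "cmod (multiplier a K f v) \<le> cmod (of_real (a ^ K) * avg K f v) + cmod (\<Sum>k<K. of_real (a ^ k - a ^ Suc k) * avg k f v)"
      unfolding multiplier_by_parts by (rule norm_triangle_ineq)
    also have "\<dots> \<le> cmod (of_real (a ^ K) * avg K f v) + (\<Sum>k<K. cmod (of_real (a ^ k - a ^ Suc k) * avg k f v))"
      by (intro add_left_mono norm_sum)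
    also have "\<dots> = a ^ K * cmod (avg K f v) + (\<Sum>k<K. (a ^ k - a ^ Suc k) * cmod (avg k f v))"
      unfolding norm_mult norm_of_real using pos a by (simp add: abs_of_nonneg)
    finally show "cmod (multiplier a K f v) \<le> a ^ K * cmod (avg K f v) + (\<Sum>k<K. (a ^ k - a ^ Suc k) * cmod (avg k f v))" .
  qed
  also have "\<dots> = a ^ K * I (\<lambda>v. cmod (avg K f v)) + (\<Sum>k<K. (a ^ k - a ^ Suc k) * I (\<lambda>v. cmod (avg k f v)))"
    by (subst Bochner_Integration.integral_add)
      (auto simp del: power_Suc intro!: integrable_mult_right int Bochner_Integration.integrable_sum simp: Bochner_Integration.integral_sum int)
  also have "\<dots> \<le> a ^ K * I (\<lambda>x. cmod (f x)) + (\<Sum>k<K. (a ^ k - a ^ Suc k) * I (\<lambda>x. cmod (f x)))"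
    using a pos by (intro add_mono sum_mono mult_left_mono avg_contraction[OF f]) auto
  also have "\<dots> = (a ^ K + (\<Sum>k<K. a ^ k - a ^ Suc k)) * I (\<lambda>x. cmod (f x))"
    by (simp only: sum_distrib_right distrib_right)
  also have "(\<Sum>k<K. a ^ k - a ^ Suc k) = 1 - a ^ K" using sum_lessThan_telescope'[of "\<lambda>k. a ^ k" K] by simp
  finally show ?thesis by simp
qed

text \<open>As |t| is 0 or a power of q, truncation at 1 leaves one index j that records both the
  value of \<open>\<mu>0\<close> and the smallest ball of radius q^(n+j) around 0 that contains
  t.\<close>

lemma mu0_shell: "\<exists>j. \<mu>0 t = q ^ j \<and> (\<forall>k. absk t \<le> q powi lev k \<longleftrightarrow> j \<le> k)"
proof -
  have m: "\<mu>0 t = max 1 (q powi (- N) * absk t)"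
    by (simp add: \<mu>0_def absk_mult absk_power absk_pi power_int_minus power_one_over inverse_eq_divide)
  show ?thesis
  proof (cases "absk t \<le> q powi N")
    case True
    have "q powi (- N) * absk t \<le> q powi (- N) * q powi N" by (intro mult_left_mono True) simp
    also have "\<dots> = 1" using power_int_add[of q "- N" N] by (simp del: power_int_of_nat)
    finally have "\<mu>0 t = q ^ 0" unfolding m by simp
    moreover have "absk t \<le> q powi lev k" for k
      using True q_powi_le_iff[of N "lev k"] order_trans by simp
    ultimately show ?thesis by blast
  next
    case False
    hence "t \<noteq> 0" using q_powi_pos(2)[of N] by auto
    then obtain i where i: "absk t = q powi i" by (rule absk_eq_powi)
    have iN: "N < i" using False unfolding i q_powi_le_iff by simp
    define j where "j = nat (i - N)"
    have ij: "i = lev j" using iN by (simp add: j_def)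
    have "q powi (- N) * absk t = q ^ j" unfolding i ij by (simp flip: power_int_add power_int_of_nat)
    moreover have "1 \<le> q ^ j" by (intro one_le_power less_imp_le q_gt_1)
    ultimately have "\<mu>0 t = q ^ j" unfolding m by simp
    thus ?thesis using i ij by (intro exI[of _ j]) simp
  qed
qed

text \<open>The dual counterpart of \<open>multiplier\<close>: indicators of balls take the place of
  averages, and the only increment that contributes is the one whose shell contains t.\<close>

lemma mu0_powr_telescope:
  "(\<Sum>k\<le>K. (q powr s) ^ k * (of_bool (absk t \<le> q powi lev k) - (if k = 0 then 0 else of_bool (absk t \<le> q powi lev (k - 1)))))
    = \<mu>0 t powr s * of_bool (absk t \<le> q powi lev K)"
proof -
  obtain j where j: "\<mu>0 t = q ^ j" "\<And>k. absk t \<le> q powi lev k \<longleftrightarrow> j \<le> k" using mu0_shell by blast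
  have "of_bool (j \<le> k) - (if k = 0 then 0 else of_bool (j \<le> k - 1)) = (of_bool (k = j) :: real)" for k
    by (cases k) auto
  hence "(\<Sum>k\<le>K. (q powr s) ^ k * (of_bool (absk t \<le> q powi lev k) - (if k = 0 then 0 else of_bool (absk t \<le> q powi lev (k - 1)))))
      = (\<Sum>k\<le>K. if k = j then (q powr s) ^ k else 0)" unfolding j(2) by (intro sum.cong) auto
  also have "\<dots> = (q powr s) ^ j * of_bool (j \<le> K)" by simp
  also have "(q powr s) ^ j = \<mu>0 t powr s"
    unfolding j(1) by (simp add: powr_powr mult.commute flip: powr_realpow)
  finally show ?thesis by (simp add: j(2))
qed

section \<open>The kernel of \<open>J\<^sup>s\<close>\<close>

lemma indicator_cb_minus: "indicator (cb 0 (- i)) t *\<^sub>R z = of_bool (absk t \<le> q powi i) * (z :: complex)"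
  unfolding indicator_def mem_cb_minus by simp

lemma test_functions_euclideanI:
  fixes f :: "'k \<Rightarrow> complex"
  assumes f: "loc_const m UNIV f" and out: "\<And>x. x \<notin> cb a i \<Longrightarrow> f x = 0"
  shows "f \<in> test_functions euclidean"
  unfolding test_functions_def
proof (intro CollectI conjI ballI allI impI)
  fix x
  have "f y = f x" if "y \<in> cb x m" for y using that by (intro loc_constD[OF f]) auto
  thus "\<exists>V. openin euclidean V \<and> x \<in> V \<and> (\<forall>y\<in>V. f y = f x)"
    using open_cb[of x m] mem_cb_self[of x m] unfolding open_openin[symmetric] by blast
next
  have "closure {x. f x \<noteq> 0} \<subseteq> cb a i" using out closed_cb by (intro closure_minimal) auto
  hence "compact (closure {x. f x \<noteq> 0})"
    using compact_cb by (metis closed_closure compact_Int_closed inf.absorb_iff2)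
  thus "compactin euclidean (euclidean closure_of {x \<in> topspace euclidean. f x \<noteq> 0})" by simp
qed simp

lemma fourier_eq_I:
  assumes "\<And>x. x \<notin> U \<Longrightarrow> f x = 0"
  shows "fourier f t = I (\<lambda>x. f x * \<Psi> (t * x))"
proof -
  have "f x * \<Psi> (t * x) = indicator (cb 1 N) x *\<^sub>R (f x * \<Psi> (t * x))" for x
    using assms[of x] by (cases "x \<in> U") (auto simp: U_eq_cb)
  thus ?thesis unfolding fourier_def I_eq_set_integral set_lebesgue_integral_def by simp
qed

lemma cnj_char_times_fourier:
  assumes "\<And>x. x \<notin> U \<Longrightarrow> f x = 0"
  shows "cnj (\<Psi> t) * fourier f t = I (\<lambda>x. f x * \<Psi> ((x - 1) * t))"
proof -
  have "fourier f t = I (\<lambda>x. f x * \<Psi> (t * x))" by (rule fourier_eq_I) (rule assms)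
  hence "cnj (\<Psi> t) * fourier f t = I (\<lambda>x. cnj (\<Psi> t) * (f x * \<Psi> (t * x)))" by simp
  also have "\<dots> = I (\<lambda>x. f x * \<Psi> ((x - 1) * t))"
  proof (rule I_cong)
    fix x
    have "\<Psi> ((x - 1) * t) = cnj (\<Psi> t) * \<Psi> (t * x)"
      using char_add[of "- t" "t * x"] by (simp add: char_minus algebra_simps)
    thus "cnj (\<Psi> t) * (f x * \<Psi> (t * x)) = f x * \<Psi> ((x - 1) * t)" by (simp add: mult.left_commute)
  qed
  finally show ?thesis .
qed

text \<open>On each ball of level K the function g is constant, and \<sigma> carries the ball
  isometrically onto another one, over which the character integrates to 0. The identity as \<sigma>
  bounds the support of Fourier transforms; 1 + \<open>\<phi>\<close> does the same for Wigner
  functions.\<close>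

lemma lc_char_isometry_eq_0:
  assumes g: "lc K g" and t: "\<not> absk t \<le> q powi lev K"
    and \<sigma>U: "\<And>w. w \<in> U \<Longrightarrow> \<sigma> w \<in> U"
    and \<sigma>iso: "\<And>v w. v \<in> U \<Longrightarrow> w \<in> U \<Longrightarrow> absk (\<sigma> v - \<sigma> w) = absk (v - w)"
  shows "I (\<lambda>w. g w * \<Psi> (t * \<sigma> w)) = 0"
proof -
  obtain R where R: "reps 1 N (lev K) R" using reps_exist[of N "lev K"] by auto
  have RU: "R \<subseteq> U" using reps_subset[OF R] by (simp add: U_eq_cb)
  \<comment> \<open>Cutting off outside \<open>U\<close> makes g a test function, which can be
    expanded in indicators of balls.\<close>
  define h where "h w = (if w \<in> U then g w else 0)" for w
  have h: "lc K h"
  proof (rule loc_constI)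
    fix x y assume "x \<in> U" "y \<in> U" "x \<in> cb y (lev K)"
    thus "h x = h y" unfolding h_def using loc_constD[OF g, of x y] by simp
  qed
  have ht: "h \<in> test_U" using h by (rule loc_const_test_U) (simp add: h_def)
  have exp: "h w = (\<Sum>r\<in>R. h r * of_bool (w \<in> cb r (lev K)))" for w
  proof -
    have "h w = (\<Sum>r\<in>R. h r *\<^sub>c ball_ind r (lev K)) w" by (rule fun_cong[OF test_U_expand[OF R ht h]]) simp
    also have "\<dots> = (\<Sum>r\<in>R. h r * of_bool (w \<in> cb r (lev K)))"
      by (simp add: fun_sum_apply cscale_fun_def cscale_complex_def ball_ind_def)
    finally show ?thesis .
  qed
  obtain m where m: "lev K \<le> m" "absk t \<le> q powi m" using ex_powi_bound by blast
  have lcm: "loc_const m U (\<lambda>y. of_bool (y \<in> cb v (lev K)) * \<Psi> (t * y))" for v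
  proof -
    have "loc_const m U (\<lambda>x. of_bool (x \<in> cb v (lev K)) :: complex)" by (rule loc_const_mono[OF loc_const_of_bool_cb m(1)])
    moreover have "loc_const m U (\<lambda>x. \<Psi> (t * x))" by (rule loc_const_char) (rule m(2))
    ultimately show ?thesis unfolding loc_const_def by metis
  qed
  have zero: "I (\<lambda>w. of_bool (\<sigma> w \<in> cb (\<sigma> r) (lev K)) * \<Psi> (t * \<sigma> w)) = 0" if r: "r \<in> R" for r
  proof -
    have "I (\<lambda>w. of_bool (\<sigma> w \<in> cb (\<sigma> r) (lev K)) * \<Psi> (t * \<sigma> w)) = I (\<lambda>y. of_bool (y \<in> cb (\<sigma> r) (lev K)) * \<Psi> (t * y))"
      by (rule I_isometry[OF \<sigma>U \<sigma>iso lcm])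
    also have "\<dots> = 0" using \<sigma>U RU r by (intro I_char_cb[OF _ _ t]) auto
    finally show ?thesis .
  qed
  have int: "integrable U_measure (\<lambda>w. of_bool (\<sigma> w \<in> cb (\<sigma> r) (lev K)) * \<Psi> (t * \<sigma> w))" for r
  proof (rule I_integrable[of m], rule loc_constI)
    fix x y assume xy: "x \<in> U" "y \<in> U" "x \<in> cb y m"
    hence "\<sigma> x \<in> cb (\<sigma> y) m" using \<sigma>iso[OF xy(1,2)] by (simp add: cb_def)
    from loc_constD[OF lcm \<sigma>U[OF xy(1)] \<sigma>U[OF xy(2)] this]
    show "of_bool (\<sigma> x \<in> cb (\<sigma> r) (lev K)) * \<Psi> (t * \<sigma> x) = of_bool (\<sigma> y \<in> cb (\<sigma> r) (lev K)) * \<Psi> (t * \<sigma> y)" .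
  qed
  have "I (\<lambda>w. g w * \<Psi> (t * \<sigma> w)) = I (\<lambda>w. \<Sum>r\<in>R. h r * (of_bool (\<sigma> w \<in> cb (\<sigma> r) (lev K)) * \<Psi> (t * \<sigma> w)))"
  proof (rule I_cong)
    fix w assume w: "w \<in> U"
    have "g w * \<Psi> (t * \<sigma> w) = h w * \<Psi> (t * \<sigma> w)" using w by (simp add: h_def)
    also have "\<dots> = (\<Sum>r\<in>R. (h r * of_bool (w \<in> cb r (lev K))) * \<Psi> (t * \<sigma> w))"
      by (subst exp) (rule sum_distrib_right)
    also have "\<dots> = (\<Sum>r\<in>R. h r * (of_bool (\<sigma> w \<in> cb (\<sigma> r) (lev K)) * \<Psi> (t * \<sigma> w)))"
    proof (rule sum.cong[OF refl])
      fix r assume "r \<in> R"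
      hence "w \<in> cb r (lev K) \<longleftrightarrow> \<sigma> w \<in> cb (\<sigma> r) (lev K)"
        using \<sigma>iso[OF w, of r] RU by (auto simp: cb_def)
      thus "(h r * of_bool (w \<in> cb r (lev K))) * \<Psi> (t * \<sigma> w)
        = h r * (of_bool (\<sigma> w \<in> cb (\<sigma> r) (lev K)) * \<Psi> (t * \<sigma> w))" by simp
    qed
    finally show "g w * \<Psi> (t * \<sigma> w) = \<dots>" .
  qed
  also have "\<dots> = (\<Sum>r\<in>R. I (\<lambda>w. h r * (of_bool (\<sigma> w \<in> cb (\<sigma> r) (lev K)) * \<Psi> (t * \<sigma> w))))"
    by (rule Bochner_Integration.integral_sum) (rule integrable_mult_right[OF int])
  also have "\<dots> = 0" using zero by (intro sum.neutral) simp
  finally show ?thesis .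
qed

lemma U_diff_one: "x \<in> U \<Longrightarrow> absk (x - 1) \<le> q powi (- N)"
  by (simp add: U_eq_cb cb_def)

text \<open>Fourier inversion truncated at |t| <= q^(n+k): over this ball the character integrates
  to q^(n+k) times the indicator of |x - 1| <= q^-(n+k), and this is the kernel of the average at
  1.\<close>

lemma ball_integral_eq_avg:
  assumes f: "lc K f" and "k \<le> K"
  shows "(LINT t:cb 0 (- lev k)|dt. I (\<lambda>x. f x * \<Psi> ((x - 1) * t))) = avg k f 1"
proof -
  obtain R where R: "reps 1 N (lev K) R" using reps_exist[of N "lev K"] by auto
  let ?c = "q powi (- lev K)"
  have g: "I (\<lambda>x. f x * \<Psi> ((x - 1) * t)) = (\<Sum>r\<in>R. (?c *\<^sub>R f r) * \<Psi> ((r - 1) * t))" if t: "t \<in> cb 0 (- lev k)" for t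
  proof -
    have "absk t \<le> q powi lev k" using t unfolding mem_cb_minus .
    also have "\<dots> \<le> q powi lev K" unfolding q_powi_le_iff using assms by simp
    finally have "lc K (\<lambda>x. \<Psi> (t * x))" by (rule loc_const_char)
    hence "lc K (\<lambda>x. f x * (\<Psi> (t * x) * \<Psi> (- t)))" by (intro lc_mult lc_const f)
    hence "lc K (\<lambda>x. f x * \<Psi> ((x - 1) * t))" by (simp add: algebra_simps flip: char_add)
    from I_reps[OF R this] show ?thesis by (simp add: scaleR_sum_right)
  qed
  have "(LINT t:cb 0 (- lev k)|dt. I (\<lambda>x. f x * \<Psi> ((x - 1) * t)))
      = (\<integral>t. (\<Sum>r\<in>R. (?c *\<^sub>R f r) * (indicator (cb 0 (- lev k)) t *\<^sub>R \<Psi> ((r - 1) * t))) \<partial>dt)"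
    unfolding set_lebesgue_integral_def
    by (rule Bochner_Integration.integral_cong) (auto simp: g indicator_def)
  also have "\<dots> = (\<Sum>r\<in>R. (?c *\<^sub>R f r) * (LINT t:cb 0 (- lev k)|dt. \<Psi> ((r - 1) * t)))"
  proof -
    have "integrable dt (\<lambda>t. indicator (cb 0 (- lev k)) t *\<^sub>R \<Psi> ((r - 1) * t))" for r
    proof -
      obtain m where "absk (r - 1) \<le> q powi m" using ex_powi_bound by blast
      from integrable_cb[OF loc_const_char[OF this]] show ?thesis unfolding set_integrable_def .
    qed
    thus ?thesis unfolding set_lebesgue_integral_def
      by (subst Bochner_Integration.integral_sum[OF integrable_mult_right]) (simp_all only: integral_mult_right_zero)
  qed
  also have "\<dots> = (\<Sum>r\<in>R. (?c *\<^sub>R f r) * (of_bool (r \<in> cb 1 (lev k)) * of_real (q powi lev k)))"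
    unfolding integral_char_cb by (intro sum.cong refl arg_cong2[of _ _ _ _ "(*)"]) (simp add: cb_def if_distrib add.commute cong: if_cong)
  also have "\<dots> = of_real (q powi lev k) * (?c *\<^sub>R (\<Sum>r\<in>R. of_bool (r \<in> cb 1 (lev k)) * f r))"
    by (simp add: sum_distrib_left scaleR_sum_right mult.commute mult.left_commute)
  also have "?c *\<^sub>R (\<Sum>r\<in>R. of_bool (r \<in> cb 1 (lev k)) * f r) = I (\<lambda>x. of_bool (x \<in> cb 1 (lev k)) * f x)"
    by (rule I_reps[OF R, symmetric]) (intro lc_mult lc_ball f assms, simp)
  finally show ?thesis by (simp add: avg_def)
qed

text \<open>The transform of f vanishes for |t| > q^(n+K), so the power of \<open>\<mu>0\<close> may
  be replaced by its finite telescoping sum, each term of which is a truncated inversion. The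
  conjugate character in the kernel moves the point of evaluation to 1.\<close>

lemma J_kernel_eq:
  assumes f: "lc K f" and out: "\<And>x. x \<notin> U \<Longrightarrow> f x = 0"
  shows "J_kernel s f = multiplier (q powr s) K f 1"
proof -
  define g where "g t = I (\<lambda>x. f x * \<Psi> ((x - 1) * t))" for t
  have F: "fourier f t = I (\<lambda>x. f x * \<Psi> (t * x))" for t by (rule fourier_eq_I) (rule out)
  have gF: "cnj (\<Psi> t) * fourier f t = g t" for t
    unfolding g_def by (rule cnj_char_times_fourier) (rule out)
  have g0: "g t = 0" if "t \<notin> cb 0 (- lev K)" for t
  proof -
    have "\<not> absk t \<le> q powi lev K" using that unfolding mem_cb_minus .
    hence "fourier f t = 0" unfolding F by (rule lc_char_isometry_eq_0[OF f]) simp_all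
    thus ?thesis using gF[of t] by simp
  qed
  have F0: "fourier f t = 0" if "t \<notin> cb 0 (- lev K)" for t
    using gF[of t] g0[OF that] char_unitary[of t] by auto
  have f_test: "f \<in> test_functions euclidean"
  proof (rule test_functions_euclideanI[of "lev K" _ 1 N])
    show "loc_const (lev K) UNIV f"
    proof (rule loc_constI)
      fix x y assume xy: "x \<in> cb y (lev K)"
      have "x \<in> U \<longleftrightarrow> y \<in> U" unfolding U_eq_cb using xy by (intro mem_cb_cong[OF mem_cb_self]) auto
      thus "f x = f y" using loc_constD[OF f _ _ xy] out by (cases "x \<in> U") auto
    qed
  qed (simp add: out U_eq_cb)
  have fourier_test: "fourier f \<in> test_functions euclidean"
  proof (rule test_functions_euclideanI[OF _ F0])
    \<comment> \<open>Since |x| = 1 on \<open>U\<close>, where f lives, the transform is invariant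
      under translation by integers. With its bounded support it is a test function on the
      field.\<close>
    show "loc_const 0 UNIV (fourier f)"
    proof (rule loc_constI)
      fix t t' :: 'k assume "t \<in> cb t' 0"
      hence "\<Psi> (x * t) = \<Psi> (x * t')" if "x \<in> U" for x
        using char_mult_cong[of x 0 t t'] U_absk[OF that] by simp
      thus "fourier f t = fourier f t'" unfolding F
        by (intro I_cong) (simp add: mult.commute)
    qed
  qed
  have "J_kernel s f = (\<integral>t. cnj (\<Psi> t) * of_real (\<mu>0 t powr s) * fourier f t \<partial>dt)"
    unfolding J_kernel_def fourier_distribution_def distribution_of_function_def
    using f_test fourier_test by simp
  also have "\<dots> = (\<integral>t. of_real (\<mu>0 t powr s) * g t \<partial>dt)"
    by (simp flip: gF add: mult.commute mult.left_commute)
  also have "\<dots> = (\<integral>t. (\<Sum>k\<le>K. of_real ((q powr s) ^ k) * (indicator (cb 0 (- lev k)) t *\<^sub>R g t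
      - (if k = 0 then 0 else indicator (cb 0 (- lev (k - 1))) t *\<^sub>R g t))) \<partial>dt)"
  proof (rule Bochner_Integration.integral_cong[OF refl])
    fix t
    have "of_real (\<mu>0 t powr s) * g t = of_real (\<mu>0 t powr s * of_bool (absk t \<le> q powi lev K)) * g t"
      using g0[of t] unfolding mem_cb_minus by (cases "absk t \<le> q powi lev K") simp_all
    also have "\<dots> = of_real (\<Sum>k\<le>K. (q powr s) ^ k * (of_bool (absk t \<le> q powi lev k) - (if k = 0 then 0 else of_bool (absk t \<le> q powi lev (k - 1))))) * g t"
      unfolding mu0_powr_telescope ..
    also have "\<dots> = (\<Sum>k\<le>K. of_real ((q powr s) ^ k) * (indicator (cb 0 (- lev k)) t *\<^sub>R g t
      - (if k = 0 then 0 else indicator (cb 0 (- lev (k - 1))) t *\<^sub>R g t)))"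
      unfolding of_real_sum sum_distrib_right
      unfolding indicator_cb_minus of_real_mult
      by (intro sum.cong refl) (simp add: algebra_simps del: of_real_power)
    finally show "of_real (\<mu>0 t powr s) * g t = \<dots>" .
  qed
  also have "\<dots> = (\<Sum>k\<le>K. of_real ((q powr s) ^ k) * ((LINT t:cb 0 (- lev k)|dt. g t)
      - (if k = 0 then 0 else (LINT t:cb 0 (- lev (k - 1))|dt. g t))))"
  proof -
    have int: "integrable dt (\<lambda>t. indicator (cb 0 (- lev k)) t *\<^sub>R g t)" for k
    proof -
      \<comment> \<open>Here |x - 1| <= q^-n gives more than |x| = 1: after division by \<Psi>(t)
        the transform is constant on balls of radius q^n.\<close>
      have "loc_const (- N) (cb 0 (- lev k)) g"
      proof (rule loc_constI)
        fix t t' :: 'k assume "t \<in> cb t' (- N)"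
        hence "\<Psi> ((x - 1) * t) = \<Psi> ((x - 1) * t')" if "x \<in> U" for x
          using U_diff_one[OF that] by (intro char_mult_cong)
        thus "g t = g t'" unfolding g_def by (intro I_cong) simp
      qed
      from integrable_cb[OF this] show ?thesis by (simp add: set_integrable_def)
    qed
    have int2: "integrable dt (\<lambda>t. if k = 0 then 0 else indicator (cb 0 (- lev (k - 1))) t *\<^sub>R g t)" for k
      using int[of "k - 1"] by (cases "k = 0") simp_all
    have "(\<integral>t. of_real ((q powr s) ^ k) * (indicator (cb 0 (- lev k)) t *\<^sub>R g t
      - (if k = 0 then 0 else indicator (cb 0 (- lev (k - 1))) t *\<^sub>R g t)) \<partial>dt)
      = of_real ((q powr s) ^ k) * ((LINT t:cb 0 (- lev k)|dt. g t)
      - (if k = 0 then 0 else (LINT t:cb 0 (- lev (k - 1))|dt. g t)))" for k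
      using Bochner_Integration.integral_diff[OF int[of k] int2[of k]]
      by (cases "k = 0") (simp_all add: set_lebesgue_integral_def)
    thus ?thesis
      by (subst Bochner_Integration.integral_sum) (intro integrable_mult_right Bochner_Integration.integrable_diff int int2, simp)
  qed
  also have "\<dots> = multiplier (q powr s) K f 1"
    unfolding multiplier_def avg_diff_def g_def
  proof (intro sum.cong refl)
    fix k assume "k \<in> {..K}"
    hence "k \<le> K" "k - 1 \<le> K" by auto
    from this[THEN ball_integral_eq_avg[OF f]]
    show "of_real ((q powr s) ^ k) * ((LINT t:cb 0 (- lev k)|dt. I (\<lambda>x. f x * \<Psi> ((x - 1) * t)))
        - (if k = 0 then 0 else (LINT t:cb 0 (- lev (k - 1))|dt. I (\<lambda>x. f x * \<Psi> ((x - 1) * t)))))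
      = of_real ((q powr s) ^ k) * (avg k f 1 - (if k = 0 then 0 else avg (k - 1) f 1))" by metis
  qed
  finally show ?thesis .
qed

section \<open>Functions on \<open>X\<close>\<close>

abbreviation "test_X \<equiv> test_functions X_top"
abbreviation "distr_X \<equiv> distributions X_top"
abbreviation "in_Linf_X \<equiv> in_Linf X_top X_measure"
abbreviation "Linf_norm_X \<equiv> Linf_norm X_top X_measure"
abbreviation "function_distr_X \<equiv> distribution_of_function X_top X_measure"

lemma cls_eq_iff: "cls s = cls t \<longleftrightarrow> s \<in> cb t (- N)"
  unfolding cls_eq_cb using cb_eq mem_cb_self by blast

lemma rep_cls: "rep (cls t) \<in> cb t (- N)"
proof -
  have "t \<in> cls t" by (simp add: cls_eq_cb)
  hence "rep (cls t) \<in> cls t" unfolding rep_def by (rule someI)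
  thus ?thesis by (simp add: cls_eq_cb)
qed

lemma cls_rep: "c \<in> \<Gamma> \<Longrightarrow> cls (rep c) = c"
  unfolding \<Gamma>_def using rep_cls cls_eq_iff by auto

lemma cls_in_Gamma [simp]: "cls t \<in> \<Gamma>"
  by (simp add: \<Gamma>_def)

lemma in_X [simp]: "(u, c) \<in> X \<longleftrightarrow> u \<in> U \<and> c \<in> \<Gamma>"
  by (simp add: X_def)

lemma absk_U_mult: "u \<in> U \<Longrightarrow> absk (u * t) = absk t"
  by (simp add: absk_mult U_absk)

lemma cls_mult_cong: "u \<in> U \<Longrightarrow> s \<in> cb t (- N) \<Longrightarrow> cls (u * s) = cls (u * t)"
  unfolding cls_eq_iff cb_def by (simp add: absk_U_mult flip: right_diff_distrib)

text \<open>The group law uses chosen representatives. As u is a unit, another choice shifts the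
  result by at most q^n in value, which stays within the class.\<close>

lemma X_mult_cls:
  assumes "u \<in> U"
  shows "X_mult (u0, cls t) (u, cls 0) = (u0 * u, cls (inverse u * t))"
proof -
  let ?s = "inverse u * rep (cls t) + rep (cls 0)"
  have "inverse u * rep (cls t) \<in> cb (inverse u * t) (- N)"
    using cls_mult_cong[OF U_inverse[OF assms] rep_cls, of t] by (simp add: cls_eq_iff)
  moreover have "?s \<in> cb (inverse u * rep (cls t)) (- N)" using rep_cls[of 0] by (simp add: cb_def)
  ultimately have "?s \<in> cb (inverse u * t) (- N)" using mem_cb_trans by blast
  thus ?thesis by (simp add: X_mult_def cls_eq_iff)
qed

text \<open>The product \<open>u t\<close> does not change when \<open>(u, [t])\<close> is multiplied by \<open>(v, [0])\<close> from the right, so \<open>J\<^sup>s\<close>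
  acts only on the last variable of the twisted function.\<close>

definition twist :: "('k \<times> 'k set \<Rightarrow> 'b) \<Rightarrow> 'k \<Rightarrow> 'k \<Rightarrow> 'b" where
  "twist f t v = f (v, cls (inverse v * t))"

lemma twist_at: "v \<in> U \<Longrightarrow> f (v, cls t) = twist f (v * t) v"
  by (simp add: twist_def U_nz flip: mult.assoc)

lemma twist_cong: "v \<in> U \<Longrightarrow> s \<in> cb t (- N) \<Longrightarrow> twist f s v = twist f t v"
  unfolding twist_def using cls_mult_cong[OF U_inverse] by simp

text \<open>One number K bounds both the local constancy and the support |t| <= q^(n+K). Constancy
  is demanded of the twisted slices because J acts on them, so that J preserves K.\<close>

definition levelX :: "nat \<Rightarrow> ('k \<times> 'k set \<Rightarrow> complex) \<Rightarrow> bool" where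
  "levelX K f \<longleftrightarrow> (\<forall>x. x \<notin> X \<longrightarrow> f x = 0) \<and> (\<forall>t. lc K (twist f t)) \<and>
     (\<forall>t v. v \<in> U \<longrightarrow> \<not> absk t \<le> q powi lev K \<longrightarrow> twist f t v = 0)"

lemma levelX_outside: "levelX K f \<Longrightarrow> x \<notin> X \<Longrightarrow> f x = 0"
  and levelX_lc: "levelX K f \<Longrightarrow> lc K (twist f t)"
  and levelX_zero: "levelX K f \<Longrightarrow> v \<in> U \<Longrightarrow> \<not> absk t \<le> q powi lev K \<Longrightarrow> twist f t v = 0"
  unfolding levelX_def by blast+

lemma levelX_zero': "levelX K f \<Longrightarrow> v \<in> U \<Longrightarrow> \<not> absk t \<le> q powi lev K \<Longrightarrow> f (v, cls t) = 0"
  using levelX_zero[of K f v "v * t"] by (simp add: twist_at absk_U_mult)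

lemma levelX_mono:
  assumes f: "levelX K f" and K: "K \<le> K'"
  shows "levelX K' f"
  unfolding levelX_def
proof (intro conjI allI impI)
  fix t v :: 'k assume "v \<in> U" "\<not> absk t \<le> q powi lev K'"
  moreover have "q powi lev K \<le> q powi lev K'" unfolding q_powi_le_iff using K by simp
  ultimately show "twist f t v = 0" using levelX_zero[OF f, of v t] by linarith
qed (use levelX_outside[OF f] lc_mono[OF levelX_lc[OF f] K] in auto)

text \<open>In a plain slice the twist parameter u t moves with u. This is harmless once |u - v| |t|
  <= q^n, so the level of the slice depends on the size of t.\<close>

lemma levelX_slice:
  assumes f: "levelX K f" and t: "absk t \<le> q powi m"
  shows "loc_const (max (m - N) (lev K)) U (\<lambda>u. f (u, cls t))"
proof (rule loc_constI)
  fix u v assume uv: "u \<in> U" "v \<in> U" "u \<in> cb v (max (m - N) (lev K))"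
  have "u \<in> cb v (m - N)" using uv(3) cb_mono[of "m - N" "max (m - N) (lev K)" v] by auto
  hence "absk (u - v) * absk t \<le> q powi (- (m - N)) * q powi m"
    using t by (intro mult_mono) (auto simp: cb_def)
  also have "\<dots> = q powi N" using power_int_add[of q "- (m - N)" m] by simp
  finally have "u * t \<in> cb (v * t) (- N)" by (simp add: cb_def absk_mult flip: left_diff_distrib)
  hence "twist f (u * t) u = twist f (v * t) u" by (rule twist_cong[OF uv(1)])
  also have "u \<in> cb v (lev K)" using uv(3) cb_mono[of "lev K" "max (m - N) (lev K)" v] by auto
  hence "twist f (v * t) u = twist f (v * t) v" by (rule loc_constD[OF levelX_lc[OF f] uv(1,2)])
  finally show "f (u, cls t) = f (v, cls t)" using uv(1,2) by (simp add: twist_at)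
qed

text \<open>A finite set of classes that carries every function of level K. The condition depends on
  the class alone, because classes have radius q^n, which is at most q^(n+K).\<close>

definition \<Gamma>K :: "nat \<Rightarrow> 'k set set" where
  "\<Gamma>K K = cls ` cb 0 (- lev K)"

lemma finite_GammaK: "finite (\<Gamma>K K)"
proof -
  obtain R where R: "reps 0 (- lev K) (- N) R" using reps_exist[of "- lev K" "- N"] by auto
  have "\<Gamma>K K \<subseteq> cls ` R"
  proof
    fix c assume "c \<in> \<Gamma>K K"
    then obtain t where t: "t \<in> cb 0 (- lev K)" "c = cls t" unfolding \<Gamma>K_def by (rule imageE)
    obtain r where "r \<in> R" "t \<in> cb r (- N)" using t(1) by (rule reps_cover[OF R])
    thus "c \<in> cls ` R" using t(2) cls_eq_iff[of t r] by blast
  qed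
  thus ?thesis using reps_finite[OF R] finite_surj by blast
qed

lemma GammaK_subset: "\<Gamma>K K \<subseteq> \<Gamma>"
  by (auto simp: \<Gamma>K_def)

lemma cls_in_GammaK_iff: "cls t \<in> \<Gamma>K K \<longleftrightarrow> absk t \<le> q powi lev K"
proof
  assume "cls t \<in> \<Gamma>K K"
  then obtain s where s: "s \<in> cb 0 (- lev K)" "cls t = cls s" unfolding \<Gamma>K_def by (rule imageE)
  have "cb s (- N) \<subseteq> cb 0 (- lev K)" using s(1) by (rule cb_subset) simp
  thus "absk t \<le> q powi lev K" using s(2) unfolding cls_eq_iff mem_cb_minus[symmetric] by blast
next
  assume "absk t \<le> q powi lev K"
  thus "cls t \<in> \<Gamma>K K" unfolding \<Gamma>K_def mem_cb_minus[symmetric] by (rule imageI)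
qed

lemma rep_GammaK: "c \<in> \<Gamma>K K \<Longrightarrow> absk (rep c) \<le> q powi lev K"
  using cls_in_GammaK_iff[of "rep c" K] cls_rep[of c] GammaK_subset[of K] by auto

lemma countable_Gamma: "countable \<Gamma>"
proof -
  have "\<Gamma> = (\<Union>K. \<Gamma>K K)"
  proof (intro equalityI subsetI)
    fix c assume "c \<in> \<Gamma>"
    then obtain t where t: "c = cls t" unfolding \<Gamma>_def by blast
    obtain m where m: "N \<le> m" "absk t \<le> q powi m" using ex_powi_bound by blast
    have "c \<in> \<Gamma>K (nat (m - N))" using m by (simp add: t cls_in_GammaK_iff)
    thus "c \<in> (\<Union>K. \<Gamma>K K)" by blast
  qed (use GammaK_subset in blast)
  thus ?thesis by (metis countable_UN countable_finite finite_GammaK countableI_type)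
qed

section \<open>Test functions on X\<close>

lemma topspace_X_top [simp]: "topspace X_top = X"
  by (simp add: X_top_def X_def)

lemma test_XI:
  assumes out: "\<And>x. x \<notin> X \<Longrightarrow> f x = 0" and lc: "\<And>c. c \<in> \<Gamma> \<Longrightarrow> \<exists>m. loc_const m U (\<lambda>u. f (u, c))"
    and S: "finite S" "S \<subseteq> \<Gamma>" "\<And>u c. u \<in> U \<Longrightarrow> c \<in> \<Gamma> \<Longrightarrow> c \<notin> S \<Longrightarrow> f (u, c) = 0"
  shows "f \<in> test_X"
  unfolding test_functions_def
proof (intro CollectI conjI ballI allI impI)
  fix x assume "x \<in> topspace X_top"
  then obtain u c where x: "x = (u, c)" "u \<in> U" "c \<in> \<Gamma>" by (auto simp: X_def)
  obtain m where lc: "loc_const m U (\<lambda>u. f (u, c))" using lc[OF x(3)] by blast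
  let ?V = "(U \<inter> cb u m) \<times> {c}"
  have "openin X_top ?V"
    unfolding X_top_def openin_prod_Times_iff using openin_U_top_cb x(3) by auto
  moreover have "f y = f x" if "y \<in> ?V" for y
  proof -
    have "fst y \<in> U" "fst y \<in> cb u m" "snd y = c" using that by auto
    from loc_constD[OF lc this(1) x(2) this(2)] have "f (fst y, c) = f (u, c)" .
    moreover have "y = (fst y, c)" using \<open>snd y = c\<close> by (cases y) simp
    ultimately show ?thesis unfolding x(1) by argo
  qed
  moreover have "x \<in> ?V" using x by simp
  ultimately show "\<exists>V. openin X_top V \<and> x \<in> V \<and> (\<forall>y\<in>V. f y = f x)" by blast
next
  have cpt: "compactin X_top (U \<times> S)"
    unfolding X_top_def compactin_Times using compact_space_U_top S(1,2)
    by (auto simp: compact_space_def compactin_discrete_topology)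
  have sub: "{x \<in> topspace X_top. f x \<noteq> 0} \<subseteq> U \<times> S"
    using S(3) by (auto simp: X_def)
  have "closedin X_top (U \<times> S)"
    unfolding X_top_def closedin_prod_Times_iff using S(2) closedin_topspace[of U_top] by auto
  hence "X_top closure_of {x \<in> topspace X_top. f x \<noteq> 0} \<subseteq> U \<times> S"
    by (rule closure_of_minimal[OF sub])
  thus "compactin X_top (X_top closure_of {x \<in> topspace X_top. f x \<noteq> 0})"
    by (rule closed_compactin[OF cpt]) simp
qed (use out in auto)

lemma levelX_slice_ex:
  assumes "levelX K f" "c \<in> \<Gamma>"
  shows "\<exists>m. loc_const m U (\<lambda>u. f (u, c))"
proof -
  obtain t where c: "c = cls t" using assms(2) unfolding \<Gamma>_def by blast
  obtain m where "absk t \<le> q powi m" using ex_powi_bound by blast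
  from levelX_slice[OF assms(1) this] show ?thesis unfolding c by blast
qed

lemma levelX_zero_GammaK:
  assumes "levelX K f" "u \<in> U" "c \<in> \<Gamma>" "c \<notin> \<Gamma>K K"
  shows "f (u, c) = 0"
proof -
  obtain t where c: "c = cls t" using assms(3) unfolding \<Gamma>_def by blast
  show ?thesis using levelX_zero'[OF assms(1,2), of t] assms(4) unfolding c cls_in_GammaK_iff by blast
qed

lemma levelX_test: "levelX K f \<Longrightarrow> f \<in> test_X"
  by (rule test_XI[OF _ _ finite_GammaK GammaK_subset])
    (auto intro: levelX_outside levelX_slice_ex levelX_zero_GammaK)

text \<open>Compact support leaves finitely many classes, and compactness of \<open>U\<close>
  provides a level on each slice. The maximum M also bounds the representatives of these classes, so
  that it limits the support.\<close>

lemma test_levelX: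
  assumes f: "f \<in> test_X"
  obtains K where "levelX K f"
proof -
  have out: "f x = 0" if "x \<notin> X" for x using test_functions_outside[OF f] that by simp
  define S where "S = snd ` (X_top closure_of {x \<in> topspace X_top. f x \<noteq> 0})"
  have "compactin (discrete_topology \<Gamma>) S"
    unfolding S_def using test_functions_compact[OF f] continuous_map_snd unfolding X_top_def
    by (rule image_compactin)
  hence S: "finite S" "S \<subseteq> \<Gamma>" by (auto simp: compactin_discrete_topology)
  have S0: "f (u, c) = 0" if "u \<in> U" "c \<in> \<Gamma>" "c \<notin> S" for u c
  proof (rule ccontr)
    assume "f (u, c) \<noteq> 0"
    hence "(u, c) \<in> {x \<in> topspace X_top. f x \<noteq> 0}" using that by simp
    hence "(u, c) \<in> X_top closure_of {x \<in> topspace X_top. f x \<noteq> 0}"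
      using closure_of_subset[of "{x \<in> topspace X_top. f x \<noteq> 0}" X_top] by auto
    thus False using that(3) unfolding S_def by force
  qed
  have "\<exists>m\<ge>N. loc_const m U (\<lambda>u. f (u, c))" if c: "c \<in> \<Gamma>" for c
  proof (rule uniformly_loc_const)
    fix x assume x: "x \<in> U"
    then obtain V where V: "openin X_top V" "(x, c) \<in> V" "\<And>y. y \<in> V \<Longrightarrow> f y = f (x, c)"
      using test_functions_locally_constant[OF f, of "(x, c)"] c by auto
    then obtain A B where AB: "openin U_top A" "x \<in> A" "c \<in> B" "A \<times> B \<subseteq> V"
      unfolding X_top_def openin_prod_topology_alt by meson
    obtain m where "cb x m \<inter> U \<subseteq> A" using AB(1,2) by (rule openin_U_top_cbE)
    thus "\<exists>m. \<forall>y\<in>cb x m \<inter> U. f (y, c) = f (x, c)" using V(3) AB(3,4) by blast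
  qed
  then obtain \<mu> where \<mu>: "\<And>c. c \<in> \<Gamma> \<Longrightarrow> loc_const (\<mu> c) U (\<lambda>u. f (u, c))" by metis
  have "\<exists>m. N \<le> m \<and> absk (rep c) \<le> q powi m" for c using ex_powi_bound by blast
  then obtain \<nu> where \<nu>: "\<And>c. N \<le> \<nu> c" "\<And>c. absk (rep c) \<le> q powi \<nu> c" by metis
  define M where "M = Max (insert N (\<mu> ` S \<union> \<nu> ` S))"
  have fin: "finite (insert N (\<mu> ` S \<union> \<nu> ` S))" using S(1) by simp
  have M: "N \<le> M" "\<And>c. c \<in> S \<Longrightarrow> \<mu> c \<le> M" "\<And>c. c \<in> S \<Longrightarrow> \<nu> c \<le> M"
    unfolding M_def using fin by (auto intro: Max_ge)
  have M0: "f (v, cls t) = 0" if "v \<in> U" "\<not> absk t \<le> q powi M" for v t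
  proof (rule ccontr)
    assume "f (v, cls t) \<noteq> 0"
    hence c: "cls t \<in> S" using S0 that(1) by force
    have "absk (rep (cls t)) \<le> q powi M" using \<nu>(2)[of "cls t"] M(3)[OF c] q_powi_le_iff order_trans by blast
    hence "cb (rep (cls t)) (- N) \<subseteq> cb 0 (- M)" using M(1) by (intro cb_subset) (simp_all add: mem_cb_minus)
    moreover have "t \<in> cb (rep (cls t)) (- N)" using rep_cls[of t] mem_cb_sym by blast
    ultimately show False using that(2) unfolding mem_cb_minus[symmetric] by blast
  qed
  define K where "K = nat (M - N)"
  have K: "lev K = M" using M(1) by (simp add: K_def)
  have "levelX K f"
    unfolding levelX_def K
  proof (intro conjI allI impI out)
    fix t v :: 'k assume "v \<in> U" "\<not> absk t \<le> q powi M"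
    thus "twist f t v = 0" unfolding twist_def using M0[of v "inverse v * t"] by (simp add: absk_U_mult U_inverse)
  next
    fix t :: 'k
    show "loc_const M U (twist f t)"
    proof (cases "absk t \<le> q powi M")
      case False
      hence "twist f t v = 0" if "v \<in> U" for v
        unfolding twist_def using M0[of v "inverse v * t"] that by (simp add: absk_U_mult U_inverse)
      thus ?thesis unfolding loc_const_def by simp
    next
      case True
      show ?thesis
      proof (rule loc_constI)
        fix u v assume uv: "u \<in> U" "v \<in> U" "u \<in> cb v M"
        have "inverse u \<in> cb (inverse v) M" using uv by (intro U_inverse_congr)
        \<comment> \<open>For |t| <= q^M and u, v in a common ball of level M, the elements t / u
          and t / v lie in one class; both twisted values are therefore taken on the same
          slice.\<close>
        hence "absk (inverse u - inverse v) * absk t \<le> q powi (- M) * q powi M"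
          using True by (intro mult_mono) (auto simp: cb_def)
        also have "\<dots> \<le> q powi N" unfolding power_int_add[OF disjI1[OF q_nz], symmetric] q_powi_le_iff by simp
        finally have eq: "cls (inverse u * t) = cls (inverse v * t)"
          unfolding cls_eq_iff by (simp add: cb_def absk_mult flip: left_diff_distrib)
        let ?c = "cls (inverse v * t)"
        show "twist f t u = twist f t v"
        proof (cases "?c \<in> S")
          case True
          have "u \<in> cb v (\<mu> ?c)" using uv(3) cb_mono[OF M(2)[OF True]] by blast
          hence "f (u, ?c) = f (v, ?c)" by (rule loc_constD[OF \<mu>[OF cls_in_Gamma] uv(1,2)])
          thus ?thesis by (simp add: twist_def eq)
        next
          case False
          thus ?thesis using S0[OF uv(1) cls_in_Gamma False] S0[OF uv(2) cls_in_Gamma False] by (simp add: twist_def eq)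
        qed
      qed
    qed
  qed
  thus ?thesis by (rule that)
qed

section \<open>J on test functions and distributions\<close>

lemma multiplier_translate:
  assumes f: "lc K f" and u: "u \<in> U"
  shows "multiplier a K (\<lambda>x. if x \<in> U then f (u * x) else 0) 1 = multiplier a K f u"
proof -
  have "avg k (\<lambda>x. if x \<in> U then f (u * x) else 0) 1 = avg k f u" for k
  proof -
    have "lc (max k K) (\<lambda>y. of_bool (y \<in> cb u (lev k)) * f y)"
      by (intro lc_mult lc_ball lc_mono[OF f]) auto
    from I_mult_left[OF u this]
    have "I (\<lambda>x. of_bool (u * x \<in> cb u (lev k)) * f (u * x)) = I (\<lambda>y. of_bool (y \<in> cb u (lev k)) * f y)" .
    moreover have "u * x \<in> cb u (lev k) \<longleftrightarrow> x \<in> cb 1 (lev k)" for x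
    proof -
      have "u * x - u = u * (x - 1)" by (simp add: algebra_simps)
      thus ?thesis by (simp add: cb_def absk_U_mult[OF u])
    qed
    ultimately have "I (\<lambda>x. of_bool (x \<in> cb 1 (lev k)) * f (u * x)) = I (\<lambda>y. of_bool (y \<in> cb u (lev k)) * f y)" by simp
    moreover have "I (\<lambda>x. of_bool (x \<in> cb 1 (lev k)) * (if x \<in> U then f (u * x) else 0))
        = I (\<lambda>x. of_bool (x \<in> cb 1 (lev k)) * f (u * x))" by (rule I_cong) simp
    ultimately show ?thesis by (simp add: avg_def)
  qed
  thus ?thesis by (simp add: multiplier_def avg_diff_def cong: if_cong)
qed

text \<open>The kernel is tested on the twisted slice translated by u, and averages commute with
  translations, so evaluation at 1 becomes evaluation at u.\<close>

lemma J_test_eq: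
  assumes f: "levelX K f" and u: "u \<in> U"
  shows "J_test s f (u, cls t) = multiplier (q powr s) K (twist f (u * t)) u"
proof -
  let ?\<phi> = "twist f (u * t)"
  have \<phi>: "lc K ?\<phi>" using f by (rule levelX_lc)
  have "f (X_mult (u, cls t) (x, cls 0)) = ?\<phi> (u * x)" if "x \<in> U" for x
    unfolding X_mult_cls[OF that] twist_def using U_nz[OF u] by (simp add: field_simps)
  hence "(\<lambda>x. if x \<in> U then f (X_mult (u, cls t) (x, cls 0)) else 0) = (\<lambda>x. if x \<in> U then ?\<phi> (u * x) else 0)"
    by auto
  hence "J_test s f (u, cls t) = J_kernel s (\<lambda>x. if x \<in> U then ?\<phi> (u * x) else 0)"
    unfolding J_test_def using u by simp
  also have "\<dots> = multiplier (q powr s) K (\<lambda>x. if x \<in> U then ?\<phi> (u * x) else 0) 1"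
  proof (rule J_kernel_eq)
    show "lc K (\<lambda>x. if x \<in> U then ?\<phi> (u * x) else 0)"
    proof (rule loc_constI)
      fix x y assume xy: "x \<in> U" "y \<in> U" "x \<in> cb y (lev K)"
      have "u * x \<in> cb (u * y) (lev K)" using u xy by (intro U_mult_congr mem_cb_self)
      hence "?\<phi> (u * x) = ?\<phi> (u * y)" by (rule loc_constD[OF \<phi> U_mult[OF u xy(1)] U_mult[OF u xy(2)]])
      thus "(if x \<in> U then ?\<phi> (u * x) else 0) = (if y \<in> U then ?\<phi> (u * y) else 0)" using xy by simp
    qed
  qed simp
  also have "\<dots> = multiplier (q powr s) K ?\<phi> u" by (rule multiplier_translate[OF \<phi> u])
  finally show ?thesis .
qed

lemma twist_J_test: "levelX K f \<Longrightarrow> v \<in> U \<Longrightarrow> twist (J_test s f) t v = multiplier (q powr s) K (twist f t) v"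
  by (simp add: twist_def[of "J_test s f"] J_test_eq U_nz flip: mult.assoc)

lemma levelX_J_test:
  assumes f: "levelX K f"
  shows "levelX K (J_test s f)"
  unfolding levelX_def
proof (intro conjI allI impI)
  fix x assume "x \<notin> X"
  thus "J_test s f x = 0" by (simp add: J_test_def)
next
  fix t :: 'k
  show "lc K (twist (J_test s f) t)"
  proof (rule loc_constI)
    fix u v assume "u \<in> U" "v \<in> U" "u \<in> cb v (lev K)"
    thus "twist (J_test s f) t u = twist (J_test s f) t v"
      using loc_constD[OF multiplier_lc[of K "q powr s" "twist f t"], of u v] by (simp add: twist_J_test[OF f])
  qed
next
  fix t v :: 'k assume v: "v \<in> U" and t: "\<not> absk t \<le> q powi lev K"
  have "multiplier (q powr s) K (twist f t) v = multiplier (q powr s) K (\<lambda>_. 0) v"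
    using levelX_zero[OF f _ t] by (intro multiplier_cong) simp
  also have "\<dots> = 0" by (simp add: multiplier_def avg_diff_def avg_def cong: if_cong)
  finally show "twist (J_test s f) t v = 0" using twist_J_test[OF f v] by simp
qed

lemma X_ext:
  assumes "\<And>x. x \<notin> X \<Longrightarrow> f x = g x" "\<And>u t. u \<in> U \<Longrightarrow> f (u, cls t) = g (u, cls t)"
  shows "f = g"
proof
  fix x show "f x = g x"
  proof (cases "x \<in> X")
    case True
    then obtain u t where "x = (u, cls t)" "u \<in> U" by (auto simp: X_def \<Gamma>_def)
    thus ?thesis using assms(2) by simp
  qed (rule assms(1))
qed

lemma J_test_J_test:
  assumes f: "f \<in> test_X"
  shows "J_test s (J_test s' f) = J_test (s + s') f"
proof (rule X_ext)
  obtain K where K: "levelX K f" using f by (rule test_levelX)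
  fix u t assume u: "u \<in> U"
  have "J_test s (J_test s' f) (u, cls t) = multiplier (q powr s) K (twist (J_test s' f) (u * t)) u"
    by (rule J_test_eq[OF levelX_J_test[OF K] u])
  also have "\<dots> = multiplier (q powr s) K (multiplier (q powr s') K (twist f (u * t))) u"
    by (rule multiplier_cong) (rule twist_J_test[OF K])
  also have "\<dots> = multiplier (q powr s * q powr s') K (twist f (u * t)) u"
    by (rule multiplier_multiplier[OF levelX_lc[OF K] u])
  also have "\<dots> = J_test (s + s') f (u, cls t)" by (simp add: J_test_eq[OF K u] powr_add)
  finally show "J_test s (J_test s' f) (u, cls t) = J_test (s + s') f (u, cls t)" .
qed (simp add: J_test_def)

lemma J_test_0:
  assumes f: "f \<in> test_X"
  shows "J_test 0 f = f"
proof (rule X_ext)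
  obtain K where K: "levelX K f" using f by (rule test_levelX)
  show "J_test 0 f x = f x" if "x \<notin> X" for x using that levelX_outside[OF K that] by (simp add: J_test_def)
  fix u t assume u: "u \<in> U"
  show "J_test 0 f (u, cls t) = f (u, cls t)"
    by (simp add: J_test_eq[OF K u] multiplier_one[OF levelX_lc[OF K] u] twist_at[OF u, of f])
qed

lemma J_test_test: "f \<in> test_X \<Longrightarrow> J_test s f \<in> test_X"
  using test_levelX levelX_J_test levelX_test by metis

lemma J_test_add:
  assumes f: "f \<in> test_X" and g: "g \<in> test_X"
  shows "J_test s (f + g) = J_test s f + J_test s g"
proof (rule X_ext)
  obtain K1 where "levelX K1 f" using f by (rule test_levelX)
  hence Kf: "levelX (max K1 K) f" for K by (rule levelX_mono) simp
  obtain K2 where "levelX K2 g" using g by (rule test_levelX)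
  hence Kg: "levelX (max K K2) g" for K by (rule levelX_mono) simp
  let ?K = "max K1 K2"
  have twist: "twist (f + g) t = (\<lambda>x. twist f t x + twist g t x)" for t by (simp add: twist_def fun_eq_iff)
  have "levelX ?K (f + g)"
    unfolding levelX_def twist
    using levelX_outside[OF Kf[of K2]] levelX_outside[OF Kg[of K1]] levelX_zero[OF Kf[of K2]] levelX_zero[OF Kg[of K1]]
      lc_add[OF levelX_lc[OF Kf[of K2]] levelX_lc[OF Kg[of K1]]] by simp
  note eq = J_test_eq[OF this] J_test_eq[OF Kf[of K2]] J_test_eq[OF Kg[of K1]]
  show "J_test s (f + g) (u, cls t) = (J_test s f + J_test s g) (u, cls t)" if "u \<in> U" for u t
    by (simp add: eq[OF that] twist multiplier_add[OF levelX_lc[OF Kf[of K2]] levelX_lc[OF Kg[of K1]]])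
qed (simp add: J_test_def)

lemma J_test_scale:
  assumes f: "f \<in> test_X"
  shows "J_test s (c *\<^sub>c f) = c *\<^sub>c J_test s f"
proof (rule X_ext)
  obtain K where K: "levelX K f" using f by (rule test_levelX)
  have twist: "twist (c *\<^sub>c f) t = (\<lambda>x. c * twist f t x)" for t
    by (simp add: twist_def fun_eq_iff cscale_fun_def cscale_complex_def)
  have "levelX K (c *\<^sub>c f)"
    unfolding levelX_def twist
    using levelX_outside[OF K] levelX_zero[OF K] lc_mult[OF lc_const levelX_lc[OF K]]
    by (simp add: cscale_fun_def cscale_complex_def)
  note eq = J_test_eq[OF this] J_test_eq[OF K]
  show "J_test s (c *\<^sub>c f) (u, cls t) = (c *\<^sub>c J_test s f) (u, cls t)" if "u \<in> U" for u t
    unfolding eq(1)[OF that] twist multiplier_scale[OF levelX_lc[OF K]] cscale_fun_def[of c "J_test s f"] eq(2)[OF that] cscale_complex_def ..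
qed (simp add: J_test_def cscale_fun_def cscale_complex_def)

lemma J_distribution:
  assumes F: "F \<in> distr_X"
  shows "J s F \<in> distr_X"
proof (rule distributionsI)
  show "clinear_on test_X (J s F)"
    using clinear_on_add[OF distributions_linear[OF F]] clinear_on_scale[OF distributions_linear[OF F]]
    unfolding clinear_on_def J_def
    by (simp add: test_functions_add test_functions_scale J_test_add J_test_scale J_test_test)
qed (simp add: J_def)

lemma J_apply: "f \<in> test_X \<Longrightarrow> J s F f = F (J_test s f)"
  by (simp add: J_def)

lemma J_J: "J s (J s' F) = J (s' + s) F"
  unfolding fun_eq_iff J_def by (simp add: J_test_test J_test_J_test)

section \<open>Integration over X\<close>

lemma X_measurableI:
  fixes f :: "'k \<times> 'k set \<Rightarrow> 'b::topological_space"
  assumes "\<And>c. c \<in> \<Gamma> \<Longrightarrow> (\<lambda>u. f (u, c)) \<in> borel_measurable U_measure"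
  shows "f \<in> borel_measurable X_measure"
proof -
  have "(\<lambda>x. (\<lambda>c x. f (fst x, c)) (snd x) x) \<in> borel_measurable X_measure"
  proof (rule measurable_compose_countable'[where g = snd and I = \<Gamma>])
    fix c assume "c \<in> \<Gamma>"
    show "(\<lambda>x. f (fst x, c)) \<in> borel_measurable X_measure"
      unfolding X_measure_def by (rule measurable_compose[OF measurable_fst assms[OF \<open>c \<in> \<Gamma>\<close>]])
  qed (simp_all add: X_measure_def countable_Gamma)
  thus ?thesis by simp
qed

lemma X_integral:
  fixes f :: "'k \<times> 'k set \<Rightarrow> 'b::{banach, second_countable_topology}"
  assumes int: "\<And>c. c \<in> \<Gamma> \<Longrightarrow> integrable U_measure (\<lambda>u. f (u, c))"
    and S: "finite S" "S \<subseteq> \<Gamma>" "\<And>u c. u \<in> U \<Longrightarrow> c \<in> \<Gamma> \<Longrightarrow> c \<notin> S \<Longrightarrow> f (u, c) = 0"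
  shows "integrable X_measure f" "integral\<^sup>L X_measure f = (\<Sum>c\<in>S. I (\<lambda>u. f (u, c)))"
proof -
  interpret F: finite_measure U_measure by simp
  interpret G: sigma_finite_measure "count_space \<Gamma>"
    by (rule sigma_finite_measure_count_space_countable[OF countable_Gamma])
  interpret P: pair_sigma_finite U_measure "count_space \<Gamma>" ..
  have meas: "f \<in> borel_measurable (U_measure \<Otimes>\<^sub>M count_space \<Gamma>)"
    using X_measurableI[of f] borel_measurable_integrable[OF int] by (simp add: X_measure_def)
  have "integrable (U_measure \<Otimes>\<^sub>M count_space \<Gamma>) f"
  proof (rule P.Fubini_integrable[OF meas])
    have "integrable U_measure (\<lambda>u. \<Sum>c\<in>S. norm (f (u, c)))"
      using int S(2) by (intro Bochner_Integration.integrable_sum integrable_norm) auto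
    moreover have "(\<Sum>c\<in>S. norm (f (u, c))) = (\<integral>c. norm (f (u, c)) \<partial>count_space \<Gamma>)" if "u \<in> U" for u
      using S that by (intro integral_count_space_finite_support[symmetric]) auto
    ultimately show "integrable U_measure (\<lambda>u. \<integral>c. norm (f (u, c)) \<partial>count_space \<Gamma>)"
      by (subst (asm) Bochner_Integration.integrable_cong) auto
    show "AE u in U_measure. integrable (count_space \<Gamma>) (\<lambda>c. f (u, c))"
      using S by (intro AE_I2 integrable_count_space_finite_support[of S]) auto
  qed
  thus "integrable X_measure f" by (simp add: X_measure_def)
  have "integral\<^sup>L X_measure f = (\<integral>c. I (\<lambda>u. f (u, c)) \<partial>count_space \<Gamma>)"
    unfolding X_measure_def
    using P.integral_snd[of "\<lambda>u c. f (u, c)"] \<open>integrable (U_measure \<Otimes>\<^sub>M count_space \<Gamma>) f\<close> by simp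
  also have "\<dots> = (\<Sum>c\<in>S. I (\<lambda>u. f (u, c)))"
  proof (rule integral_count_space_finite_support[OF S(1,2)])
    fix c assume "c \<in> \<Gamma>" "c \<notin> S"
    hence "I (\<lambda>u. f (u, c)) = I (\<lambda>u. 0)" using S(3) by (intro I_cong) auto
    thus "I (\<lambda>u. f (u, c)) = 0" by simp
  qed
  finally show "integral\<^sup>L X_measure f = (\<Sum>c\<in>S. I (\<lambda>u. f (u, c)))" .
qed

definition L1_X :: "('k \<times> 'k set \<Rightarrow> complex) \<Rightarrow> real" where
  "L1_X f = (\<integral>x. cmod (f x) \<partial>X_measure)"

lemma levelX_slice_integrable: "levelX K f \<Longrightarrow> c \<in> \<Gamma> \<Longrightarrow> integrable U_measure (\<lambda>u. f (u, c))"
  using levelX_slice_ex I_integrable by blast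

lemma test_X_integrable: "f \<in> test_X \<Longrightarrow> integrable X_measure f"
proof -
  assume "f \<in> test_X"
  then obtain K where K: "levelX K f" by (rule test_levelX)
  show ?thesis
    using levelX_slice_integrable[OF K] finite_GammaK GammaK_subset levelX_zero_GammaK[OF K] by (rule X_integral(1))
qed

lemma L1_X_eq:
  assumes "levelX K f"
  shows "L1_X f = (\<Sum>c\<in>\<Gamma>K K. I (\<lambda>u. cmod (f (u, c))))"
  unfolding L1_X_def using levelX_slice_integrable[OF assms] levelX_zero_GammaK[OF assms]
  by (intro X_integral(2) finite_GammaK GammaK_subset) auto

lemma bij_betw_GammaK:
  assumes u: "u \<in> U"
  shows "bij_betw (\<lambda>c. cls (u * rep c)) (\<Gamma>K K) (\<Gamma>K K)"
proof -
  have into: "cls (v * rep c) \<in> \<Gamma>K K" if "v \<in> U" "c \<in> \<Gamma>K K" for v c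
    using rep_GammaK[OF that(2)] that(1) by (simp add: cls_in_GammaK_iff absk_U_mult)
  have inv: "cls (inverse v * rep (cls (v * rep c))) = c" if v: "v \<in> U" and c: "c \<in> \<Gamma>K K" for v c
  proof -
    have "cls (inverse v * rep (cls (v * rep c))) = cls (inverse v * (v * rep c))"
      by (rule cls_mult_cong[OF U_inverse[OF v] rep_cls])
    also have "inverse v * (v * rep c) = rep c" using U_nz[OF v] by simp
    finally show ?thesis using cls_rep c GammaK_subset by auto
  qed
  show ?thesis
  proof (rule bij_betw_byWitness[where f' = "\<lambda>c. cls (inverse u * rep c)"])
    show "\<forall>c\<in>\<Gamma>K K. cls (inverse u * rep (cls (u * rep c))) = c" using inv[OF u] by blast
    show "\<forall>c\<in>\<Gamma>K K. cls (u * rep (cls (inverse u * rep c))) = c" using inv[OF U_inverse[OF u]] by simp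
    show "(\<lambda>c. cls (u * rep c)) ` \<Gamma>K K \<subseteq> \<Gamma>K K" using into[OF u] by blast
    show "(\<lambda>c. cls (inverse u * rep c)) ` \<Gamma>K K \<subseteq> \<Gamma>K K" using into[OF U_inverse[OF u]] by blast
  qed
qed

text \<open>For each fixed u the twist permutes the finitely many classes in
  \<open>\<Gamma>K K\<close>. The L1 norm can therefore be computed from twisted slices, on which J
  is a multiplier in one variable.\<close>

lemma L1_X_eq_twist:
  assumes f: "levelX K f"
  shows "L1_X f = (\<Sum>c\<in>\<Gamma>K K. I (\<lambda>u. cmod (twist f (rep c) u)))"
proof -
  have "(\<Sum>c\<in>\<Gamma>K K. I (\<lambda>u. cmod (f (u, c)))) = I (\<lambda>u. \<Sum>c\<in>\<Gamma>K K. cmod (f (u, c)))"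
    using levelX_slice_integrable[OF f] GammaK_subset
    by (intro Bochner_Integration.integral_sum[symmetric] integrable_norm) auto
  also have "\<dots> = I (\<lambda>u. \<Sum>c\<in>\<Gamma>K K. cmod (twist f (rep c) u))"
  proof (rule I_cong)
    fix u assume "u \<in> U"
    from sum.reindex_bij_betw[OF bij_betw_GammaK[OF U_inverse[OF this]], of "\<lambda>c. cmod (f (u, c))" K]
    show "(\<Sum>c\<in>\<Gamma>K K. cmod (f (u, c))) = (\<Sum>c\<in>\<Gamma>K K. cmod (twist f (rep c) u))" by (simp add: twist_def)
  qed
  also have "\<dots> = (\<Sum>c\<in>\<Gamma>K K. I (\<lambda>u. cmod (twist f (rep c) u)))"
    by (intro Bochner_Integration.integral_sum I_integrable[OF lc_comp[OF levelX_lc[OF f]]])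
  finally show ?thesis using L1_X_eq[OF f] by simp
qed

lemma L1_X_J_test_le:
  assumes f: "f \<in> test_X" and s: "s \<le> 0"
  shows "L1_X (J_test s f) \<le> L1_X f"
proof -
  obtain K where K: "levelX K f" using f by (rule test_levelX)
  have a: "q powr s \<le> 1" using s powr_mono[of s 0 q] q_gt_1 by simp
  have "I (\<lambda>u. cmod (twist (J_test s f) t u)) \<le> I (\<lambda>u. cmod (twist f t u))" for t
  proof -
    have "I (\<lambda>u. cmod (twist (J_test s f) t u)) = I (\<lambda>u. cmod (multiplier (q powr s) K (twist f t) u))"
      by (intro I_cong) (simp add: twist_J_test[OF K])
    also have "\<dots> \<le> I (\<lambda>u. cmod (twist f t u))"
      by (rule multiplier_contraction[OF levelX_lc[OF K] _ a]) simp
    finally show ?thesis .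
  qed
  thus ?thesis unfolding L1_X_eq_twist[OF K] L1_X_eq_twist[OF levelX_J_test[OF K]] by (intro sum_mono)
qed

section \<open>Duality between L1 and L-infinity on X\<close>

lemma Linf_apply_le:
  assumes h: "h \<in> borel_measurable X_measure" "AE x in X_measure. cmod (h x) \<le> C"
    and T: "T = function_distr_X h" and f: "f \<in> test_X"
  shows "cmod (T f) \<le> C * L1_X f"
proof -
  have int: "integrable X_measure (\<lambda>x. C * cmod (f x))" using test_X_integrable[OF f] by simp
  have le: "AE x in X_measure. cmod (h x * f x) \<le> C * cmod (f x)"
    using h(2) by eventually_elim (simp add: norm_mult mult_right_mono)
  have int2: "integrable X_measure (\<lambda>x. h x * f x)"
  proof (rule Bochner_Integration.integrable_bound[OF int])
    show "(\<lambda>x. h x * f x) \<in> borel_measurable X_measure"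
      using h(1) borel_measurable_integrable[OF test_X_integrable[OF f]] by simp
    show "AE x in X_measure. norm (h x * f x) \<le> norm (C * cmod (f x))"
      using le by eventually_elim (metis order_trans abs_ge_self real_norm_def)
  qed
  have "cmod (T f) \<le> (\<integral>x. cmod (h x * f x) \<partial>X_measure)"
    unfolding T distribution_of_function_def using f by (simp add: integral_norm_bound)
  also have "\<dots> \<le> (\<integral>x. C * cmod (f x) \<partial>X_measure)"
    by (rule integral_mono_AE) (use int int2 le in auto)
  finally show ?thesis by (simp add: L1_X_def)
qed

definition slice_embed :: "'k set \<Rightarrow> ('k \<Rightarrow> complex) \<Rightarrow> 'k \<times> 'k set \<Rightarrow> complex" where
  "slice_embed c f x = (if snd x = c then f (fst x) else 0)"

lemma slice_embed_test:
  assumes f: "f \<in> test_U" and c: "c \<in> \<Gamma>"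
  shows "slice_embed c f \<in> test_X"
proof (rule test_XI[of _ "{c}"])
  show "slice_embed c f x = 0" if "x \<notin> X" for x
    using that test_U_outside[OF f, of "fst x"] c by (cases x) (auto simp: slice_embed_def)
  obtain m where m: "loc_const m U f" using f by (rule test_U_loc_const)
  show "\<exists>m. loc_const m U (\<lambda>u. slice_embed c f (u, c'))" for c'
  proof (cases "c' = c")
    case True
    thus ?thesis using m by (auto simp: slice_embed_def)
  next
    case False
    hence "(\<lambda>u. slice_embed c f (u, c')) = (\<lambda>u. 0)" by (simp add: slice_embed_def)
    thus ?thesis unfolding loc_const_def by metis
  qed
qed (use c in \<open>auto simp: slice_embed_def\<close>)

lemma L1_X_slice_embed:
  assumes f: "f \<in> test_U" and c: "c \<in> \<Gamma>"
  shows "L1_X (slice_embed c f) = I (\<lambda>u. cmod (f u))"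
proof -
  obtain m where m: "loc_const m U f" using f by (rule test_U_loc_const)
  have "integrable U_measure f" using m by (rule I_integrable)
  hence "integrable U_measure (\<lambda>u. cmod (slice_embed c f (u, c')))" for c'
    by (cases "c' = c") (simp_all add: slice_embed_def)
  hence "L1_X (slice_embed c f) = (\<Sum>c'\<in>{c}. I (\<lambda>u. cmod (slice_embed c f (u, c'))))"
    unfolding L1_X_def using c by (intro X_integral(2)) (auto simp: slice_embed_def)
  thus ?thesis by (simp add: slice_embed_def)
qed

text \<open>The direction of duality that produces a function. On each slice the L1 bound implies an
  L2 bound because \<open>U\<close> has finite volume, so the Riesz theorem applies; its pointwise
  bound restores C, and the slices are glued over the countable \<open>\<Gamma>\<close>.\<close>

lemma bounded_distribution_in_Linf:
  assumes T: "T \<in> distr_X" and C: "0 \<le> C"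
    and bound: "\<And>f. f \<in> test_X \<Longrightarrow> cmod (T f) \<le> C * L1_X f"
  obtains h where "h \<in> borel_measurable X_measure" "\<And>x. cmod (h x) \<le> C"
    "T = function_distr_X h"
proof -
  note lin = distributions_linear[OF T]
  have lin_c: "clinear_on test_U (\<lambda>\<phi>. T (slice_embed c \<phi>))" if c: "c \<in> \<Gamma>" for c
    unfolding clinear_on_def
  proof (intro conjI ballI allI)
    fix f g assume fg: "f \<in> test_U" "g \<in> test_U"
    have "slice_embed c (f + g) = slice_embed c f + slice_embed c g" by (simp add: slice_embed_def fun_eq_iff)
    thus "T (slice_embed c (f + g)) = T (slice_embed c f) + T (slice_embed c g)"
      using clinear_on_add[OF lin slice_embed_test[OF fg(1) c] slice_embed_test[OF fg(2) c]] by argo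
  next
    fix a f assume f: "f \<in> test_U"
    have "slice_embed c (a *\<^sub>c f) = a *\<^sub>c slice_embed c f"
      by (simp add: slice_embed_def fun_eq_iff cscale_fun_def cscale_complex_def)
    thus "T (slice_embed c (a *\<^sub>c f)) = a *\<^sub>c T (slice_embed c f)"
      using clinear_on_scale[OF lin slice_embed_test[OF f c]] by metis
  qed
  have bound1: "cmod (T (slice_embed c \<phi>)) \<le> C * I (\<lambda>u. cmod (\<phi> u))" if "c \<in> \<Gamma>" "\<phi> \<in> test_U" for c \<phi>
    using bound[OF slice_embed_test[OF that(2,1)]] L1_X_slice_embed[OF that(2,1)] by simp
  define V where "V = sqrt (measure U_measure (space U_measure))"
  have bound2: "cmod (T (slice_embed c \<phi>)) \<le> (C * V) * norm2 \<phi>" if "c \<in> \<Gamma>" "\<phi> \<in> test_U" for c \<phi>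
    using bound1[OF that] mult_left_mono[OF L1_le_L2[OF finite_U test_U_L2[OF that(2)]] C]
    unfolding V_def by (simp add: mult.assoc)
  have "\<exists>h. h \<in> L2U \<and> (\<forall>\<phi>\<in>test_U. T (slice_embed c \<phi>) = I (\<lambda>x. h x * \<phi> x)) \<and> (AE x in U_measure. cmod (h x) \<le> C)"
    if c: "c \<in> \<Gamma>" for c
  proof -
    obtain h hs where "h \<in> L2U" "\<And>\<phi>. \<phi> \<in> test_U \<Longrightarrow> T (slice_embed c \<phi>) = I (\<lambda>x. h x * \<phi> x)"
      "\<And>D. (\<And>\<phi>. \<phi> \<in> test_U \<Longrightarrow> cmod (T (slice_embed c \<phi>)) \<le> D * I (\<lambda>x. cmod (\<phi> x))) \<Longrightarrow> AE x in U_measure. cmod (h x) \<le> D"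
      by (rule Riesz_representation[OF lin_c[OF c] bound2[OF c]]) (use C in \<open>auto simp: V_def\<close>)
    thus ?thesis using bound1[OF c] by blast
  qed
  then obtain H where H: "\<And>c. c \<in> \<Gamma> \<Longrightarrow> H c \<in> L2U \<and> (\<forall>\<phi>\<in>test_U. T (slice_embed c \<phi>) = I (\<lambda>x. H c x * \<phi> x)) \<and>
    (AE x in U_measure. cmod (H c x) \<le> C)" by metis
  \<comment> \<open>On each slice the values exceeding C form a null set. They are replaced by 0 so
    that the bound holds at every point.\<close>
  define h where "h x = (if cmod (H (snd x) (fst x)) \<le> C then H (snd x) (fst x) else 0)" for x
  have H_meas: "H c \<in> borel_measurable U_measure" if "c \<in> \<Gamma>" for c
    using H[OF that] L2_borel by blast
  have h_meas: "(\<lambda>u. h (u, c)) \<in> borel_measurable U_measure" if "c \<in> \<Gamma>" for c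
    unfolding h_def fst_conv snd_conv using H_meas[OF that] by simp
  have h_AE: "AE u in U_measure. h (u, c) = H c u" if "c \<in> \<Gamma>" for c
  proof -
    have "AE u in U_measure. cmod (H c u) \<le> C" using H[OF that] by blast
    thus ?thesis by eventually_elim (simp add: h_def)
  qed
  have hC: "cmod (h x) \<le> C" for x using C by (simp add: h_def)
  have T_eq: "T f = (\<integral>x. h x * f x \<partial>X_measure)" if f: "f \<in> test_X" for f
  proof -
    obtain K where K: "levelX K f" using f by (rule test_levelX)
    define fc where "fc c = (\<lambda>u. f (u, c))" for c
    have fc: "fc c \<in> test_U" if c: "c \<in> \<Gamma>" for c
    proof -
      obtain m where "loc_const m U (fc c)" using levelX_slice_ex[OF K c] unfolding fc_def by blast
      thus ?thesis by (rule loc_const_test_U) (use levelX_outside[OF K] in \<open>simp add: fc_def\<close>)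
    qed
    have "f = (\<Sum>c\<in>\<Gamma>K K. slice_embed c (fc c))"
    proof
      fix x
      have "(\<Sum>c\<in>\<Gamma>K K. slice_embed c (fc c)) x = (\<Sum>c\<in>\<Gamma>K K. if c = snd x then f x else 0)"
        by (simp add: fun_sum_apply slice_embed_def fc_def) (intro sum.cong, auto)
      also have "\<dots> = (if snd x \<in> \<Gamma>K K then f x else 0)" using finite_GammaK by simp
      also have "\<dots> = f x"
        using levelX_zero_GammaK[OF K, of "fst x" "snd x"] levelX_outside[OF K, of x] by (cases x) auto
      finally show "f x = (\<Sum>c\<in>\<Gamma>K K. slice_embed c (fc c)) x" by simp
    qed
    hence "T f = (\<Sum>c\<in>\<Gamma>K K. T (slice_embed c (fc c)))"
      using clinear_on_test_sum[OF lin finite_GammaK, of K "\<lambda>c. slice_embed c (fc c)"] slice_embed_test[OF fc] GammaK_subset by auto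
    also have "\<dots> = (\<Sum>c\<in>\<Gamma>K K. I (\<lambda>u. h (u, c) * f (u, c)))"
    proof (rule sum.cong[OF refl])
      fix c assume "c \<in> \<Gamma>K K"
      hence c: "c \<in> \<Gamma>" using GammaK_subset by blast
      have "T (slice_embed c (fc c)) = I (\<lambda>u. H c u * fc c u)" using H[OF c] fc[OF c] by blast
      also have "\<dots> = I (\<lambda>u. h (u, c) * fc c u)"
      proof (rule integral_cong_AE)
        show "AE u in U_measure. H c u * fc c u = h (u, c) * fc c u" using h_AE[OF c] by eventually_elim simp
      qed (use H_meas[OF c] h_meas[OF c] L2_borel[OF test_U_L2[OF fc[OF c]]] in auto)
      finally show "T (slice_embed c (fc c)) = I (\<lambda>u. h (u, c) * f (u, c))" by (simp add: fc_def)
    qed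
    also have "\<dots> = (\<integral>x. h x * f x \<partial>X_measure)"
    proof (rule X_integral(2)[symmetric, OF _ finite_GammaK GammaK_subset])
      fix c assume c: "c \<in> \<Gamma>"
      have "(\<lambda>u. h (u, c)) \<in> L2U"
        by (rule bounded_in_L2[OF finite_U h_meas[OF c]]) (rule hC)
      from L2_mult_integrable[OF this test_U_L2[OF fc[OF c]]]
      show "integrable U_measure (\<lambda>u. h (u, c) * f (u, c))" by (simp add: fc_def)
    qed (use levelX_zero_GammaK[OF K] in simp)
    finally show ?thesis .
  qed
  show ?thesis
  proof (rule that[of h])
    show "h \<in> borel_measurable X_measure" by (rule X_measurableI) (rule h_meas)
    show "T = function_distr_X h"
      unfolding distribution_of_function_def fun_eq_iff using T_eq distributions_outside[OF T] by simp
  qed (rule hC)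
qed

lemma Linf_norm_le:
  assumes "h \<in> borel_measurable X_measure" "AE x in X_measure. cmod (h x) \<le> C" "0 \<le> C"
    "T = function_distr_X h"
  shows "Linf_norm_X T \<le> C"
  unfolding Linf_norm_def using assms by (intro cInf_lower bdd_belowI[of _ 0]) auto

text \<open>Every admissible constant bounds |T f| divided by the L1 norm of f, and this passes to
  the infimum; functions of L1 norm 0 are treated apart, and any one admissible constant settles
  them.\<close>

lemma in_Linf_apply_le:
  assumes T: "in_Linf_X T" and f: "f \<in> test_X"
  shows "cmod (T f) \<le> Linf_norm_X T * L1_X f" and "0 \<le> Linf_norm_X T"
proof -
  let ?A = "{C. 0 \<le> C \<and> (\<exists>f. f \<in> borel_measurable X_measure \<and>
     (AE x in X_measure. cmod (f x) \<le> C) \<and> T = function_distr_X f)}"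
  obtain h C where h: "h \<in> borel_measurable X_measure" "AE x in X_measure. cmod (h x) \<le> C"
    "T = function_distr_X h" using T unfolding in_Linf_def by blast
  have "AE x in X_measure. cmod (h x) \<le> \<bar>C\<bar>" using h(2) by eventually_elim simp
  hence ne: "?A \<noteq> {}" using h by (auto intro!: exI[of _ "\<bar>C\<bar>"])
  show nonneg: "0 \<le> Linf_norm_X T"
    unfolding Linf_norm_def using ne by (intro cInf_greatest) auto
  have L1_X: "0 \<le> L1_X f" unfolding L1_X_def by simp
  show "cmod (T f) \<le> Linf_norm_X T * L1_X f"
  proof (cases "L1_X f = 0")
    case True
    thus ?thesis using Linf_apply_le[OF h f] by simp
  next
    case False
    hence pos: "0 < L1_X f" using L1_X by simp
    have "cmod (T f) / L1_X f \<le> Linf_norm_X T"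
      unfolding Linf_norm_def
    proof (rule cInf_greatest[OF ne])
      fix C assume "C \<in> ?A"
      then obtain g where "g \<in> borel_measurable X_measure" "AE x in X_measure. cmod (g x) \<le> C"
        "T = function_distr_X g" by blast
      from Linf_apply_le[OF this f] show "cmod (T f) / L1_X f \<le> C" using pos by (simp add: field_simps)
    qed
    thus ?thesis using pos by (simp add: field_simps)
  qed
qed

text \<open>J^s F evaluates J^s' F on test functions transformed by J^(s - s'), which contracts L1.
  The bound by the L1 norm thus passes from s' to s, and duality turns it back into a function. This
  is how natural exponents yield all real ones.\<close>

lemma in_Linf_J_mono:
  assumes F: "F \<in> distr_X" and s: "s \<le> s'" and L: "in_Linf_X (J s' F)"
  shows "in_Linf_X (J s F)"
    and "Linf_norm_X (J s F) \<le> Linf_norm_X (J s' F)"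
proof -
  let ?C = "Linf_norm_X (J s' F)"
  have C: "0 \<le> ?C" using in_Linf_apply_le(2)[OF L test_functions_zero] .
  have bound: "cmod (J s F f) \<le> ?C * L1_X f" if f: "f \<in> test_X" for f
  proof -
    have "J s F f = J s' F (J_test (s - s') f)"
      using J_J[of "s - s'" s' F] J_apply[OF f, of "s - s'" "J s' F"] by simp
    also have "cmod \<dots> \<le> ?C * L1_X (J_test (s - s') f)"
      by (rule in_Linf_apply_le(1)[OF L J_test_test[OF f]])
    also have "\<dots> \<le> ?C * L1_X f" using L1_X_J_test_le[OF f] s C by (intro mult_left_mono) auto
    finally show ?thesis .
  qed
  have "\<exists>h. h \<in> borel_measurable X_measure \<and> (\<forall>x. cmod (h x) \<le> ?C) \<and>
    J s F = function_distr_X h"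
    by (rule bounded_distribution_in_Linf[OF J_distribution[OF F] C bound]) blast+
  then obtain h where h: "h \<in> borel_measurable X_measure" "\<And>x. cmod (h x) \<le> ?C"
    "J s F = function_distr_X h" by blast
  thus "in_Linf_X (J s F)" unfolding in_Linf_def by (auto intro!: exI[of _ h] exI[of _ ?C])
  show "Linf_norm_X (J s F) \<le> ?C"
    by (rule Linf_norm_le[OF h(1) _ C h(3)]) (simp add: h(2))
qed

section \<open>Wigner functions\<close>

text \<open>The conjugation cancels the one in the inner product, so \<open>Wig\<close> is
  bilinear.\<close>

abbreviation "Wig a b \<equiv> W (\<lambda>x. cnj (a x)) b"

text \<open>u + v differs from 2 by an element of value at most q^-n < 1, and |2| = 1.\<close>

lemma absk_U_add:
  assumes "u \<in> U" "v \<in> U"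
  shows "absk (u + v) = 1"
proof -
  have "absk ((u - 1) + (v - 1)) \<le> q powi (- N)"
    using assms U_diff_one by (intro absk_add_le) auto
  also have "\<dots> < q powi 0" unfolding q_powi_less_iff using n_pos by simp
  finally have "absk ((u - 1) + (v - 1)) < absk (2::'k)" by (simp add: absk_2)
  from absk_add_eq[OF this] show ?thesis by (simp add: absk_2 algebra_simps)
qed

lemma absk_square_diff: "u \<in> U \<Longrightarrow> v \<in> U \<Longrightarrow> absk (u * u - v * v) = absk (u - v)"
  using absk_mult[of "u - v" "u + v"] absk_U_add[of u v] by (simp add: algebra_simps)

text \<open>The difference factors as (u - v)(1 + 1/(u v)), where the second factor is a sum of two
  elements of \<open>U\<close> and so has value 1.\<close>

lemma phi_diff:
  assumes "u \<in> U" "v \<in> U"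
  shows "absk (\<phi> u - \<phi> v) = absk (u - v)"
proof -
  have "\<phi> u - \<phi> v = (u - v) * (1 + inverse u * inverse v)"
    using assms[THEN U_nz] by (simp add: \<phi>_def field_simps)
  moreover have "absk (1 + inverse u * inverse v) = 1"
    using assms by (intro absk_U_add U_intros)
  ultimately show ?thesis by (simp add: absk_mult)
qed

lemma phi_small: "u \<in> U \<Longrightarrow> absk (\<phi> u) \<le> q powi (- N)"
  using phi_diff[of u 1] U_diff_one[of u] by (simp add: \<phi>_def)

text \<open>\<theta> times a value of \<open>\<phi>\<close> is at most q^-n, so the phase depends on
  the class of t only, and the chosen representative can be exchanged for t.\<close>

lemma W_eq:
  assumes u: "u \<in> U"
  shows "Wig a b (u, cls t) = I (\<lambda>x. a x * (b (u * u * inverse x) * \<Psi> (\<theta> * t * \<phi> (u * inverse x))))"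
proof -
  have "Wig a b (u, cls t) = I (\<lambda>x. a x * (\<Psi> (\<theta> * (\<phi> (u * inverse x) * rep (cls t))) * b (u\<^sup>2 * inverse x)))"
    using u by (simp add: W_def L2_inner_def \<Omega>_def)
  also have "\<dots> = I (\<lambda>x. a x * (b (u * u * inverse x) * \<Psi> (\<theta> * t * \<phi> (u * inverse x))))"
  proof (rule I_cong)
    fix x assume "x \<in> U"
    hence "absk (\<theta> * \<phi> (u * inverse x)) \<le> q powi (- N)"
      using phi_small[OF U_mult[OF u U_inverse]] by (simp add: absk_mult absk_theta)
    from char_mult_cong[OF this rep_cls[of t]]
    have "\<Psi> (\<theta> * (\<phi> (u * inverse x) * rep (cls t))) = \<Psi> (\<theta> * t * \<phi> (u * inverse x))"
      by (simp add: mult_ac)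
    thus "a x * (\<Psi> (\<theta> * (\<phi> (u * inverse x) * rep (cls t))) * b (u\<^sup>2 * inverse x))
      = a x * (b (u * u * inverse x) * \<Psi> (\<theta> * t * \<phi> (u * inverse x)))"
      by (simp add: power2_eq_square)
  qed
  finally show ?thesis .
qed

lemma twist_W_eq:
  assumes u: "u \<in> U"
  shows "twist (Wig a b) t u
    = I (\<lambda>x. (a x * \<Psi> (\<theta> * t * inverse x)) * (b (u * u * inverse x) * \<Psi> (- (\<theta> * t) * inverse (u * u * inverse x))))"
  unfolding twist_def W_eq[OF u]
proof (rule I_cong)
  fix x assume x: "x \<in> U"
  \<comment> \<open>With y = u^2 / x this reads \<open>\<phi>\<close>(u / x) t / u = t / x - t / y.
    The twist contributes the division by u, without which the factor u would remain in both
    terms.\<close>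
  have "\<theta> * (inverse u * t) * \<phi> (u * inverse x) = \<theta> * t * inverse x + - (\<theta> * t) * inverse (u * u * inverse x)"
    using U_nz[OF u] U_nz[OF x] by (simp add: \<phi>_def field_simps)
  hence "\<Psi> (\<theta> * (inverse u * t) * \<phi> (u * inverse x)) = \<Psi> (\<theta> * t * inverse x) * \<Psi> (- (\<theta> * t) * inverse (u * u * inverse x))"
    by (simp only: char_add)
  thus "a x * (b (u * u * inverse x) * \<Psi> (\<theta> * (inverse u * t) * \<phi> (u * inverse x)))
    = (a x * \<Psi> (\<theta> * t * inverse x)) * (b (u * u * inverse x) * \<Psi> (- (\<theta> * t) * inverse (u * u * inverse x)))"
    by (simp add: mult_ac)
qed

text \<open>\<open>\<phi>\<close> takes values near 0; adding 1 turns it into an isometry of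
  \<open>U\<close>, and the shift only introduces the nonzero factor \<Psi>(t).\<close>

lemma lc_char_phi_eq_0:
  assumes g: "lc K g" and t: "\<not> absk t \<le> q powi lev K"
  shows "I (\<lambda>w. g w * \<Psi> (t * \<phi> w)) = 0"
proof -
  have "I (\<lambda>w. g w * \<Psi> (t * (1 + \<phi> w))) = 0"
    using phi_small phi_diff by (intro lc_char_isometry_eq_0[OF g t]) (auto simp: U_eq_cb cb_def)
  thus ?thesis by (simp add: distrib_left char_add mult.left_commute[of _ "\<Psi> t"])
    (metis char_unitary norm_zero zero_neq_one)
qed

text \<open>In the variable w = u / x the arguments of a and b are u / w and u w, hence of level K
  in w, while the phase is \<Psi>(\<theta> t \<open>\<phi>\<close>(w)). The cancellation is then
  that of characters against functions of level K.\<close>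

lemma W_zero:
  assumes a: "lc K a" and b: "lc K b" and u: "u \<in> U" and t: "\<not> absk t \<le> q powi lev K"
  shows "Wig a b (u, cls t) = 0"
proof -
  let ?F = "\<lambda>w. (a (u * inverse w) * b (u * w)) * \<Psi> ((\<theta> * t) * \<phi> w)"
  have abs_t: "absk (\<theta> * t) = absk t" by (simp add: absk_mult absk_theta)
  have lcg: "lc K (\<lambda>w. a (u * inverse w) * b (u * w))"
  proof (rule loc_constI)
    fix x y assume xy: "x \<in> U" "y \<in> U" "x \<in> cb y (lev K)"
    have "a (u * inverse x) = a (u * inverse y)"
      using u xy by (intro loc_constD[OF a] congr_intros) auto
    moreover have "b (u * x) = b (u * y)"
      using u xy by (intro loc_constD[OF b] congr_intros) auto
    ultimately show "a (u * inverse x) * b (u * x) = a (u * inverse y) * b (u * y)" by simp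
  qed
  obtain m where m: "lev K \<le> m" "absk (\<theta> * t) \<le> q powi m" using ex_powi_bound by blast
  have lcF: "loc_const m U ?F"
  proof (rule loc_constI)
    fix x y assume xy: "x \<in> U" "y \<in> U" "x \<in> cb y m"
    have "\<phi> x \<in> cb (\<phi> y) m" using phi_diff[OF xy(1,2)] xy(3) by (simp add: cb_def)
    hence "\<Psi> ((\<theta> * t) * \<phi> x) = \<Psi> ((\<theta> * t) * \<phi> y)" by (rule char_mult_cong[OF m(2)])
    moreover have "a (u * inverse x) * b (u * x) = a (u * inverse y) * b (u * y)"
      by (rule loc_constD[OF loc_const_mono[OF lcg m(1)] xy])
    ultimately show "?F x = ?F y" by simp
  qed
  have "Wig a b (u, cls t) = I (\<lambda>x. ?F (u * inverse x))"
    unfolding W_eq[OF u]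
  proof (rule I_cong)
    fix x assume x: "x \<in> U"
    have "u * inverse (u * inverse x) = x"
      using U_nz[OF u] U_nz[OF x] by (simp add: field_simps)
    thus "a x * (b (u * u * inverse x) * \<Psi> (\<theta> * t * \<phi> (u * inverse x))) = ?F (u * inverse x)"
      by (simp only: mult.assoc)
  qed
  also have "\<dots> = I ?F"
    by (rule I_isometry[OF _ _ lcF])
      (use u in \<open>auto simp: U_mult U_inverse absk_mult U_absk absk_inverse_diff simp flip: right_diff_distrib\<close>)
  also have "\<dots> = 0" by (rule lc_char_phi_eq_0[OF lcg]) (use t abs_t in simp)
  finally show ?thesis .
qed

text \<open>In the split form u occurs only through y = u^2 / x. For |t| <= q^(n+K) both b and the
  phase in y have level K; for larger t the Wigner function vanishes.\<close>

lemma W_levelX: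
  assumes a: "lc K a" and b: "lc K b"
  shows "levelX K (Wig a b)"
  unfolding levelX_def
proof (intro conjI allI impI)
  fix x assume "x \<notin> X" thus "Wig a b x = 0" by (simp add: W_def)
next
  fix t v :: 'k assume "v \<in> U" "\<not> absk t \<le> q powi lev K"
  thus "twist (Wig a b) t v = 0" unfolding twist_def
    by (intro W_zero[OF a b]) (auto simp: absk_U_mult U_inverse)
next
  fix t :: 'k
  show "lc K (twist (Wig a b) t)"
  proof (rule loc_constI)
    fix u v assume uv: "u \<in> U" "v \<in> U" "u \<in> cb v (lev K)"
    show "twist (Wig a b) t u = twist (Wig a b) t v"
    proof (cases "absk t \<le> q powi lev K")
      case False
      thus ?thesis unfolding twist_def using uv
        by (subst (1 2) W_zero[OF a b]) (auto simp: absk_U_mult U_inverse)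
    next
      case True
      have t: "absk (- (\<theta> * t)) \<le> q powi lev K" using True by (simp add: absk_mult absk_theta)
      show ?thesis unfolding twist_W_eq[OF uv(1)] twist_W_eq[OF uv(2)]
      proof (rule I_cong)
        fix x assume x: "x \<in> U"
        have c: "u * u * inverse x \<in> cb (v * v * inverse x) (lev K)"
          using uv x by (intro congr_intros) auto
        hence "inverse (u * u * inverse x) \<in> cb (inverse (v * v * inverse x)) (lev K)"
          using uv x by (intro U_inverse_congr U_intros) auto
        hence "\<Psi> (- (\<theta> * t) * inverse (u * u * inverse x)) = \<Psi> (- (\<theta> * t) * inverse (v * v * inverse x))"
          by (rule char_mult_cong[OF t])
        moreover have "b (u * u * inverse x) = b (v * v * inverse x)"
          using uv x c by (intro loc_constD[OF b] U_intros) auto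
        ultimately show "a x * \<Psi> (\<theta> * t * inverse x) * (b (u * u * inverse x) * \<Psi> (- (\<theta> * t) * inverse (u * u * inverse x)))
          = a x * \<Psi> (\<theta> * t * inverse x) * (b (v * v * inverse x) * \<Psi> (- (\<theta> * t) * inverse (v * v * inverse x)))" by simp
      qed
    qed
  qed
qed

lemma test_U_common_level:
  assumes "f \<in> test_U" "g \<in> test_U"
  obtains K where "lc K f" "lc K g"
proof -
  obtain m where m: "loc_const m U f" using assms(1) by (rule test_U_loc_const)
  obtain l where l: "loc_const l U g" using assms(2) by (rule test_U_loc_const)
  let ?K = "nat (max m l)"
  have "lc ?K f" "lc ?K g" using loc_const_mono[OF m, of "lev ?K"] loc_const_mono[OF l, of "lev ?K"] by auto
  thus ?thesis by (rule that)
qed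

lemma W_test:
  assumes "f1 \<in> test_U" "f2 \<in> test_U"
  shows "Wig f1 f2 \<in> test_X"
proof -
  obtain K where "lc K f1" "lc K f2" using assms by (rule test_U_common_level)
  thus ?thesis by (intro levelX_test[OF W_levelX])
qed

section \<open>Bessel's inequality on U\<close>

lemma I_char_orthogonal:
  "I (\<lambda>x. \<Psi> (t * x)) = (if absk t \<le> q powi N then of_real (q powi (- N)) * \<Psi> t else 0)"
  unfolding I_eq_set_integral integral_char_cb by simp

text \<open>Characters whose frequencies are more than q^n apart are orthogonal on \<open>U\<close>,
  each with squared norm q^-n. With coefficients rescaled by q^n, p is the orthogonal projection of
  h onto their span, and the claim is that h - p has nonnegative squared norm.\<close>

lemma Bessel:
  assumes h: "h \<in> L2U" and S: "finite S"
    and sep: "\<And>c d. c \<in> S \<Longrightarrow> d \<in> S \<Longrightarrow> c \<noteq> d \<Longrightarrow> \<not> absk (\<tau> c - \<tau> d) \<le> q powi N"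
  shows "(\<Sum>c\<in>S. (cmod (I (\<lambda>x. h x * \<Psi> (\<tau> c * x))))\<^sup>2) \<le> q powi (- N) * (norm2 h)\<^sup>2"
proof -
  define z where "z c = I (\<lambda>x. h x * \<Psi> (\<tau> c * x))" for c
  let ?q = "complex_of_real (q powi N)"
  define e where "e c x = \<Psi> (- \<tau> c * x)" for c x
  have cnj_e: "cnj (e c x) = \<Psi> (\<tau> c * x)" for c x by (simp add: e_def char_minus)
  have eL2: "e c \<in> L2U" for c
  proof (rule bounded_in_L2[OF finite_U, of _ 1])
    obtain m where "absk (- \<tau> c) \<le> q powi m" using ex_powi_bound by blast
    thus "e c \<in> borel_measurable U_measure" unfolding e_def[abs_def] by (intro loc_const_borel loc_const_char)
  qed (simp add: e_def char_unitary)
  have eeL2: "I (\<lambda>x. e c x * cnj (e d x)) = (if c = d then of_real (q powi (- N)) else 0)" if "c \<in> S" "d \<in> S" for c d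
  proof -
    have "(\<lambda>x. e c x * cnj (e d x)) = (\<lambda>x. \<Psi> ((\<tau> d - \<tau> c) * x))"
      unfolding cnj_e by (simp add: e_def fun_eq_iff algebra_simps flip: char_add)
    moreover have "absk (0::'k) \<le> q powi N" using q_powi_pos(2) by (simp only: absk_0)
    ultimately show ?thesis using sep[OF that(2,1)]
      by (cases "c = d") (auto simp: I_char_orthogonal measure_U scaleR_conv_of_real)
  qed
  define p where "p = (\<Sum>c\<in>S. (?q * z c) *\<^sub>c e c)"
  have p_apply: "p x = (\<Sum>c\<in>S. ?q * z c * e c x)" for x
    by (simp add: p_def fun_sum_apply cscale_fun_def cscale_complex_def)
  have "(\<Sum>c\<in>T. (?q * z c) *\<^sub>c e c) \<in> L2U" if "finite T" for T
    using that
  proof (induction T rule: finite_induct)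
    case empty
    show ?case using zero_in_L2 by (simp add: zero_fun_def)
  next
    case (insert c T)
    have "(?q * z c) *\<^sub>c e c + (\<Sum>c\<in>T. (?q * z c) *\<^sub>c e c) \<in> L2U"
      using insert.IH L2_scale[OF eL2] by (rule L2_add[rotated])
    thus ?case unfolding sum.insert[OF insert.hyps] .
  qed
  hence pL2: "p \<in> L2U" unfolding p_def using S by blast
  have expand: "I (\<lambda>x. g x * cnj (p x)) = (\<Sum>c\<in>S. ?q * cnj (z c) * I (\<lambda>x. g x * cnj (e c x)))" if g: "g \<in> L2U" for g
  proof -
    have "I (\<lambda>x. g x * cnj (p x)) = I (\<lambda>x. \<Sum>c\<in>S. ?q * cnj (z c) * (g x * cnj (e c x)))"
      by (simp add: p_apply sum_distrib_left mult_ac)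
    also have "\<dots> = (\<Sum>c\<in>S. I (\<lambda>x. ?q * cnj (z c) * (g x * cnj (e c x))))"
      by (intro Bochner_Integration.integral_sum integrable_mult_right L2_mult_integrable[OF g L2_cnj[OF eL2]])
    finally show ?thesis by simp
  qed
  have hp: "I (\<lambda>x. h x * cnj (p x)) = of_real (q powi N * (\<Sum>c\<in>S. (cmod (z c))\<^sup>2))"
    unfolding expand[OF h] cnj_e z_def[symmetric]
    by (simp add: sum_distrib_left complex_norm_square mult_ac del: of_real_power)
  have ep: "I (\<lambda>x. p x * cnj (e c x)) = z c" if c: "c \<in> S" for c
  proof -
    have "I (\<lambda>x. p x * cnj (e c x)) = I (\<lambda>x. \<Sum>d\<in>S. ?q * z d * (e d x * cnj (e c x)))"
      by (simp only: p_apply sum_distrib_right mult.assoc)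
    also have "\<dots> = (\<Sum>d\<in>S. I (\<lambda>x. ?q * z d * (e d x * cnj (e c x))))"
      by (intro Bochner_Integration.integral_sum integrable_mult_right L2_mult_integrable[OF eL2 L2_cnj[OF eL2]])
    also have "\<dots> = (\<Sum>d\<in>S. ?q * z d * (if d = c then of_real (q powi (- N)) else 0))"
      using eeL2[OF _ c] by (intro sum.cong refl) (simp del: of_real_power_int)
    also have "\<dots> = ?q * z c * of_real (q powi (- N))"
      using S c by (simp add: if_distrib sum.delta' cong: if_cong)
    also have "\<dots> = z c * of_real (q powi N * q powi (- N))" by simp
    also have "q powi N * q powi (- N) = 1" using power_int_add[of q N "- N"] by (simp del: power_int_of_nat)
    finally show ?thesis by simp
  qed
  have pp: "I (\<lambda>x. p x * cnj (p x)) = of_real (q powi N * (\<Sum>c\<in>S. (cmod (z c))\<^sup>2))"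
    unfolding expand[OF pL2] using ep
    by (simp add: sum_distrib_left complex_norm_square mult_ac del: of_real_power)
  have "(norm2 p)\<^sup>2 = Re (I (\<lambda>x. p x * cnj (p x)))"
  proof -
    have "I (\<lambda>x. p x * cnj (p x)) = I (\<lambda>x. of_real ((cmod (p x))\<^sup>2))" by (simp only: complex_norm_square)
    also have "\<dots> = of_real (I (\<lambda>x. (cmod (p x))\<^sup>2))" by (rule integral_complex_of_real)
    finally show ?thesis by (simp add: L2_norm_sq)
  qed
  hence "0 \<le> (norm2 h)\<^sup>2 - q powi N * (\<Sum>c\<in>S. (cmod (z c))\<^sup>2)"
    using L2_norm_sq_diff[OF h pL2] zero_le_power2[of "norm2 (h - p)"] unfolding hp pp by simp
  hence "q powi (- N) * (q powi N * (\<Sum>c\<in>S. (cmod (z c))\<^sup>2)) \<le> q powi (- N) * (norm2 h)\<^sup>2"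
    by (intro mult_left_mono) auto
  moreover have "q powi (- N) * q powi N = 1" using power_int_add[of q "- N" N] by (simp del: power_int_of_nat)
  ultimately show ?thesis unfolding z_def by (simp only: mult.assoc[symmetric] mult_1_left)
qed

lemma rep_separated:
  assumes "c \<in> \<Gamma>" "d \<in> \<Gamma>" "c \<noteq> d"
  shows "\<not> absk (rep c - rep d) \<le> q powi N"
proof
  assume "absk (rep c - rep d) \<le> q powi N"
  hence "rep c \<in> cb (rep d) (- N)" by (simp add: cb_def)
  hence "cls (rep c) = cls (rep d)" by (simp only: cls_eq_iff)
  thus False using assms cls_rep by metis
qed

text \<open>The pieces of a over the partition have squared norms adding up to that of a, so
  applying Bessel to each piece loses nothing. Inversion turns the phase into a character. The map
  \<xi> serves both factors of the Wigner function: one is partitioned by v^2 / x, the other by its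
  own variable.\<close>

lemma Bessel_partition:
  assumes a: "lc K a" and kK: "k \<le> K" and R: "reps 1 N (lev k) R" and \<theta>': "absk \<theta>' = 1"
    and \<xi>: "\<And>x. x \<in> U \<Longrightarrow> \<xi> x \<in> U" "\<And>x y. x \<in> U \<Longrightarrow> y \<in> U \<Longrightarrow> x \<in> cb y (lev K) \<Longrightarrow> \<xi> x \<in> cb (\<xi> y) (lev K)"
  shows "(\<Sum>r\<in>R. \<Sum>c\<in>\<Gamma>K K. (cmod (I (\<lambda>x. of_bool (\<xi> x \<in> cb r (lev k)) * (a x * \<Psi> (\<theta>' * rep c * inverse x)))))\<^sup>2)
    \<le> q powi (- N) * (norm2 a)\<^sup>2"
proof -
  have RU: "R \<subseteq> U" using reps_subset[OF R] by (simp add: U_eq_cb)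
  define h where "h r w = of_bool (\<xi> (inverse w) \<in> cb r (lev k)) * a (inverse w)" for r w
  have lch: "lc K (h r)" for r
  proof (rule loc_constI)
    fix x y assume xy: "x \<in> U" "y \<in> U" "x \<in> cb y (lev K)"
    have c: "\<xi> (inverse x) \<in> cb (\<xi> (inverse y)) (lev K)" using xy by (intro \<xi> congr_intros) auto
    have "\<xi> (inverse x) \<in> cb r (lev k) \<longleftrightarrow> \<xi> (inverse y) \<in> cb r (lev k)" by (rule mem_cb_cong[OF mem_cb_self c]) (use kK in simp)
    moreover have "a (inverse x) = a (inverse y)" using xy by (intro loc_constD[OF a] congr_intros) auto
    ultimately show "h r x = h r y" by (simp add: h_def)
  qed
  have hL2: "h r \<in> L2U" for r
  proof -
    have "integrable U_measure (\<lambda>x. (cmod (h r x))\<^sup>2)" by (rule I_integrable[OF lc_comp[OF lch]])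
    thus ?thesis using loc_const_borel[OF lch] by (simp add: L2_functions_def)
  qed
  have eq: "I (\<lambda>x. of_bool (\<xi> x \<in> cb r (lev k)) * (a x * \<Psi> (\<theta>' * rep c * inverse x)))
      = I (\<lambda>w. h r w * \<Psi> (\<theta>' * rep c * w))" if c: "c \<in> \<Gamma>K K" for r c
  proof -
    have "absk (\<theta>' * rep c) \<le> q powi lev K" using rep_GammaK[OF c] \<theta>' by (simp add: absk_mult)
    hence "lc K (\<lambda>w. h r w * \<Psi> (\<theta>' * rep c * w))" by (intro lc_mult lch loc_const_char)
    from I_inverse[OF this] show ?thesis by (simp add: h_def mult.assoc)
  qed
  have "(\<Sum>c\<in>\<Gamma>K K. (cmod (I (\<lambda>x. of_bool (\<xi> x \<in> cb r (lev k)) * (a x * \<Psi> (\<theta>' * rep c * inverse x)))))\<^sup>2)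
      \<le> q powi (- N) * (norm2 (h r))\<^sup>2" for r
  proof -
    have "(\<Sum>c\<in>\<Gamma>K K. (cmod (I (\<lambda>w. h r w * \<Psi> (\<theta>' * rep c * w))))\<^sup>2) \<le> q powi (- N) * (norm2 (h r))\<^sup>2"
    proof (rule Bessel[OF hL2 finite_GammaK])
      fix c d assume "c \<in> \<Gamma>K K" "d \<in> \<Gamma>K K" "c \<noteq> d"
      hence "\<not> absk (rep c - rep d) \<le> q powi N" using GammaK_subset by (intro rep_separated) auto
      moreover have "absk (\<theta>' * rep c - \<theta>' * rep d) = absk (rep c - rep d)"
        using \<theta>' by (simp add: absk_mult flip: right_diff_distrib)
      ultimately show "\<not> absk (\<theta>' * rep c - \<theta>' * rep d) \<le> q powi N" by simp
    qed
    thus ?thesis by (simp only: eq cong: sum.cong)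
  qed
  hence "(\<Sum>r\<in>R. \<Sum>c\<in>\<Gamma>K K. (cmod (I (\<lambda>x. of_bool (\<xi> x \<in> cb r (lev k)) * (a x * \<Psi> (\<theta>' * rep c * inverse x)))))\<^sup>2)
      \<le> (\<Sum>r\<in>R. q powi (- N) * (norm2 (h r))\<^sup>2)" by (intro sum_mono)
  also have "\<dots> = q powi (- N) * (\<Sum>r\<in>R. (norm2 (h r))\<^sup>2)" by (simp add: sum_distrib_left)
  also have "(\<Sum>r\<in>R. (norm2 (h r))\<^sup>2) = I (\<lambda>w. \<Sum>r\<in>R. (cmod (h r w))\<^sup>2)"
    unfolding L2_norm_sq by (intro Bochner_Integration.integral_sum[symmetric] L2_integrable hL2)
  also have "\<dots> = I (\<lambda>w. (cmod (a (inverse w)))\<^sup>2)"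
  proof (rule I_cong)
    fix w assume w: "w \<in> U"
    hence "\<xi> (inverse w) \<in> cb 1 N" using \<xi>(1)[OF U_inverse] by (simp add: U_eq_cb)
    then obtain s where s: "s \<in> R" "\<xi> (inverse w) \<in> cb s (lev k)" by (rule reps_cover[OF R])
    have "(\<Sum>r\<in>R. (cmod (h r w))\<^sup>2) = (\<Sum>r\<in>R. if r = s then (cmod (a (inverse w)))\<^sup>2 else 0)"
    proof (rule sum.cong[OF refl])
      fix r assume r: "r \<in> R"
      have "\<xi> (inverse w) \<in> cb r (lev k) \<longleftrightarrow> r = s"
        using s reps_inj[OF R r s(1)] mem_cb_common[of "\<xi> (inverse w)" r "lev k" s] by auto
      thus "(cmod (h r w))\<^sup>2 = (if r = s then (cmod (a (inverse w)))\<^sup>2 else 0)" by (simp add: h_def)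
    qed
    also have "\<dots> = (cmod (a (inverse w)))\<^sup>2" using s(1) reps_finite[OF R] by simp
    finally show "(\<Sum>r\<in>R. (cmod (h r w))\<^sup>2) = (cmod (a (inverse w)))\<^sup>2" .
  qed
  also have "\<dots> = (norm2 a)\<^sup>2" unfolding L2_norm_sq by (rule I_inverse[OF lc_comp[OF a]])
  finally show ?thesis .
qed

text \<open>For fixed x the map u -> u^2 / x is an isometry of \<open>U\<close>, so the ball around
  v becomes the ball around v^2 / x in the variable y. This is the ball of exactly one
  representative r, and sorting x according to r decouples the two integrals.\<close>

lemma avg_twist_W:
  assumes a: "lc K a" and b: "lc K b" and kK: "k \<le> K" and v: "v \<in> U" and t: "absk t \<le> q powi lev K"
    and R: "reps 1 N (lev k) R"
  shows "avg k (twist (Wig a b) t) v = of_real (q powi lev k) * (\<Sum>r\<in>R.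
    I (\<lambda>x. of_bool (v * v * inverse x \<in> cb r (lev k)) * (a x * \<Psi> (\<theta> * t * inverse x))) *
    I (\<lambda>y. of_bool (y \<in> cb r (lev k)) * (b y * \<Psi> (- \<theta> * t * inverse y))))"
proof -
  define A where "A x = a x * \<Psi> (\<theta> * t * inverse x)" for x
  define B where "B y = b y * \<Psi> (- \<theta> * t * inverse y)" for y
  have lcchar: "lc K (\<lambda>x. \<Psi> (s * inverse x))" if "absk s \<le> q powi lev K" for s
    by (rule loc_constI, rule char_mult_cong[OF that]) (intro congr_intros)
  have A: "lc K A" unfolding A_def using t by (intro lc_mult a lcchar) (simp add: absk_mult absk_theta)
  have B: "lc K B" unfolding B_def using t by (intro lc_mult b lcchar) (simp add: absk_mult absk_theta)
  have lcA': "lc K (\<lambda>x. of_bool (v * v * inverse x \<in> cb r (lev k)) * A x)" for r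
  proof (rule loc_constI)
    fix x y assume xy: "x \<in> U" "y \<in> U" "x \<in> cb y (lev K)"
    have c: "v * v * inverse x \<in> cb (v * v * inverse y) (lev K)" using v xy by (intro congr_intros) auto
    have "v * v * inverse x \<in> cb r (lev k) \<longleftrightarrow> v * v * inverse y \<in> cb r (lev k)"
      by (rule mem_cb_cong[OF mem_cb_self c]) (use kK in simp)
    thus "of_bool (v * v * inverse x \<in> cb r (lev k)) * A x = of_bool (v * v * inverse y \<in> cb r (lev k)) * A y"
      using loc_constD[OF A xy] by simp
  qed
  have inner: "I (\<lambda>u. of_bool (u \<in> cb v (lev k)) * (A x * B (u * u * inverse x)))
      = (\<Sum>r\<in>R. (of_bool (v * v * inverse x \<in> cb r (lev k)) * A x) * I (\<lambda>y. of_bool (y \<in> cb r (lev k)) * B y))"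
    if x: "x \<in> U" for x
  proof -
    let ?w = "v * v * inverse x"
    have w: "?w \<in> U" using v x by (intro U_intros)
    have diff: "absk (u * u * inverse x - u' * u' * inverse x) = absk (u - u')" if "u \<in> U" "u' \<in> U" for u u'
      using absk_square_diff[OF that] U_absk[OF x] by (simp add: absk_mult absk_inverse flip: left_diff_distrib)
    have "I (\<lambda>u. of_bool (u \<in> cb v (lev k)) * (A x * B (u * u * inverse x)))
        = I (\<lambda>u. of_bool (u * u * inverse x \<in> cb ?w (lev k)) * (A x * B (u * u * inverse x)))"
      by (rule I_cong) (use diff v in \<open>simp add: cb_def\<close>)
    also have "\<dots> = I (\<lambda>y. of_bool (y \<in> cb ?w (lev k)) * (A x * B y))"
    proof (rule I_isometry[OF _ diff])
      show "lc K (\<lambda>y. of_bool (y \<in> cb ?w (lev k)) * (A x * B y))"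
        using kK by (intro lc_mult lc_ball lc_const B)
    qed (use x in \<open>auto intro: U_intros\<close>)
    also have "\<dots> = I (\<lambda>y. \<Sum>r\<in>R. (of_bool (?w \<in> cb r (lev k)) * A x) * (of_bool (y \<in> cb r (lev k)) * B y))"
    proof (rule I_cong)
      fix y
      obtain s where s: "s \<in> R" "?w \<in> cb s (lev k)" using w reps_cover[OF R] by (auto simp: U_eq_cb)
      have "(\<Sum>r\<in>R. (of_bool (?w \<in> cb r (lev k)) * A x) * (of_bool (y \<in> cb r (lev k)) * B y))
        = (\<Sum>r\<in>R. if r = s then A x * (of_bool (y \<in> cb s (lev k)) * B y) else 0)"
      proof (rule sum.cong[OF refl])
        fix r assume r: "r \<in> R"
        have "?w \<in> cb r (lev k) \<longleftrightarrow> r = s"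
          using s reps_inj[OF R r s(1)] mem_cb_common[of ?w r "lev k" s] by auto
        thus "(of_bool (?w \<in> cb r (lev k)) * A x) * (of_bool (y \<in> cb r (lev k)) * B y)
          = (if r = s then A x * (of_bool (y \<in> cb s (lev k)) * B y) else 0)" by simp
      qed
      also have "\<dots> = A x * (of_bool (y \<in> cb s (lev k)) * B y)" using s(1) reps_finite[OF R] by simp
      also have "cb s (lev k) = cb ?w (lev k)" using cb_eq[OF s(2)] by simp
      finally show "of_bool (y \<in> cb ?w (lev k)) * (A x * B y)
        = (\<Sum>r\<in>R. (of_bool (?w \<in> cb r (lev k)) * A x) * (of_bool (y \<in> cb r (lev k)) * B y))" by simp
    qed
    also have "\<dots> = (\<Sum>r\<in>R. I (\<lambda>y. (of_bool (?w \<in> cb r (lev k)) * A x) * (of_bool (y \<in> cb r (lev k)) * B y)))"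
      by (intro Bochner_Integration.integral_sum integrable_mult_right avg_integrable[OF B])
    finally show ?thesis by (simp only: integral_mult_right_zero)
  qed
  have "avg k (twist (Wig a b) t) v
      = of_real (q powi lev k) * I (\<lambda>u. I (\<lambda>x. of_bool (u \<in> cb v (lev k)) * (A x * B (u * u * inverse x))))"
    unfolding avg_def
  proof (intro arg_cong2[of _ _ _ _ "(*)"] refl I_cong)
    fix u assume u: "u \<in> U"
    show "of_bool (u \<in> cb v (lev k)) * twist (Wig a b) t u
      = I (\<lambda>x. of_bool (u \<in> cb v (lev k)) * (A x * B (u * u * inverse x)))"
      unfolding twist_W_eq[OF u] A_def B_def by simp
  qed
  also have "I (\<lambda>u. I (\<lambda>x. of_bool (u \<in> cb v (lev k)) * (A x * B (u * u * inverse x))))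
      = I (\<lambda>x. I (\<lambda>u. of_bool (u \<in> cb v (lev k)) * (A x * B (u * u * inverse x))))"
  proof (rule I_swap[of "lev K"])
    fix u u' x x' assume h: "u \<in> U" "u' \<in> U" "x \<in> U" "x' \<in> U" "u' \<in> cb u (lev K)" "x' \<in> cb x (lev K)"
    have "u' \<in> cb v (lev k) \<longleftrightarrow> u \<in> cb v (lev k)" by (rule mem_cb_cong[OF mem_cb_self h(5)]) (use kK in simp)
    moreover have "A x' = A x" by (rule loc_constD[OF A h(4,3,6)])
    moreover have "B (u' * u' * inverse x') = B (u * u * inverse x)"
      using h by (intro loc_constD[OF B] congr_intros) auto
    ultimately show "of_bool (u' \<in> cb v (lev k)) * (A x' * B (u' * u' * inverse x'))
      = of_bool (u \<in> cb v (lev k)) * (A x * B (u * u * inverse x))" by simp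
  qed
  also have "\<dots> = I (\<lambda>x. \<Sum>r\<in>R. (of_bool (v * v * inverse x \<in> cb r (lev k)) * A x) * I (\<lambda>y. of_bool (y \<in> cb r (lev k)) * B y))"
    by (rule I_cong) (rule inner)
  also have "\<dots> = (\<Sum>r\<in>R. I (\<lambda>x. (of_bool (v * v * inverse x \<in> cb r (lev k)) * A x) * I (\<lambda>y. of_bool (y \<in> cb r (lev k)) * B y)))"
    by (intro Bochner_Integration.integral_sum integrable_mult_left I_integrable[OF lcA'])
  finally show ?thesis unfolding A_def B_def by (simp only: integral_mult_left_zero)
qed

text \<open>Bessel is applied to the squares of the two factors separately. The weight \<rho> stays
  free, to be optimized once v has been integrated out.\<close>

lemma sum_avg_twist_W_le:
  assumes a: "lc K a" and b: "lc K b" and kK: "k \<le> K" and v: "v \<in> U" and \<rho>: "0 < \<rho>"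
  shows "(\<Sum>c\<in>\<Gamma>K K. cmod (avg k (twist (Wig a b) (rep c)) v))
    \<le> q powi lev k * ((\<rho> * (q powi (- N) * (norm2 a)\<^sup>2) + (q powi (- N) * (norm2 b)\<^sup>2) / \<rho>) / 2)"
proof -
  obtain R where R: "reps 1 N (lev k) R" using reps_exist[of N "lev k"] by auto
  define A where "A r c = I (\<lambda>x. of_bool (v * v * inverse x \<in> cb r (lev k)) * (a x * \<Psi> (\<theta> * rep c * inverse x)))" for r c
  define B where "B r c = I (\<lambda>y. of_bool (y \<in> cb r (lev k)) * (b y * \<Psi> (- \<theta> * rep c * inverse y)))" for r c
  have "(\<Sum>r\<in>R. \<Sum>c\<in>\<Gamma>K K. (cmod (A r c))\<^sup>2) \<le> q powi (- N) * (norm2 a)\<^sup>2"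
    unfolding A_def by (rule Bessel_partition[OF a kK R absk_theta]) (use v in \<open>intro congr_intros; simp\<close>)+
  hence A2: "(\<Sum>c\<in>\<Gamma>K K. \<Sum>r\<in>R. (cmod (A r c))\<^sup>2) \<le> q powi (- N) * (norm2 a)\<^sup>2" by (subst sum.swap)
  have "(\<Sum>r\<in>R. \<Sum>c\<in>\<Gamma>K K. (cmod (B r c))\<^sup>2) \<le> q powi (- N) * (norm2 b)\<^sup>2"
    unfolding B_def by (rule Bessel_partition[OF b kK R]) (simp_all add: absk_theta)
  hence B2: "(\<Sum>c\<in>\<Gamma>K K. \<Sum>r\<in>R. (cmod (B r c))\<^sup>2) \<le> q powi (- N) * (norm2 b)\<^sup>2" by (subst sum.swap)
  have "cmod (avg k (twist (Wig a b) (rep c)) v)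
      \<le> q powi lev k * (\<Sum>r\<in>R. (\<rho> * (cmod (A r c))\<^sup>2 + (cmod (B r c))\<^sup>2 / \<rho>) / 2)" if c: "c \<in> \<Gamma>K K" for c
  proof -
    have "avg k (twist (Wig a b) (rep c)) v = of_real (q powi lev k) * (\<Sum>r\<in>R. A r c * B r c)"
      unfolding A_def B_def by (rule avg_twist_W[OF a b kK v rep_GammaK[OF c] R])
    hence "cmod (avg k (twist (Wig a b) (rep c)) v) = q powi lev k * cmod (\<Sum>r\<in>R. A r c * B r c)"
      by (simp only: norm_mult norm_of_real abs_of_nonneg[OF q_powi_pos(2)])
    also have "\<dots> \<le> q powi lev k * (\<Sum>r\<in>R. (\<rho> * (cmod (A r c))\<^sup>2 + (cmod (B r c))\<^sup>2 / \<rho>) / 2)"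
    proof (rule mult_left_mono[OF order_trans[OF norm_sum sum_mono] q_powi_pos(2)])
      fix r show "cmod (A r c * B r c) \<le> (\<rho> * (cmod (A r c))\<^sup>2 + (cmod (B r c))\<^sup>2 / \<rho>) / 2"
        unfolding norm_mult by (rule mult_le_half_squares[OF \<rho>])
    qed
    finally show ?thesis .
  qed
  hence "(\<Sum>c\<in>\<Gamma>K K. cmod (avg k (twist (Wig a b) (rep c)) v))
      \<le> (\<Sum>c\<in>\<Gamma>K K. q powi lev k * (\<Sum>r\<in>R. (\<rho> * (cmod (A r c))\<^sup>2 + (cmod (B r c))\<^sup>2 / \<rho>) / 2))"
    by (rule sum_mono)
  also have "\<dots> = q powi lev k * ((\<rho> * (\<Sum>c\<in>\<Gamma>K K. \<Sum>r\<in>R. (cmod (A r c))\<^sup>2) + (\<Sum>c\<in>\<Gamma>K K. \<Sum>r\<in>R. (cmod (B r c))\<^sup>2) / \<rho>) / 2)"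
    by (simp only: sum_distrib_left[symmetric] sum_divide_distrib[symmetric] sum.distrib)
  also have "\<dots> \<le> q powi lev k * ((\<rho> * (q powi (- N) * (norm2 a)\<^sup>2) + (q powi (- N) * (norm2 b)\<^sup>2) / \<rho>) / 2)"
    using A2 B2 \<rho> by (intro mult_left_mono divide_right_mono add_mono) auto
  finally show ?thesis .
qed

lemma L1_X_avg_twist_W_le:
  assumes a: "lc K a" and b: "lc K b" and kK: "k \<le> K"
  shows "(\<Sum>c\<in>\<Gamma>K K. I (\<lambda>v. cmod (avg k (twist (Wig a b) (rep c)) v)))
    \<le> q ^ k * (q powi (- N) * norm2 a * norm2 b)"
proof -
  let ?S = "\<lambda>v. \<Sum>c\<in>\<Gamma>K K. cmod (avg k (twist (Wig a b) (rep c)) v)"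
  let ?A = "q powi (- N) * (norm2 a)\<^sup>2" and ?B = "q powi (- N) * (norm2 b)\<^sup>2"
  have int: "integrable U_measure (\<lambda>v. cmod (avg k (twist (Wig a b) (rep c)) v))" for c
    by (rule I_integrable[OF lc_comp[OF avg_lc[OF order_refl]]])
  have eq: "(\<Sum>c\<in>\<Gamma>K K. I (\<lambda>v. cmod (avg k (twist (Wig a b) (rep c)) v))) = I ?S"
    by (intro Bochner_Integration.integral_sum[symmetric] int)
  \<comment> \<open>The normalization q^(n+k) of the average meets the volume q^-n of
    \<open>U\<close>, over which v is integrated.\<close>
  have qk: "q powi lev k * q powi (- N) = q ^ k"
    using power_int_add[of q "lev k" "- N"] by simp
  have "I ?S / q ^ k \<le> sqrt ?A * sqrt ?B"
  proof (rule le_sqrt_multI)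
    fix \<rho> :: real assume \<rho>: "0 < \<rho>"
    let ?E = "(\<rho> * ?A + ?B / \<rho>) / 2"
    have "I ?S \<le> I (\<lambda>v. q powi lev k * ?E)"
    proof (rule integral_mono)
      show "integrable U_measure ?S" by (intro Bochner_Integration.integrable_sum int)
      show "integrable U_measure (\<lambda>v. q powi lev k * ?E)" using finite_measure.integrable_const[OF finite_U] .
      fix v assume "v \<in> space U_measure"
      thus "?S v \<le> q powi lev k * ?E" using sum_avg_twist_W_le[OF a b kK _ \<rho>, of v] by simp
    qed
    also have "\<dots> = (q powi lev k * q powi (- N)) * ?E" by (simp add: measure_U)
    finally show "I ?S / q ^ k \<le> ?E" unfolding qk by (simp add: field_simps)
  qed simp_all
  also have "sqrt ?A * sqrt ?B = q powi (- N) * norm2 a * norm2 b"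
    by (simp add: real_sqrt_mult[symmetric] power_mult_distrib[symmetric]) (simp add: real_sqrt_mult)
  finally have "I ?S \<le> (q powi (- N) * norm2 a * norm2 b) * q ^ k" by (simp add: pos_divide_le_eq)
  thus ?thesis unfolding eq by (simp add: mult.commute)
qed

text \<open>Each increment is split by the triangle inequality into two averages, whence the terms
  q^k and q^(k-1). The exponent s is arbitrary for the finite sum; uniformity in K is obtained
  afterwards from s < -2.\<close>

lemma L1_X_J_test_W_le:
  assumes a: "lc K a" and b: "lc K b"
  shows "L1_X (J_test s (Wig a b))
    \<le> (\<Sum>k\<le>K. (q powr s) ^ k * (q ^ k + (if k = 0 then 0 else q ^ (k - 1)))) * (q powi (- N) * norm2 a * norm2 b)"
proof -
  let ?W = "Wig a b" and ?P = "q powi (- N) * norm2 a * norm2 b"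
  define M where "M k = (\<Sum>c\<in>\<Gamma>K K. I (\<lambda>v. cmod (avg k (twist ?W (rep c)) v)))" for k
  have int: "integrable U_measure (\<lambda>v. cmod (avg k (twist ?W t) v))" for k t
    by (rule I_integrable[OF lc_comp[OF avg_lc[OF order_refl]]])
  have int2: "integrable U_measure (\<lambda>v. if k = 0 then 0 else cmod (avg (k - 1) (twist ?W t) v))" for k t
    using int[of "k - 1" t] by (cases "k = 0") simp_all
  have int3: "integrable U_measure (\<lambda>v. (q powr s) ^ k * (cmod (avg k (twist ?W t) v) + (if k = 0 then 0 else cmod (avg (k - 1) (twist ?W t) v))))" for k t
    by (intro integrable_mult_right Bochner_Integration.integrable_add int int2)
  note lev = W_levelX[OF a b]
  have "I (\<lambda>v. cmod (twist (J_test s ?W) t v))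
      \<le> (\<Sum>k\<le>K. (q powr s) ^ k * (I (\<lambda>v. cmod (avg k (twist ?W t) v)) + (if k = 0 then 0 else I (\<lambda>v. cmod (avg (k - 1) (twist ?W t) v)))))" for t
  proof -
    have "I (\<lambda>v. cmod (twist (J_test s ?W) t v))
        \<le> I (\<lambda>v. \<Sum>k\<le>K. (q powr s) ^ k * (cmod (avg k (twist ?W t) v) + (if k = 0 then 0 else cmod (avg (k - 1) (twist ?W t) v))))"
    proof (rule integral_mono)
      show "integrable U_measure (\<lambda>v. cmod (twist (J_test s ?W) t v))"
        by (rule I_integrable[OF lc_comp[OF levelX_lc[OF levelX_J_test[OF lev]]]])
      show "integrable U_measure (\<lambda>v. \<Sum>k\<le>K. (q powr s) ^ k * (cmod (avg k (twist ?W t) v) + (if k = 0 then 0 else cmod (avg (k - 1) (twist ?W t) v))))"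
        by (intro Bochner_Integration.integrable_sum int3)
      fix v assume "v \<in> space U_measure"
      hence "twist (J_test s ?W) t v = multiplier (q powr s) K (twist ?W t) v" by (intro twist_J_test[OF lev]) simp
      also have "cmod \<dots> \<le> (\<Sum>k\<le>K. cmod (of_real ((q powr s) ^ k) * avg_diff k (twist ?W t) v))"
        unfolding multiplier_def by (rule norm_sum)
      also have "\<dots> \<le> (\<Sum>k\<le>K. (q powr s) ^ k * (cmod (avg k (twist ?W t) v) + (if k = 0 then 0 else cmod (avg (k - 1) (twist ?W t) v))))"
      proof (rule sum_mono)
        fix k
        have "cmod (avg_diff k (twist ?W t) v) \<le> cmod (avg k (twist ?W t) v) + (if k = 0 then 0 else cmod (avg (k - 1) (twist ?W t) v))"
          unfolding avg_diff_def using norm_triangle_ineq4 by auto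
        thus "cmod (of_real ((q powr s) ^ k) * avg_diff k (twist ?W t) v)
          \<le> (q powr s) ^ k * (cmod (avg k (twist ?W t) v) + (if k = 0 then 0 else cmod (avg (k - 1) (twist ?W t) v)))"
          unfolding norm_mult norm_of_real by (simp add: mult_left_mono)
      qed
      finally show "cmod (twist (J_test s ?W) t v) \<le> \<dots>" .
    qed
    also have "\<dots> = (\<Sum>k\<le>K. I (\<lambda>v. (q powr s) ^ k * (cmod (avg k (twist ?W t) v) + (if k = 0 then 0 else cmod (avg (k - 1) (twist ?W t) v)))))"
      by (rule Bochner_Integration.integral_sum) (rule int3)
    also have "\<dots> = (\<Sum>k\<le>K. (q powr s) ^ k * (I (\<lambda>v. cmod (avg k (twist ?W t) v)) + (if k = 0 then 0 else I (\<lambda>v. cmod (avg (k - 1) (twist ?W t) v)))))"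
    proof (rule sum.cong[OF refl])
      fix k
      show "I (\<lambda>v. (q powr s) ^ k * (cmod (avg k (twist ?W t) v) + (if k = 0 then 0 else cmod (avg (k - 1) (twist ?W t) v))))
        = (q powr s) ^ k * (I (\<lambda>v. cmod (avg k (twist ?W t) v)) + (if k = 0 then 0 else I (\<lambda>v. cmod (avg (k - 1) (twist ?W t) v))))"
        using Bochner_Integration.integral_add[OF int[of k t] int[of "k - 1" t]] by (cases "k = 0") simp_all
    qed
    finally show ?thesis .
  qed
  hence "L1_X (J_test s ?W) \<le> (\<Sum>c\<in>\<Gamma>K K. \<Sum>k\<le>K. (q powr s) ^ k * (I (\<lambda>v. cmod (avg k (twist ?W (rep c)) v))
      + (if k = 0 then 0 else I (\<lambda>v. cmod (avg (k - 1) (twist ?W (rep c)) v)))))"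
    unfolding L1_X_eq_twist[OF levelX_J_test[OF lev]] by (intro sum_mono)
  also have "\<dots> = (\<Sum>k\<le>K. \<Sum>c\<in>\<Gamma>K K. (q powr s) ^ k * (I (\<lambda>v. cmod (avg k (twist ?W (rep c)) v))
      + (if k = 0 then 0 else I (\<lambda>v. cmod (avg (k - 1) (twist ?W (rep c)) v)))))" by (rule sum.swap)
  also have "\<dots> = (\<Sum>k\<le>K. (q powr s) ^ k * (M k + (if k = 0 then 0 else M (k - 1))))"
  proof (rule sum.cong[OF refl])
    fix k
    show "(\<Sum>c\<in>\<Gamma>K K. (q powr s) ^ k * (I (\<lambda>v. cmod (avg k (twist ?W (rep c)) v))
      + (if k = 0 then 0 else I (\<lambda>v. cmod (avg (k - 1) (twist ?W (rep c)) v))))) = (q powr s) ^ k * (M k + (if k = 0 then 0 else M (k - 1)))"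
      unfolding sum_distrib_left[symmetric] M_def by (cases "k = 0") (simp_all add: sum.distrib)
  qed
  also have "\<dots> \<le> (\<Sum>k\<le>K. (q powr s) ^ k * (q ^ k * ?P + (if k = 0 then 0 else q ^ (k - 1) * ?P)))"
  proof (rule sum_mono)
    fix k assume "k \<in> {..K}"
    hence "M k \<le> q ^ k * ?P" "M (k - 1) \<le> q ^ (k - 1) * ?P"
      unfolding M_def by (auto intro!: L1_X_avg_twist_W_le[OF a b])
    thus "(q powr s) ^ k * (M k + (if k = 0 then 0 else M (k - 1))) \<le> (q powr s) ^ k * (q ^ k * ?P + (if k = 0 then 0 else q ^ (k - 1) * ?P))"
      by (intro mult_left_mono) auto
  qed
  also have "\<dots> = (\<Sum>k\<le>K. (q powr s) ^ k * (q ^ k + (if k = 0 then 0 else q ^ (k - 1)))) * ?P"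
    unfolding sum_distrib_right by (intro sum.cong refl) (simp add: algebra_simps)
  finally show ?thesis .
qed

section \<open>The quantization map\<close>

lemma mu0_measurable: "\<mu>0 \<in> borel_measurable dt"
proof -
  have "\<mu>0 = (\<lambda>t. max 1 (q powi (- N) * dist t 0))"
    by (simp add: fun_eq_iff \<mu>0_def absk_dist absk_mult absk_power absk_pi power_int_minus power_one_over inverse_eq_divide)
  moreover have "continuous_on UNIV (\<lambda>t::'k. max 1 (q powi (- N) * dist t 0))" by (intro continuous_intros)
  ultimately have "\<mu>0 \<in> borel_measurable borel" by (simp add: borel_measurable_continuous_onI)
  thus ?thesis by (simp only: measurable_cong_sets[OF haar_sets refl])
qed

definition shell :: "nat \<Rightarrow> 'k set" where
  "shell k = cb 0 (- lev k) - (if k = 0 then {} else cb 0 (- lev (k - 1)))"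

lemma mem_shell: "\<exists>j. \<mu>0 t = q ^ j \<and> (\<forall>k. t \<in> shell k \<longleftrightarrow> k = j)"
proof -
  obtain j where j: "\<mu>0 t = q ^ j" "\<And>k. absk t \<le> q powi lev k \<longleftrightarrow> j \<le> k" using mu0_shell by blast
  have "t \<in> shell k \<longleftrightarrow> k = j" for k
  proof -
    have "t \<in> shell k \<longleftrightarrow> absk t \<le> q powi lev k \<and> (k = 0 \<or> \<not> absk t \<le> q powi lev (k - 1))"
      unfolding shell_def Diff_iff by (cases "k = 0") (simp_all only: mem_cb_minus if_True if_False empty_iff simp_thms)
    thus ?thesis unfolding j(2) by (cases k) auto
  qed
  thus ?thesis using j(1) by blast
qed

lemma sets_shell [measurable]: "shell k \<in> sets dt"
  by (simp add: shell_def)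

lemma measure_shell:
  "emeasure dt (shell k) = ennreal (measure dt (shell k))"
  "measure dt (shell k) = q powi lev k - (if k = 0 then 0 else q powi lev (k - 1))"
proof -
  have fin: "emeasure dt (cb a i) \<noteq> \<infinity>" for a i by (simp add: emeasure_cb)
  have "emeasure dt (shell k) \<le> emeasure dt (cb 0 (- lev k))" by (rule emeasure_mono) (auto simp: shell_def)
  hence "emeasure dt (shell k) \<noteq> \<infinity>" using fin[of 0 "- lev k"] by (auto simp: top_unique)
  thus "emeasure dt (shell k) = ennreal (measure dt (shell k))" by (simp add: emeasure_eq_ennreal_measure)
  show "measure dt (shell k) = q powi lev k - (if k = 0 then 0 else q powi lev (k - 1))"
  proof (cases "k = 0")
    case False
    hence "measure dt (shell k) = measure dt (cb 0 (- lev k)) - measure dt (cb 0 (- lev (k - 1)))"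
      unfolding shell_def using fin cb_mono[of "- lev k" "- lev (k - 1)" 0]
      by (simp add: measure_Diff)
    also have "\<dots> = q powi lev k - q powi lev (k - 1)" unfolding measure_cb minus_minus ..
    finally show ?thesis using False by simp
  next
    case True
    thus ?thesis using measure_cb[of 0 "- lev 0"] by (simp add: shell_def)
  qed
qed

text \<open>Shell k has volume at most q^(n+k), so a geometric series of ratio q^(p+1) < 1
  dominates. Integrability has to be shown because the integral in \<open>L1_norm\<close> takes the
  value 0 on non-integrable functions.\<close>

lemma mu0_powr_integrable:
  assumes p: "p < - 1"
  shows "integrable dt (\<lambda>t. \<mu>0 t powr p)"
proof (rule integrableI_nonneg)
  show "(\<lambda>t. \<mu>0 t powr p) \<in> borel_measurable dt" using mu0_measurable by measurable
  have "(\<integral>\<^sup>+t. ennreal (\<mu>0 t powr p) \<partial>dt) = (\<integral>\<^sup>+t. (\<Sum>k. ennreal ((q powr p) ^ k) * indicator (shell k) t) \<partial>dt)"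
  proof (rule nn_integral_cong)
    fix t
    obtain j where j: "\<mu>0 t = q ^ j" "\<And>k. t \<in> shell k \<longleftrightarrow> k = j" using mem_shell by blast
    have "(\<Sum>k. ennreal ((q powr p) ^ k) * indicator (shell k) t) = (\<Sum>k\<in>{j}. ennreal ((q powr p) ^ k) * indicator (shell k) t)"
      by (rule suminf_finite) (auto simp: j(2))
    thus "ennreal (\<mu>0 t powr p) = (\<Sum>k. ennreal ((q powr p) ^ k) * indicator (shell k) t)"
      by (simp add: j powr_powr mult.commute flip: powr_realpow)
  qed
  also have "\<dots> = (\<Sum>k. ennreal ((q powr p) ^ k) * emeasure dt (shell k))"
    by (subst nn_integral_suminf) (simp_all add: nn_integral_cmult_indicator)
  also have "\<dots> \<le> (\<Sum>k. ennreal (q powi N * (q powr (p + 1)) ^ k))"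
  proof (rule suminf_le)
    fix k
    have "measure dt (shell k) \<le> q powi lev k" unfolding measure_shell(2) by simp
    hence "(q powr p) ^ k * measure dt (shell k) \<le> (q powr p) ^ k * q powi lev k" by (intro mult_left_mono) auto
    also have "\<dots> = q powi N * (q powr (p + 1)) ^ k"
      by (simp add: power_int_add powr_add power_mult_distrib abs_of_pos)
    finally show "ennreal ((q powr p) ^ k) * emeasure dt (shell k) \<le> ennreal (q powi N * (q powr (p + 1)) ^ k)"
      unfolding measure_shell(1) by (subst ennreal_mult[symmetric]) (auto intro!: ennreal_leI)
  qed auto
  also have "\<dots> < \<infinity>"
  proof -
    have "q powr (p + 1) < q powr 0" using p by (intro powr_less_mono) auto
    hence "summable (\<lambda>k. q powi N * (q powr (p + 1)) ^ k)" by (intro summable_mult summable_geometric) simp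
    moreover have "0 \<le> q powi N * (q powr (p + 1)) ^ k" for k by (intro mult_nonneg_nonneg q_powi_pos zero_le_power powr_ge_zero)
    ultimately have "(\<Sum>k. ennreal (q powi N * (q powr (p + 1)) ^ k)) = ennreal (\<Sum>k. q powi N * (q powr (p + 1)) ^ k)"
      by (intro suminf_ennreal2)
    thus ?thesis by (simp only: infinity_ennreal_def ennreal_less_top)
  qed
  finally show "(\<integral>\<^sup>+t. ennreal (\<mu>0 t powr p) \<partial>dt) < \<infinity>" .
qed simp

lemma sum_shell_le_L1_norm:
  assumes p: "p < - 1"
  shows "(\<Sum>k\<le>K. (q powr p) ^ k * measure dt (shell k)) \<le> L1_norm dt (\<lambda>t. \<mu>0 t powr p)"
proof -
  have int: "integrable dt (indicator (shell k) :: 'k \<Rightarrow> real)" for k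
    by (rule integrable_real_indicator) (simp_all add: measure_shell(1))
  have "(\<Sum>k\<le>K. (q powr p) ^ k * measure dt (shell k)) = (\<Sum>k\<le>K. \<integral>t. (q powr p) ^ k * indicator (shell k) t \<partial>dt)"
    by (simp add: int)
  also have "\<dots> = (\<integral>t. (\<Sum>k\<le>K. (q powr p) ^ k * indicator (shell k) t) \<partial>dt)"
    by (rule Bochner_Integration.integral_sum[symmetric]) (intro integrable_mult_right int)
  also have "\<dots> \<le> (\<integral>t. \<bar>\<mu>0 t powr p\<bar> \<partial>dt)"
  proof (rule integral_mono)
    show "integrable dt (\<lambda>t. \<Sum>k\<le>K. (q powr p) ^ k * indicator (shell k) t)"
      by (intro Bochner_Integration.integrable_sum integrable_mult_right int)
    show "integrable dt (\<lambda>t. \<bar>\<mu>0 t powr p\<bar>)" using mu0_powr_integrable[OF p] by simp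
    fix t
    obtain j where j: "\<mu>0 t = q ^ j" "\<And>k. t \<in> shell k \<longleftrightarrow> k = j" using mem_shell by blast
    have "(\<Sum>k\<le>K. (q powr p) ^ k * indicator (shell k) t) = (\<Sum>k\<le>K. if k = j then (q powr p) ^ k else 0)"
      by (intro sum.cong) (auto simp: indicator_def j(2))
    also have "\<dots> \<le> (q powr p) ^ j" by simp
    also have "\<dots> = \<bar>\<mu>0 t powr p\<bar>"
      unfolding j(1) by (simp add: powr_powr mult.commute flip: powr_realpow)
    finally show "(\<Sum>k\<le>K. (q powr p) ^ k * indicator (shell k) t) \<le> \<bar>\<mu>0 t powr p\<bar>" .
  qed
  finally show ?thesis by (simp add: L1_norm_def)
qed

text \<open>For k >= 1 the volume of shell k is q^(n+k) - q^(n+k-1), and with n >= 1 its product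
  with q^k dominates q^k + q^(k-1). The extra factor q^k is what raises the exponent from s to s +
  1.\<close>

lemma shell_sum_le:
  assumes s: "s < - 2"
  shows "(\<Sum>k\<le>K. (q powr s) ^ k * (q ^ k + (if k = 0 then 0 else q ^ (k - 1))))
    \<le> q ^ n + L1_norm dt (\<lambda>t. \<mu>0 t powr (s + 1))"
proof -
  have "(\<Sum>k\<le>K. (q powr s) ^ k * (q ^ k + (if k = 0 then 0 else q ^ (k - 1))))
      \<le> (\<Sum>k\<le>K. (q powr (s + 1)) ^ k * measure dt (shell k))"
  proof (rule sum_mono)
    fix k
    have "q ^ k + (if k = 0 then 0 else q ^ (k - 1)) \<le> q ^ k * measure dt (shell k)"
    proof (cases k)
      case 0
      have "1 \<le> q ^ n" by (intro one_le_power less_imp_le q_gt_1)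
      thus ?thesis using 0 by (simp add: measure_shell(2))
    next
      case (Suc j)
      have "lev k = int (n + k)" "lev (k - 1) = int (n + j)" using Suc by auto
      hence m: "measure dt (shell k) = q ^ (n + k) - q ^ (n + j)" using Suc unfolding measure_shell(2) by (simp only: power_int_of_nat) simp
      \<comment> \<open>q + 1 <= 2 q, and the cofactor of q on the right is at least 2 because q^n
        >= 2 and q - 1 >= 1.\<close>
      have ineq: "q + 1 \<le> q * (q ^ j * q ^ n * (q - 1))"
      proof -
        have "2 \<le> q ^ n"
        proof -
          have "q ^ 1 \<le> q ^ n" by (rule power_increasing[OF n_pos]) (simp add: less_imp_le)
          thus ?thesis using q_ge_2 by simp
        qed
        hence "1 * 2 * 1 \<le> q ^ j * q ^ n * (q - 1)"
          using q_ge_2 by (intro mult_mono one_le_power) auto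
        hence "q * 2 \<le> q * (q ^ j * q ^ n * (q - 1))" by (intro mult_left_mono) (simp_all add: less_imp_le)
        moreover have "q + 1 \<le> q * 2" using q_ge_2 by simp
        ultimately show ?thesis by (rule order_trans[rotated])
      qed
      have "q ^ j * (q + 1) \<le> q ^ j * (q * (q ^ j * q ^ n * (q - 1)))" using ineq by (intro mult_left_mono) (simp_all add: less_imp_le)
      thus ?thesis unfolding m using Suc by (simp add: power_add algebra_simps)
    qed
    hence "(q powr s) ^ k * (q ^ k + (if k = 0 then 0 else q ^ (k - 1))) \<le> (q powr s) ^ k * (q ^ k * measure dt (shell k))"
      by (intro mult_left_mono) auto
    also have "\<dots> = (q powr (s + 1)) ^ k * measure dt (shell k)" by (simp add: powr_add power_mult_distrib abs_of_pos)
    finally show "(q powr s) ^ k * (q ^ k + (if k = 0 then 0 else q ^ (k - 1))) \<le> (q powr (s + 1)) ^ k * measure dt (shell k)" .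
  qed
  also have "\<dots> \<le> L1_norm dt (\<lambda>t. \<mu>0 t powr (s + 1))" using s by (intro sum_shell_le_L1_norm) simp
  finally show ?thesis using q_pos by (simp add: add_increasing less_imp_le)
qed

lemma quantization_bound:
  assumes F: "F \<in> distr_X" and s: "s < - 2" and L: "in_Linf_X (J (- s) F)"
    and f: "f1 \<in> test_U" "f2 \<in> test_U"
  shows "cmod (quantization F f2 f1) \<le> (q ^ n + L1_norm dt (\<lambda>t. \<mu>0 t powr (s + 1)))
    * Linf_norm_X (J (- s) F) * norm2 f1 * norm2 f2"
proof -
  let ?L = "Linf_norm_X (J (- s) F)" and ?W = "Wig f1 f2"
  obtain K where K: "lc K f1" "lc K f2" using f by (rule test_U_common_level)
  have W: "?W \<in> test_X" using f by (rule W_test)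
  have "F ?W = J (- s) F (J_test s ?W)"
    using J_apply[OF J_test_test[OF W], of "- s" F s] J_test_J_test[OF W, of "- s" s] J_test_0[OF W] by simp
  hence "cmod (F ?W) \<le> ?L * L1_X (J_test s ?W)"
    using in_Linf_apply_le(1)[OF L J_test_test[OF W]] by simp
  also have "\<dots> \<le> ?L * ((q ^ n + L1_norm dt (\<lambda>t. \<mu>0 t powr (s + 1))) * (q powi (- N) * norm2 f1 * norm2 f2))"
  proof (intro mult_left_mono)
    have "0 \<le> q powi (- N) * norm2 f1 * norm2 f2" by simp
    from mult_right_mono[OF shell_sum_le[OF s] this]
    show "L1_X (J_test s ?W) \<le> (q ^ n + L1_norm dt (\<lambda>t. \<mu>0 t powr (s + 1))) * (q powi (- N) * norm2 f1 * norm2 f2)"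
      using L1_X_J_test_W_le[OF K, of s] by (rule order_trans[rotated])
    show "0 \<le> ?L" using L W by (rule in_Linf_apply_le(2))
  qed
  finally have "q ^ n * cmod (F ?W) \<le> q ^ n * (?L * ((q ^ n + L1_norm dt (\<lambda>t. \<mu>0 t powr (s + 1))) * (q powi (- N) * norm2 f1 * norm2 f2)))"
    by (intro mult_left_mono) (simp_all add: less_imp_le)
  also have "\<dots> = (q ^ n * q powi (- N)) * ((q ^ n + L1_norm dt (\<lambda>t. \<mu>0 t powr (s + 1))) * ?L * norm2 f1 * norm2 f2)"
    by (simp only: mult_ac)
  also have "q ^ n * q powi (- N) = 1" using power_int_add[of q N "- N"] by simp
  finally show ?thesis using f by (simp add: quantization_def absk_theta norm_mult norm_power abs_of_pos)
qed

section \<open>Bilinearity of Wigner functions and linearity of the quantization\<close>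

lemma W_integrable:
  assumes a: "a \<in> test_U" and b: "b \<in> test_U" and u: "u \<in> U"
  shows "integrable U_measure (\<lambda>x. a x * (b (u * u * inverse x) * \<Psi> (\<theta> * t * \<phi> (u * inverse x))))"
proof -
  obtain K where K: "lc K a" "lc K b" using a b by (rule test_U_common_level)
  obtain m where m: "lev K \<le> m" "absk (\<theta> * t) \<le> q powi m" using ex_powi_bound by blast
  show ?thesis
  proof (rule I_integrable[of m], rule loc_constI)
    fix x y assume xy: "x \<in> U" "y \<in> U" "x \<in> cb y m"
    have "u * u * inverse x \<in> cb (u * u * inverse y) m" using u xy by (intro congr_intros) auto
    hence "b (u * u * inverse x) = b (u * u * inverse y)"
      using u xy by (intro loc_constD[OF loc_const_mono[OF K(2) m(1)]] U_intros) auto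
    moreover have "u * inverse x \<in> cb (u * inverse y) m" using u xy by (intro congr_intros) auto
    hence "\<phi> (u * inverse x) \<in> cb (\<phi> (u * inverse y)) m"
      using phi_diff[of "u * inverse x" "u * inverse y"] u xy by (simp add: cb_def U_intros)
    hence "\<Psi> (\<theta> * t * \<phi> (u * inverse x)) = \<Psi> (\<theta> * t * \<phi> (u * inverse y))" by (rule char_mult_cong[OF m(2)])
    moreover have "a x = a y" by (rule loc_constD[OF loc_const_mono[OF K(1) m(1)] xy])
    ultimately show "a x * (b (u * u * inverse x) * \<Psi> (\<theta> * t * \<phi> (u * inverse x)))
      = a y * (b (u * u * inverse y) * \<Psi> (\<theta> * t * \<phi> (u * inverse y)))" by simp
  qed
qed

lemma W_add_left:
  assumes "a \<in> test_U" "a' \<in> test_U" "b \<in> test_U"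
  shows "Wig (a + a') b = Wig a b + Wig a' b"
proof (rule X_ext)
  fix u t assume u: "u \<in> U"
  show "Wig (a + a') b (u, cls t) = (Wig a b + Wig a' b) (u, cls t)"
    using Bochner_Integration.integral_add[OF W_integrable[OF assms(1,3) u, of t] W_integrable[OF assms(2,3) u, of t]]
    unfolding plus_fun_apply[of "W _ _"] W_eq[OF u] by (simp add: algebra_simps)
qed (simp add: W_def)

lemma W_scale_left: "Wig (c *\<^sub>c a) b = c *\<^sub>c Wig a b"
proof (rule X_ext)
  fix u t assume u: "u \<in> U"
  show "Wig (c *\<^sub>c a) b (u, cls t) = (c *\<^sub>c Wig a b) (u, cls t)"
    unfolding cscale_fun_def cscale_complex_def W_eq[OF u] by (simp add: mult.assoc)
qed (simp add: W_def cscale_fun_def cscale_complex_def)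

lemma W_add_right:
  assumes "a \<in> test_U" "b \<in> test_U" "b' \<in> test_U"
  shows "Wig a (b + b') = Wig a b + Wig a b'"
proof (rule X_ext)
  fix u t assume u: "u \<in> U"
  show "Wig a (b + b') (u, cls t) = (Wig a b + Wig a b') (u, cls t)"
    using Bochner_Integration.integral_add[OF W_integrable[OF assms(1,2) u, of t] W_integrable[OF assms(1,3) u, of t]]
    unfolding plus_fun_apply[of "W _ _"] W_eq[OF u] by (simp add: algebra_simps)
qed (simp add: W_def)

lemma W_scale_right: "Wig a (c *\<^sub>c b) = c *\<^sub>c Wig a b"
proof (rule X_ext)
  fix u t assume u: "u \<in> U"
  show "Wig a (c *\<^sub>c b) (u, cls t) = (c *\<^sub>c Wig a b) (u, cls t)"
    unfolding cscale_fun_def cscale_complex_def W_eq[OF u]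
    by (simp add: mult.assoc mult.left_commute[of _ c])
qed (simp add: W_def cscale_fun_def cscale_complex_def)

text \<open>Since linear maps on test functions are automatically continuous, the claim reduces to
  bilinearity of the Wigner function and linearity of F.\<close>

lemma quantization_operator:
  assumes F: "F \<in> distr_X"
  shows "quantization F \<in> distribution_operators U_top"
proof (rule distribution_operatorsI)
  note lin = distributions_linear[OF F]
  show "clinear_on test_U (quantization F)"
    unfolding clinear_on_def
  proof (intro conjI ballI allI ext)
    fix f g h assume fg: "f \<in> test_U" "g \<in> test_U"
    show "quantization F (f + g) h = (quantization F f + quantization F g) h"
      using clinear_on_add[OF lin W_test W_test, of h f h g] fg
      by (simp add: quantization_def test_functions_add W_add_right distrib_left)
  next
    fix c f h assume f: "f \<in> test_U"
    show "quantization F (c *\<^sub>c f) h = (c *\<^sub>c quantization F f) h"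
      using clinear_on_scale[OF lin W_test, of h f c] f
      by (simp add: quantization_def test_functions_scale W_scale_right cscale_fun_def[of c "quantization F f"] cscale_complex_def)
  qed
  show "quantization F f = 0" if "f \<notin> test_U" for f
    using that by (simp add: quantization_def fun_eq_iff)
  fix f assume f: "f \<in> test_U"
  show "quantization F f \<in> distributions U_top"
  proof (rule distributionsI)
    show "clinear_on test_U (quantization F f)"
      unfolding clinear_on_def
    proof (intro conjI ballI allI)
      fix g h assume gh: "g \<in> test_U" "h \<in> test_U"
      have "Wig (g + h) f = Wig g f + Wig h f"
        using gh f by (rule W_add_left)
      hence "F (Wig (g + h) f) = F (Wig g f) + F (Wig h f)"
        using clinear_on_add[OF lin W_test[OF gh(1) f] W_test[OF gh(2) f]] by argo
      thus "quantization F f (g + h) = quantization F f g + quantization F f h"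
        using gh f test_functions_add[OF gh] unfolding quantization_def by (simp only: distrib_left simp_thms if_True)
    next
      fix c g assume g: "g \<in> test_U"
      have "F (Wig (c *\<^sub>c g) f) = c * F (Wig g f)"
        unfolding W_scale_left using clinear_on_scale[OF lin W_test[OF g f]] by (simp add: cscale_complex_def)
      thus "quantization F f (c *\<^sub>c g) = c *\<^sub>c quantization F f g"
        using g f test_functions_scale[OF g] unfolding quantization_def cscale_complex_def
        by (simp only: mult.left_commute simp_thms if_True)
    qed
  qed (simp add: quantization_def)
qed

section \<open>Boundedness and continuity on the symbol space\<close>

lemma symbol_space_distribution: "F \<in> symbol_space \<Longrightarrow> F \<in> distr_X"
  by (simp add: symbol_space_def)

text \<open>The symbol space offers a natural exponent above s, and essential boundedness descends
  to smaller exponents.\<close>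

lemma symbol_space_in_Linf:
  assumes F: "F \<in> symbol_space"
  shows "in_Linf_X (J s F)"
proof -
  have "s \<le> real (nat \<lceil>s\<rceil>)" by linarith
  moreover have "in_Linf_X (J (real (nat \<lceil>s\<rceil>)) F)" using F by (simp add: symbol_space_def)
  ultimately show ?thesis by (rule in_Linf_J_mono(1)[OF symbol_space_distribution[OF F]])
qed

lemma L1_norm_nonneg: "0 \<le> L1_norm M f"
  by (simp add: L1_norm_def)

lemma quantization_bounded:
  assumes F: "F \<in> symbol_space"
  shows "quantization F \<in> bounded_ops"
proof -
  note FD = symbol_space_distribution[OF F]
  \<comment> \<open>Any s < -2 gives a bound here; -3 is an integer, so that the same choice later
    selects the seminorm with j = 3.\<close>
  have L: "in_Linf_X (J (- (- 3)) F)" using F by (rule symbol_space_in_Linf)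
  let ?K = "(q ^ n + L1_norm dt (\<lambda>t. \<mu>0 t powr (- 3 + 1))) * Linf_norm_X (J (- (- 3)) F)"
  have "\<exists>A. is_L2_extension U_top U_measure (quantization F) A"
  proof (rule bounded_form_L2_extension[OF quantization_operator[OF FD]])
    show "0 \<le> ?K"
      using in_Linf_apply_le(2)[OF L test_functions_zero] by (intro mult_nonneg_nonneg add_nonneg_nonneg L1_norm_nonneg) (simp_all add: less_imp_le)
    show "cmod (quantization F f2 f1) \<le> ?K * norm2 f1 * norm2 f2" if "f1 \<in> test_U" "f2 \<in> test_U" for f1 f2
      by (rule quantization_bound[OF FD _ L that]) simp
  qed
  thus ?thesis using quantization_operator[OF FD] by (simp add: bounded_operators_def)
qed

lemma operator_norm_quantization_le:
  assumes F: "F \<in> symbol_space" and s: "s < - 2"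
  shows "opnorm (quantization F)
    \<le> (q ^ n + L1_norm dt (\<lambda>t. \<mu>0 t powr (s + 1))) * Linf_norm_X (J (- s) F)"
proof (rule operator_norm_le[OF quantization_bounded[OF F]])
  note L = symbol_space_in_Linf[OF F, of "- s"]
  show "0 \<le> (q ^ n + L1_norm dt (\<lambda>t. \<mu>0 t powr (s + 1))) * Linf_norm_X (J (- s) F)"
    using in_Linf_apply_le(2)[OF L test_functions_zero] by (intro mult_nonneg_nonneg add_nonneg_nonneg L1_norm_nonneg) (simp_all add: less_imp_le)
qed (rule quantization_bound[OF symbol_space_distribution[OF F] s symbol_space_in_Linf[OF F]])

lemma in_Linf_diff:
  assumes S: "S \<in> distr_X" "in_Linf_X S"
    and T: "T \<in> distr_X" "in_Linf_X T"
  shows "in_Linf_X (S - T)"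
proof -
  let ?C = "Linf_norm_X S + Linf_norm_X T"
  have "0 \<le> ?C" using in_Linf_apply_le(2)[OF S(2) test_functions_zero] in_Linf_apply_le(2)[OF T(2) test_functions_zero] by simp
  moreover have "cmod ((S - T) f) \<le> ?C * L1_X f" if "f \<in> test_X" for f
    using in_Linf_apply_le(1)[OF S(2) that] in_Linf_apply_le(1)[OF T(2) that] norm_triangle_ineq4[of "S f" "T f"]
    by (simp add: distrib_right)
  ultimately have "\<exists>h. h \<in> borel_measurable X_measure \<and> (\<forall>x. cmod (h x) \<le> ?C) \<and>
    S - T = function_distr_X h"
    by (rule bounded_distribution_in_Linf[OF distributions_diff[OF S(1) T(1)]]) blast+
  then obtain h where h: "h \<in> borel_measurable X_measure" "\<forall>x. cmod (h x) \<le> ?C"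
    "S - T = function_distr_X h" by blast
  show ?thesis unfolding in_Linf_def
    by (intro exI[of _ h] exI[of _ ?C] conjI AE_I2 h(1,3)) (use h(2) in blast)
qed

lemma J_diff: "J s (F - G) = J s F - J s G"
  by (simp add: J_def fun_eq_iff)

lemma Linf_norm_J_zero: "Linf_norm_X (J s 0) = 0"
proof (rule antisym)
  have J0: "J s 0 = function_distr_X (\<lambda>_. 0)"
    by (simp add: J_def distribution_of_function_def fun_eq_iff)
  show "Linf_norm_X (J s 0) \<le> 0"
    by (rule Linf_norm_le[OF _ _ _ J0]) simp_all
  have "in_Linf_X (J s 0)" unfolding in_Linf_def using J0 by (intro exI[of _ "\<lambda>_. 0"] exI[of _ 0]) simp
  thus "0 \<le> Linf_norm_X (J s 0)" using test_functions_zero by (rule in_Linf_apply_le(2))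
qed

text \<open>The estimate at s = -3 is governed by the single seminorm j = 3. A ball in the target
  may be centred at any bounded operator, so the difference of two symbols is used as a perturbation
  of the distance to that centre.\<close>

lemma quantization_continuous:
  "continuous_map symbol_topology (bounded_operator_topology U_top U_measure) quantization"
  unfolding symbol_topology_def bounded_operator_topology_def
proof (rule continuous_map_seminorm_topologyI)
  show "quantization ` symbol_space \<subseteq> bounded_ops" using quantization_bounded by blast
  fix r assume r: "r \<in> {opnorm}"
  let ?p = "\<lambda>F. Linf_norm_X (J (real 3) F)"
  let ?K = "q ^ n + L1_norm dt (\<lambda>t. \<mu>0 t powr (- 3 + 1))"
  have "opnorm (quantization G - T) \<le> opnorm (quantization F - T) + ?K * ?p (G - F)"
    if T: "T \<in> bounded_ops" and F: "F \<in> symbol_space" and G: "G \<in> symbol_space" for T F G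
  proof (rule operator_norm_triangle_diff[OF T quantization_bounded[OF G] quantization_bounded[OF F]])
    note FD = symbol_space_distribution[OF F] and GD = symbol_space_distribution[OF G]
    have L: "in_Linf_X (J (- (- 3)) (G - F))"
      unfolding J_diff by (intro in_Linf_diff J_distribution FD GD symbol_space_in_Linf F G)
    show "0 \<le> ?K * ?p (G - F)"
      using in_Linf_apply_le(2)[OF L test_functions_zero] by (intro mult_nonneg_nonneg add_nonneg_nonneg L1_norm_nonneg) (simp_all add: less_imp_le)
    fix f1 f2 assume f: "f1 \<in> test_U" "f2 \<in> test_U"
    have "quantization G f2 f1 - quantization F f2 f1 = quantization (G - F) f2 f1"
      by (simp add: quantization_def right_diff_distrib)
    also have "cmod \<dots> \<le> ?K * Linf_norm_X (J (- (- 3)) (G - F)) * norm2 f1 * norm2 f2"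
      by (rule quantization_bound[OF distributions_diff[OF GD FD] _ L f]) simp
    finally show "cmod (quantization G f2 f1 - quantization F f2 f1) \<le> ?K * ?p (G - F) * norm2 f1 * norm2 f2"
      by (simp only: minus_minus of_nat_numeral)
  qed
  moreover have "0 \<le> ?K" by (intro add_nonneg_nonneg L1_norm_nonneg) (simp add: less_imp_le)
  moreover have "?p 0 = 0" by (rule Linf_norm_J_zero)
  moreover have "?p \<in> {\<lambda>F. Linf_norm_X (J (real j) F) | j. True}" by blast
  moreover have "r = opnorm" using r by simp
  ultimately show "\<exists>p\<in>{\<lambda>F. Linf_norm_X (J (real j) F) | j. True}. \<exists>K\<ge>0. p 0 = 0 \<and>
      (\<forall>x\<in>bounded_ops. \<forall>y0\<in>symbol_space. \<forall>y\<in>symbol_space.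
        r (quantization y - x) \<le> r (quantization y0 - x) + K * p (y - y0))"
    by (intro bexI[of _ ?p] exI[of _ ?K]) blast+
qed

lemma quantization_linear: "clinear_on (distr_X) quantization"
  unfolding clinear_on_def
  by (auto simp: fun_eq_iff quantization_def cscale_fun_def cscale_complex_def algebra_simps)

end

theorem theorem4p12:
  fixes \<pi> :: "'k::nonarch_local_field"
    and dt :: "'k measure"
    and \<Psi> :: "'k \<Rightarrow> complex"
    and n :: nat
    and \<theta> :: 'k
  defines "U_top \<equiv> local_field_quantization.U_top \<pi> n"
    and "X_top \<equiv> local_field_quantization.X_top \<pi> n"
    and "U_measure \<equiv> local_field_quantization.U_measure \<pi> dt n"
    and "X_measure \<equiv> local_field_quantization.X_measure \<pi> dt n"
    and "\<Omega>\<^sub>\<theta> \<equiv> local_field_quantization.quantization \<pi> dt \<Psi> n \<theta>"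
    and "\<B>X \<equiv> local_field_quantization.symbol_space \<pi> dt \<Psi> n"
    and "\<B>X_top \<equiv> local_field_quantization.symbol_topology \<pi> dt \<Psi> n"
    and "J \<equiv> local_field_quantization.J \<pi> dt \<Psi> n"
    and "\<mu>0 \<equiv> local_field_quantization.\<mu>0 \<pi> n"
    and "q \<equiv> local_field_quantization.q TYPE('k)"
  assumes "local_field_quantization \<pi> dt \<Psi>"
    and "CHAR('k) \<noteq> 2"
    and "\<not> extends_Qp 2 TYPE('k)"
    and "n \<ge> 1"
    and "absk \<theta> = 1"
  shows "\<Omega>\<^sub>\<theta> ` distributions X_top \<subseteq> distribution_operators U_top \<and>
    clinear_on (distributions X_top) \<Omega>\<^sub>\<theta> \<and>
    continuous_map \<B>X_top (bounded_operator_topology U_top U_measure) \<Omega>\<^sub>\<theta> \<and>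
    (\<forall>s::real. s < - 2 \<longrightarrow> (\<forall>F\<in>\<B>X.
       in_Linf X_top X_measure (J (- s) F) \<and>
       operator_norm U_top U_measure (\<Omega>\<^sub>\<theta> F)
         \<le> (q ^ n + L1_norm dt (\<lambda>t. \<mu>0 t powr (s + 1))) * Linf_norm X_top X_measure (J (- s) F)))"
proof -
  \<comment> \<open>The two hypotheses on the field are exchanged for |2| = 1 at this point.\<close>
  interpret odd_quantization \<pi> dt \<Psi> n \<theta>
    using assms(11,14,15) absk_2_eq_1[OF assms(12,13)]
    by (intro odd_quantization.intro odd_quantization_axioms.intro)
  show ?thesis
    unfolding assms(1-10)
    using quantization_operator quantization_linear quantization_continuous
      symbol_space_in_Linf operator_norm_quantization_le by blast
qed

end
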